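(* Let $k$ be a field of characteristic $2$ and let $C/k$ be an elliptic curve in split $\mu_4$-normal form, i.e. for some $c\in k$, $C$ is the curve in $\mathbb{P}^3$ $$(X_0+X_2)^2=c^2X_1X_3,\qquad (X_1+X_3)^2=c^2X_0X_2,$$ with identity $\mathrm{O}=(c:1:0:1)$. Then: 1. The embedding divisor class of $C$ is $4(\mathrm{O})$. 2. The point $T=(1:c:1:0)$ is a rational $4$-torsion point. 3. The translation-by-$T$ and inverse morphisms are given by $$\tau_T(X_0:X_1:X_2:X_3)=(X_3:X_0:X_1:X_2),\qquad [-1](X_0:X_1:X_2:X_3)=(X_0:X_3:X_2:X_1).$$
   Context: An elliptic curve is a nonsingular projective curve of genus 1 with a chosen rational point $\mathrm{O}$ (so in particular $c\neq 0$ here); $\tau_T(P)=P+T$. Embedding divisor class: if $C\subset\mathbb{P}^r$ is an elliptic curve over $k$ embedded by a complete linear system of degree $d=r+1$, there is a point $S\in C(k)$ such that, for every hyperplane $H$ not containing $C$, the points of $C\cap H$ (over $\bar k$, with multiplicity) sum to $S$ in the group $C$; the embedding divisor class of $C$ is $(d-1)(\mathrm{O})+(S)$. When $S=\mathrm{O}$ and $d=4$ this is $4(\mathrm{O})$. *)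

theory Defs
  imports
    "HOL-Analysis.Cartesian_Space"
    "HOL-Library.Numeral_Type"
    "HOL-Library.Poly_Mapping"
    "HOL-Library.Function_Algebras"
    "HOL-Algebra.FiniteProduct"
    "HOL-Algebra.Algebraic_Closure_Type"
begin

text \<open>
  The projective space of dimension \<open>CARD('n) - 1\<close> over an algebraically closed field is the set
  of classes of nonzero vectors up to scaling. Curves are identified with their sets of geometric
  points; the base field enters through the embedding \<^const>\<open>to_ac\<close> into its algebraic closure.
\<close>

definition proj_class :: "'a::field ^ 'n \<Rightarrow> ('a ^ 'n) set" where
  "proj_class x = {s *s x | s. s \<noteq> 0}"

definition proj_space :: "('a::field ^ 'n) set set" where
  "proj_space = proj_class ` (UNIV - {0})"

definition rational_point :: "('k::field alg_closure ^ 'n) set \<Rightarrow> bool" where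
  "rational_point P \<longleftrightarrow> (\<exists>v :: 'k ^ 'n. v \<noteq> 0 \<and> P = proj_class (\<chi> i. to_ac (v $ i)))"


section \<open>Forms\<close>

text \<open>
  Forms are represented by the functions they induce on vectors. Over an infinite field, such as an
  algebraically closed one, a polynomial is determined by its function. Sums and products of forms
  are the pointwise ones.
\<close>

interpretation fn: vector_space "\<lambda>(a::'a::field) (F :: 'b \<Rightarrow> 'a). (\<lambda>x. a * F x)"
  by unfold_locales (auto simp: fun_eq_iff algebra_simps)

definition form :: "nat \<Rightarrow> ('a::alg_closed_field ^ 'n \<Rightarrow> 'a) \<Rightarrow> bool" where
  "form d F \<longleftrightarrow>
     (\<exists>a. F = (\<lambda>x. \<Sum>m | (\<Sum>i\<in>UNIV. m i) = d. a m * (\<Prod>i\<in>UNIV. (x $ i) ^ m i)))"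

definition form_over_base :: "nat \<Rightarrow> ('k::field alg_closure ^ 'n \<Rightarrow> 'k alg_closure) \<Rightarrow> bool" where
  "form_over_base d F \<longleftrightarrow>
     (\<exists>a :: ('n \<Rightarrow> nat) \<Rightarrow> 'k.
        F = (\<lambda>x. \<Sum>m | (\<Sum>i\<in>UNIV. m i) = d. to_ac (a m) * (\<Prod>i\<in>UNIV. (x $ i) ^ m i)))"

definition vanishes_at :: "('a ^ 'n \<Rightarrow> 'a::zero) \<Rightarrow> ('a ^ 'n) set \<Rightarrow> bool" where
  "vanishes_at F P \<longleftrightarrow> (\<forall>x\<in>P. F x = 0)"

definition vanishes_on :: "('a ^ 'n \<Rightarrow> 'a::zero) \<Rightarrow> ('a ^ 'n) set set \<Rightarrow> bool" where
  "vanishes_on F C \<longleftrightarrow> (\<forall>P\<in>C. vanishes_at F P)"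


section \<open>Multiplicities\<close>

text \<open>Elements of degree \<open>d\<close> of the \<open>n\<close>-th power of the homogeneous ideal of the point \<open>P\<close>.\<close>

definition ideal_power ::
    "('a::alg_closed_field ^ 'n) set \<Rightarrow> nat \<Rightarrow> nat \<Rightarrow> ('a ^ 'n \<Rightarrow> 'a) set" where
  "ideal_power P n d =
     fn.span {A * (\<Prod>i<n. B i) | A B.
       form d (A * (\<Prod>i<n. B i)) \<and> (\<exists>e. form e A) \<and>
       (\<forall>i<n. (\<exists>e. form e (B i)) \<and> vanishes_at (B i) P)}"

text \<open>
  For a form \<open>F\<close> of degree \<open>d\<close>, the following says that \<open>F / M\<close> lies in the \<open>n\<close>-th power of the
  maximal ideal of the local ring of \<open>C\<close> at \<open>P\<close>, where \<open>M\<close> is any form of degree \<open>d\<close> not vanishing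
  at \<open>P\<close>: the form \<open>G\<close> is a denominator that is a unit in the local ring.
\<close>

definition in_max_ideal_power ::
    "('a::alg_closed_field ^ 'n) set set \<Rightarrow> ('a ^ 'n) set \<Rightarrow> nat \<Rightarrow> ('a ^ 'n \<Rightarrow> 'a) \<Rightarrow> bool" where
  "in_max_ideal_power C P n F \<longleftrightarrow>
     (\<exists>d e G H. form d F \<and> form e G \<and> \<not> vanishes_at G P \<and>
        H \<in> ideal_power P n (d + e) \<and> vanishes_on (G * F - H) C)"

text \<open>
  At a nonsingular point of a curve, the largest such \<open>n\<close> is the normalized valuation of \<open>F / M\<close>,
  i.e. the multiplicity of \<open>P\<close> in the intersection of \<open>C\<close> with \<open>F = 0\<close>.
\<close>

definition mult_at ::
    "('a::alg_closed_field ^ 'n) set set \<Rightarrow> ('a ^ 'n) set \<Rightarrow> ('a ^ 'n \<Rightarrow> 'a) \<Rightarrow> nat" where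
  "mult_at C P F = (GREATEST n. in_max_ideal_power C P n F)"


section \<open>Divisors\<close>

type_synonym ('a, 'n) divisor = "('a ^ 'n) set \<Rightarrow>\<^sub>0 int"

definition divisor_on :: "('a ^ 'n) set set \<Rightarrow> ('a, 'n) divisor \<Rightarrow> bool" where
  "divisor_on C D \<longleftrightarrow> Poly_Mapping.keys D \<subseteq> C"

definition effective :: "('a, 'n) divisor \<Rightarrow> bool" where
  "effective D \<longleftrightarrow> (\<forall>P. Poly_Mapping.lookup D P \<ge> 0)"

definition divisor_degree :: "('a, 'n) divisor \<Rightarrow> int" where
  "divisor_degree D = (\<Sum>P\<in>Poly_Mapping.keys D. Poly_Mapping.lookup D P)"

definition div_of_form ::
    "('a::alg_closed_field ^ 'n) set set \<Rightarrow> ('a ^ 'n \<Rightarrow> 'a) \<Rightarrow> ('a, 'n) divisor" where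
  "div_of_form C F = (\<Sum>P | P \<in> C \<and> vanishes_at F P. frag_cmul (int (mult_at C P F)) (frag_of P))"

text \<open>The nonzero rational functions on \<open>C\<close> are the quotients \<open>F / G\<close> of forms of equal degree.\<close>

definition principal :: "('a::alg_closed_field ^ 'n) set set \<Rightarrow> ('a, 'n) divisor \<Rightarrow> bool" where
  "principal C D \<longleftrightarrow>
     (\<exists>d F G. form d F \<and> form d G \<and> \<not> vanishes_on F C \<and> \<not> vanishes_on G C \<and>
        D = div_of_form C F - div_of_form C G)"

definition lin_equiv ::
    "('a::alg_closed_field ^ 'n) set set \<Rightarrow> ('a, 'n) divisor \<Rightarrow> ('a, 'n) divisor \<Rightarrow> bool" where
  "lin_equiv C D E \<longleftrightarrow> principal C (D - E)"

definition divisor_class ::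
    "('a::alg_closed_field ^ 'n) set set \<Rightarrow> ('a, 'n) divisor \<Rightarrow> ('a, 'n) divisor set" where
  "divisor_class C D = {E. divisor_on C E \<and> lin_equiv C E D}"


section \<open>Elliptic curves in projective space\<close>

definition zariski_closed :: "('a::alg_closed_field ^ 'n) set set \<Rightarrow> bool" where
  "zariski_closed C \<longleftrightarrow>
     C = {P \<in> proj_space. \<forall>d F. form d F \<and> vanishes_on F C \<longrightarrow> vanishes_at F P}"

text \<open>The homogeneous ideal of \<open>C\<close> is generated by forms with coefficients in the base field.\<close>

definition defined_over_base :: "('k::field alg_closure ^ 'n) set set \<Rightarrow> bool" where
  "defined_over_base C \<longleftrightarrow>
     (\<forall>d F. form d F \<and> vanishes_on F C \<longrightarrow>
        F \<in> fn.span {G. form_over_base d G \<and> vanishes_on G C})"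

definition irreducible_set :: "('a::alg_closed_field ^ 'n) set set \<Rightarrow> bool" where
  "irreducible_set C \<longleftrightarrow>
     C \<noteq> {} \<and>
     (\<forall>d e F G. form d F \<and> form e G \<and> vanishes_on (F * G) C \<longrightarrow> vanishes_on F C \<or> vanishes_on G C)"

text \<open>
  The formal directional derivative \<open>\<Sum>i. v $ i * (\<partial>F / \<partial>X\<^sub>i) x\<close> is the coefficient of \<open>t\<close> in
  \<open>F (x + t v)\<close>.
\<close>

definition dir_deriv :: "('a::alg_closed_field ^ 'n \<Rightarrow> 'a) \<Rightarrow> 'a ^ 'n \<Rightarrow> 'a ^ 'n \<Rightarrow> 'a" where
  "dir_deriv F x v = Polynomial.coeff (THE p. \<forall>t. poly p t = F (x + t *s v)) 1"

definition tangent_space ::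
    "('a::alg_closed_field ^ 'n) set set \<Rightarrow> 'a ^ 'n \<Rightarrow> ('a ^ 'n) set" where
  "tangent_space C x = {v. \<forall>d F. form d F \<and> vanishes_on F C \<longrightarrow> dir_deriv F x v = 0}"

text \<open>
  Jacobian criterion for a curve: the tangent space of the affine cone, which has one dimension more
  than the curve, is of dimension 2.
\<close>

definition nonsingular_curve :: "('a::alg_closed_field ^ 'n) set set \<Rightarrow> bool" where
  "nonsingular_curve C \<longleftrightarrow> (\<forall>x\<in>\<Union>C. vec.dim (tangent_space C x) = 2)"

text \<open>
  The Hilbert function gives the dimension of the degree \<open>n\<close> part of the homogeneous coordinate
  ring, realised as the space of restrictions of forms to the affine cone of \<open>C\<close>. The Hilbert
  polynomial of a curve of degree \<open>d\<close> and genus \<open>g\<close> is \<open>d n + 1 - g\<close>; conversely, a variety whose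
  Hilbert polynomial has degree 1 is a curve.
\<close>

definition hilbert_function :: "('a::alg_closed_field ^ 'n) set set \<Rightarrow> nat \<Rightarrow> nat" where
  "hilbert_function C n = fn.dim {(\<lambda>x. if x \<in> \<Union>C then F x else 0) | F. form n F}"

definition curve_of_genus :: "('a::alg_closed_field ^ 'n) set set \<Rightarrow> nat \<Rightarrow> bool" where
  "curve_of_genus C g \<longleftrightarrow>
     (\<exists>d>0. \<forall>\<^sub>F n in sequentially. int (hilbert_function C n) = int d * int n + 1 - int g)"

definition elliptic_curve ::
    "('k::field alg_closure ^ 'n) set set \<Rightarrow> ('k alg_closure ^ 'n) set \<Rightarrow> bool" where
  "elliptic_curve C Z \<longleftrightarrow>
     zariski_closed C \<and> defined_over_base C \<and> irreducible_set C \<and>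
     curve_of_genus C 1 \<and> nonsingular_curve C \<and> Z \<in> C \<and> rational_point Z"

text \<open>
  The group of geometric points of an elliptic curve with identity \<open>Z\<close>: the sum of \<open>P\<close> and \<open>Q\<close> is
  the point \<open>R\<close> with \<open>(P) + (Q) \<sim> (R) + (Z)\<close>, that is, the group structure transported from the
  divisor classes of degree 0 along \<open>P \<mapsto> (P) - (Z)\<close>.
\<close>

definition point_group ::
    "('a::alg_closed_field ^ 'n) set set \<Rightarrow> ('a ^ 'n) set \<Rightarrow> ('a ^ 'n) set monoid" where
  "point_group C Z =
     \<lparr>carrier = C,
      monoid.mult = (\<lambda>P Q. THE R. R \<in> C \<and> lin_equiv C (frag_of P + frag_of Q) (frag_of R + frag_of Z)),
      one = Z\<rparr>"


section \<open>The embedding divisor class\<close>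

definition embedded_by_complete_linear_system ::
    "('a::alg_closed_field ^ 'n) set set \<Rightarrow> nat \<Rightarrow> bool" where
  "embedded_by_complete_linear_system C d \<longleftrightarrow>
     (\<forall>H. form 1 H \<and> vanishes_on H C \<longrightarrow> H = 0) \<and>
     (\<forall>H. form 1 H \<and> \<not> vanishes_on H C \<longrightarrow>
        divisor_degree (div_of_form C H) = int d \<and>
        (\<forall>D. divisor_on C D \<and> effective D \<and> lin_equiv C D (div_of_form C H) \<longrightarrow>
           (\<exists>L. form 1 L \<and> \<not> vanishes_on L C \<and> D = div_of_form C L)))"

text \<open>
  The curve has degree \<open>CARD('n)\<close>, one more than the dimension of the ambient space, and \<open>S\<close> is the
  common sum in the group of the points of each hyperplane section.
\<close>

definition is_embedding_divisor_class ::
    "('k::field alg_closure ^ 'n) set set \<Rightarrow> ('k alg_closure ^ 'n) set \<Rightarrow>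
     ('k alg_closure, 'n) divisor set \<Rightarrow> bool" where
  "is_embedding_divisor_class C Z \<D> \<longleftrightarrow>
     embedded_by_complete_linear_system C CARD('n) \<and>
     (\<exists>S\<in>C. rational_point S \<and>
        (\<forall>H. form 1 H \<and> \<not> vanishes_on H C \<longrightarrow>
           finprod (point_group C Z) (\<lambda>P. P [^]\<^bsub>point_group C Z\<^esub> mult_at C P H)
             {P \<in> C. vanishes_at H P} = S) \<and>
        \<D> = divisor_class C (frag_cmul (int CARD('n) - 1) (frag_of Z) + frag_of S))"


section \<open>Split \<open>\<mu>\<^sub>4\<close>-normal form\<close>

text \<open>The indices of type \<^typ>\<open>4\<close> are 0, 1, 2 and 3.\<close>

definition hom_coords :: "'a::field \<Rightarrow> 'a \<Rightarrow> 'a \<Rightarrow> 'a \<Rightarrow> ('a ^ 4) set" where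
  "hom_coords x0 x1 x2 x3 =
     proj_class (\<chi> i. if i = 0 then x0 else if i = 1 then x1 else if i = 2 then x2 else x3)"

definition mu4_curve :: "'k::field \<Rightarrow> ('k alg_closure ^ 4) set set" where
  "mu4_curve c =
     {P \<in> proj_space. \<forall>x\<in>P.
        (x $ 0 + x $ 2)\<^sup>2 = (to_ac c)\<^sup>2 * x $ 1 * x $ 3 \<and>
        (x $ 1 + x $ 3)\<^sup>2 = (to_ac c)\<^sup>2 * x $ 0 * x $ 2}"

definition mu4_O :: "'k::field \<Rightarrow> ('k alg_closure ^ 4) set" where
  "mu4_O c = hom_coords (to_ac c) 1 0 1"

definition mu4_T :: "'k::field \<Rightarrow> ('k alg_closure ^ 4) set" where
  "mu4_T c = hom_coords 1 (to_ac c) 1 0"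

end

theory Submission
  imports Defs
begin

text \<open>
  The first equation is a cone over a conic, and projection from its vertex makes \<open>C\<close> a double cover
  of the conic with coordinates \<open>X\<^sub>1 : X\<^sub>3\<close>, with conjugation \<open>X\<^sub>0 \<leftrightarrow> X\<^sub>2\<close>. As the characteristic is 2,
  the square of a form is on \<open>C\<close> equal to \<open>A(X\<^sub>1, X\<^sub>3) + X\<^sub>0\<^sup>2 B(X\<^sub>1, X\<^sub>3)\<close> for binary forms \<open>A\<close>, \<open>B\<close>, and
  every such expression of even degree is a square. So the square of the norm of a form is a product of linear
  forms in \<open>X\<^sub>1\<close>, \<open>X\<^sub>3\<close>, whose divisors are known explicitly, and this gives the degree of the divisor of
  any form. Dividing \<open>A\<close> and \<open>B\<close> by linear factors and taking a square root shows that \<open>F\<close> is a multiple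
  of \<open>G\<close> on \<open>C\<close> whenever the divisor of \<open>F\<close> exceeds that of \<open>G\<close>, hence the completeness of the
  linear system of planes. The group law then comes from plane sections, which are equivalent to
  \<open>4(O) = div X\<^sub>2\<close>: the inverse of \<open>x\<close> is found on the plane through \<open>x\<close> and tangent at \<open>O\<close>, which has
  the equation \<open>x\<^sub>2(X\<^sub>1 + X\<^sub>3) = (x\<^sub>1 + x\<^sub>3)X\<^sub>2\<close>, and \<open>-(x + T)\<close> is the fourth point
  of the plane through \<open>O\<close>, \<open>T\<close> and \<open>x\<close>.
\<close>

text \<open>Why squares: the conic is parametrised by X1 = s^2, X3 = t^2, X0 + X2 = e s t, and a
  form of degree d restricts to A(s,t) + X0 B(s,t) with deg A = 2d and deg B = 2d - 2. The
  parameters s, t are not among the homogeneous coordinates, but their squares are. In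
  characteristic 2 squaring is additive and injective, so it merely squares the coefficients and
  turns s, t into X1, X3. For the same reason linear forms in X1, X3 vanish to even order
  everywhere.

  Multiplicity is defined as the greatest n with membership in the n-th power of the ideal of a
  point, and a greatest n has to be shown to exist. An explicit linear uniformizer at each point
  turns membership into divisibility with a denominator, and the norm bounds the orders.

  The group operation is a definite description, so sums must be shown to exist and to be unique.
  Existence comes from a fourth intersection point and a negation, uniqueness from completeness of
  the system of planes.\<close>

no_notation fps_nth (infixl "$" 75)

section \<open>Forms\<close>

definition monom_fun :: "('n::finite \<Rightarrow> nat) \<Rightarrow> 'a::comm_monoid_mult ^ 'n \<Rightarrow> 'a" where
  "monom_fun m x = (\<Prod>i\<in>UNIV. (x $ i) ^ m i)"

lemma finite_multidegree: "finite {m :: 'n::finite \<Rightarrow> nat. (\<Sum>i\<in>UNIV. m i) = d}"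
proof (rule finite_subset)
  show "{m :: 'n \<Rightarrow> nat. (\<Sum>i\<in>UNIV. m i) = d} \<subseteq> PiE UNIV (\<lambda>_. {..d})"
    by (auto simp: PiE_UNIV_domain intro: member_le_sum)
qed (auto intro: finite_PiE)

lemma form_iff:
  "form d F \<longleftrightarrow> (\<exists>a. F = (\<lambda>x. \<Sum>m | (\<Sum>i\<in>UNIV. m i) = d. a m * monom_fun m x))"
  by (simp add: form_def monom_fun_def)

lemma form_monom:
  assumes "(\<Sum>i\<in>UNIV. m i) = d"
  shows "form d (\<lambda>x :: 'a::alg_closed_field ^ 'n::finite. c * monom_fun m x)"
proof -
  have "(\<Sum>m' | (\<Sum>i\<in>UNIV. m' i) = d. (if m' = m then c else 0) * monom_fun m' x) = c * monom_fun m x"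
    for x :: "'a ^ 'n"
    using assms by (simp add: finite_multidegree if_distrib[of "\<lambda>y. y * _"] cong: if_cong)
  then show ?thesis
    unfolding form_iff by (intro exI[of _ "\<lambda>m'. if m' = m then c else 0"]) (simp add: fun_eq_iff)
qed

lemma form_add: "form d F \<Longrightarrow> form d G \<Longrightarrow> form d (\<lambda>x. F x + G x)"
  unfolding form_iff
proof (elim exE)
  fix a b
  assume "F = (\<lambda>x. \<Sum>m | sum m UNIV = d. a m * monom_fun m x)"
    and "G = (\<lambda>x. \<Sum>m | sum m UNIV = d. b m * monom_fun m x)"
  then show "\<exists>a. (\<lambda>x. F x + G x) = (\<lambda>x. \<Sum>m | sum m UNIV = d. a m * monom_fun m x)"
    by (intro exI[of _ "\<lambda>m. a m + b m"]) (simp add: distrib_right sum.distrib)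
qed

lemma form_scale: "form d F \<Longrightarrow> form d (\<lambda>x. c * F x)"
  unfolding form_iff
proof (elim exE)
  fix a
  assume "F = (\<lambda>x. \<Sum>m | sum m UNIV = d. a m * monom_fun m x)"
  then show "\<exists>a. (\<lambda>x. c * F x) = (\<lambda>x. \<Sum>m | sum m UNIV = d. a m * monom_fun m x)"
    by (intro exI[of _ "\<lambda>m. c * a m"]) (simp add: sum_distrib_left mult.assoc)
qed

lemma form_zero: "form d (\<lambda>x. 0)"
  unfolding form_iff by (rule exI[of _ "\<lambda>_. 0"]) simp

lemma form_uminus: "form d F \<Longrightarrow> form d (\<lambda>x. - F x)"
  using form_scale[of d F "-1"] by simp

lemma form_diff: "form d F \<Longrightarrow> form d G \<Longrightarrow> form d (\<lambda>x. F x - G x)"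
  using form_add[of d F "\<lambda>x. - G x"] form_uminus[of d G] by simp

lemma form_sum: "(\<And>i. i \<in> I \<Longrightarrow> form d (F i)) \<Longrightarrow> form d (\<lambda>x. \<Sum>i\<in>I. F i x)"
  by (induction I rule: infinite_finite_induct) (auto intro: form_zero form_add)

lemma form_const: "form 0 (\<lambda>x. c)"
  using form_monom[of "\<lambda>_. 0" 0 c] by (simp add: monom_fun_def)

lemma prod_power_single: "(\<Prod>j\<in>UNIV. (x $ j) ^ (if j = i then 1 else 0)) = x $ i"
  for x :: "'a::comm_monoid_mult ^ 'n::finite"
proof -
  have "(\<Prod>j\<in>UNIV. (x $ j) ^ (if j = i then 1 else 0)) = (\<Prod>j\<in>UNIV. if j = i then x $ j else 1)"
    by (rule prod.cong) auto
  then show ?thesis by simp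
qed

lemma form_var: "form 1 (\<lambda>x. x $ i)"
  using form_monom[of "\<lambda>j. if j = i then 1 else 0" 1 1]
  by (simp add: monom_fun_def prod_power_single del: One_nat_def)

lemma form_mult:
  assumes "form d F" "form e G"
  shows "form (d + e) (\<lambda>x. F x * G x)"
proof -
  from assms obtain a b where
    F: "F = (\<lambda>x. \<Sum>m | sum m UNIV = d. a m * monom_fun m x)" and
    G: "G = (\<lambda>x. \<Sum>m | sum m UNIV = e. b m * monom_fun m x)"
    unfolding form_iff by blast
  have "(\<lambda>x. F x * G x) = (\<lambda>x. \<Sum>m | sum m UNIV = d. \<Sum>k | sum k UNIV = e.
      (a m * b k) * monom_fun (\<lambda>i. m i + k i) x)"
    by (simp add: F G sum_product monom_fun_def power_add prod.distrib mult_ac)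
  moreover have "form (d + e) \<dots>"
    by (intro form_sum form_monom) (auto simp: sum.distrib)
  ultimately show ?thesis by simp
qed

lemma form_power: "form d F \<Longrightarrow> form (n * d) (\<lambda>x. F x ^ n)"
  by (induction n) (auto intro: form_mult form_const[of 1])

lemma form_prod: "(\<And>i. i < n \<Longrightarrow> form (d i) (F i)) \<Longrightarrow> form (\<Sum>i<n. d i) (\<lambda>x. \<Prod>i<(n::nat). F i x)"
  by (induction n) (auto intro: form_mult form_const[of 1])

lemma form_induct [consumes 1, case_names const var add]:
  fixes F :: "'a::alg_closed_field ^ 'n::finite \<Rightarrow> 'a"
  assumes "form d F"
    and const: "\<And>c. P 0 (\<lambda>x. c)"
    and var: "\<And>d F i. form d F \<Longrightarrow> P d F \<Longrightarrow> P (Suc d) (\<lambda>x. x $ i * F x)"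
    and add: "\<And>d F G. form d F \<Longrightarrow> form d G \<Longrightarrow> P d F \<Longrightarrow> P d G \<Longrightarrow> P d (\<lambda>x. F x + G x)"
  shows "P d F"
proof -
  have monom: "P d (\<lambda>x. c * monom_fun m x)" if "sum m UNIV = d" for c d and m :: "'n \<Rightarrow> nat"
    using that
  proof (induction d arbitrary: m)
    case 0
    then show ?case using const[of c] by (simp add: monom_fun_def)
  next
    case (Suc d)
    then obtain i where i: "m i \<noteq> 0"
      by (metis sum.neutral nat.distinct(1))
    let ?k = "m(i := m i - 1)"
    have m: "m = (\<lambda>j. (if j = i then 1 else 0) + ?k j)"
      using i by (auto simp: fun_eq_iff)
    have "sum m UNIV = 1 + sum ?k UNIV"
      by (subst m) (simp add: sum.distrib del: fun_upd_apply)
    then have k: "sum ?k UNIV = d" using Suc.prems by simp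
    have "monom_fun m x = x $ i * monom_fun ?k x" for x :: "'a ^ 'n"
      unfolding monom_fun_def
      by (subst m) (simp only: power_add prod.distrib prod_power_single)
    then have "(\<lambda>x :: 'a ^ 'n. c * monom_fun m x) = (\<lambda>x. x $ i * (c * monom_fun ?k x))"
      by (simp add: mult_ac)
    with var[OF form_monom[OF k] Suc.IH[OF k]] show ?case by metis
  qed
  \<comment> \<open>No case of the induction yields the zero form of degree \<open>d\<close>
    directly. It is taken as a monomial of degree \<open>d\<close> with coefficient 0, for which an
    arbitrary index \<open>i\<close> is needed.\<close>
  obtain i :: 'n where True by simp
  have "(\<Sum>j\<in>UNIV. if j = i then d else 0) = d" by simp
  from monom[OF this, of 0] have zero: "P d (\<lambda>x. 0)" by simp
  from assms(1) obtain a where F: "F = (\<lambda>x. \<Sum>m | sum m UNIV = d. a m * monom_fun m x)"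
    unfolding form_iff by blast
  have "form d (\<lambda>x. \<Sum>m\<in>S. a m * monom_fun m x) \<and> P d (\<lambda>x. \<Sum>m\<in>S. a m * monom_fun m x)"
    if "finite S" "S \<subseteq> {m. sum m UNIV = d}" for S
    using that
  proof (induction S)
    case empty
    then show ?case using zero by (simp add: form_zero)
  next
    case (insert m S)
    then show ?case using monom[of m d "a m"] form_monom[of m d "a m"]
      by (auto intro!: add form_add)
  qed
  from this[OF finite_multidegree order_refl] show ?thesis by (simp add: F)
qed

lemma form_homogeneous: "form d F \<Longrightarrow> F (s *s x) = s ^ d * F x"
  by (induction rule: form_induct) (auto simp: algebra_simps)

lemma form_permute:
  assumes "form d F"
  shows "form d (\<lambda>x. F (\<chi> i. x $ f i))"
  using assms
proof (induction rule: form_induct)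
  case (var d F i)
  then show ?case using form_mult[OF form_var[of "f i"], of d] by simp
qed (auto intro: form_const form_add)

text \<open>Forms are functions here, so this rests on the field being algebraically closed: with
  two degrees the nonconstant polynomial 1 + X^d - X^e would take only the value 1 and have no
  root.\<close>

lemma form_degree_unique:
  fixes F :: "'a::alg_closed_field ^ 'n::finite \<Rightarrow> 'a"
  assumes "form d F" "form e F" "F x \<noteq> 0"
  shows "d = e"
proof (rule ccontr)
  assume "d \<noteq> e"
  have eq: "s ^ d = s ^ e" for s :: 'a
    using form_homogeneous[OF assms(1), of s x] form_homogeneous[OF assms(2), of s x] assms(3) by simp
  define p where "p = 1 + Polynomial.monom (1::'a) d - Polynomial.monom 1 e"
  have "poly p s = 1" for s
    by (simp add: p_def poly_monom eq)
  moreover have "poly.coeff p (max d e) \<noteq> 0" "max d e > 0"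
    using \<open>d \<noteq> e\<close> by (auto simp: p_def max_def coeff_1)
  then have "degree p > 0" using le_degree[of p "max d e"] by linarith
  ultimately show False using alg_closed_imp_poly_has_root[of p] by simp
qed

lemma form_1_iff:
  fixes F :: "'a::alg_closed_field ^ 'n::finite \<Rightarrow> 'a"
  shows "form 1 F \<longleftrightarrow> (\<exists>a. F = (\<lambda>x. \<Sum>i\<in>UNIV. a i * x $ i))"
proof
  assume F: "form 1 F"
  \<comment> \<open>The induction runs over all degrees, and a form of degree 1 is a variable times
    a form of degree 0; hence both degrees are treated together.\<close>
  have "(d = 0 \<longrightarrow> (\<exists>c. F = (\<lambda>x. c))) \<and> (d = 1 \<longrightarrow> (\<exists>a. F = (\<lambda>x. \<Sum>i\<in>UNIV. a i * x $ i)))" 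
    if "form d F" for d using that
  proof (induction rule: form_induct)
    case (var k F i)
    show ?case
    proof (intro conjI impI)
      assume "Suc k = 1"
      with var obtain c where "F = (\<lambda>x. c)" by auto
      then show "\<exists>a. (\<lambda>x. x $ i * F x) = (\<lambda>x. \<Sum>j\<in>UNIV. a j * x $ j)"
        by (intro exI[of _ "\<lambda>j. if j = i then c else 0"])
          (simp add: if_distrib[of "\<lambda>y. y * _"] mult.commute[of c] cong: if_cong)
    qed simp
  next
    case (add k F G)
    show ?case
    proof (intro conjI impI)
      assume "k = 1"
      with add obtain a b where "F = (\<lambda>x. \<Sum>i\<in>UNIV. a i * x $ i)" "G = (\<lambda>x. \<Sum>i\<in>UNIV. b i * x $ i)"
        by auto
      then show "\<exists>a. (\<lambda>x. F x + G x) = (\<lambda>x. \<Sum>j\<in>UNIV. a j * x $ j)"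
        by (intro exI[of _ "\<lambda>j. a j + b j"]) (simp add: distrib_right sum.distrib)
    qed (use add in auto)
  qed auto
  with F show "\<exists>a. F = (\<lambda>x. \<Sum>i\<in>UNIV. a i * x $ i)" by auto
next
  assume "\<exists>a. F = (\<lambda>x. \<Sum>i\<in>UNIV. a i * x $ i)"
  then show "form 1 F" by (elim exE) (simp only: form_sum form_scale form_var)
qed

section \<open>Binary forms\<close>

text \<open>Written in Horner form, so that root extraction and products are direct inductions.\<close>

fun bin :: "nat \<Rightarrow> ('a::comm_ring_1 \<Rightarrow> 'a \<Rightarrow> 'a) \<Rightarrow> bool" where
  "bin 0 h \<longleftrightarrow> (\<exists>k. h = (\<lambda>a b. k))"
| "bin (Suc d) h \<longleftrightarrow> (\<exists>f k. bin d f \<and> h = (\<lambda>a b. a * f a b + k * b ^ Suc d))"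

lemma bin_add: "bin d f \<Longrightarrow> bin d g \<Longrightarrow> bin d (\<lambda>a b. f a b + g a b)"
proof (induction d arbitrary: f g)
  case (Suc d)
  then obtain f' k g' l where "bin d f'" "f = (\<lambda>a b. a * f' a b + k * b ^ Suc d)"
    "bin d g'" "g = (\<lambda>a b. a * g' a b + l * b ^ Suc d)" by auto
  with Suc.IH[of f' g'] show ?case
    by (auto intro!: exI[of _ "\<lambda>a b. f' a b + g' a b"] exI[of _ "k + l"] simp: algebra_simps)
qed auto

lemma bin_scale: "bin d f \<Longrightarrow> bin d (\<lambda>a b. c * f a b)"
proof (induction d arbitrary: f)
  case (Suc d)
  then obtain f' k where "bin d f'" "f = (\<lambda>a b. a * f' a b + k * b ^ Suc d)" by auto
  with Suc.IH[of f'] show ?case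
    by (auto intro!: exI[of _ "\<lambda>a b. c * f' a b"] exI[of _ "c * k"] simp: algebra_simps)
qed auto

lemma bin_zero: "bin d (\<lambda>a b. 0)"
proof (induction d)
  case (Suc d)
  then show ?case unfolding bin.simps by (intro exI[of _ "\<lambda>a b. 0"] exI[of _ 0]) simp
qed auto

lemma bin_fst: "bin d f \<Longrightarrow> bin (Suc d) (\<lambda>a b. a * f a b)"
  unfolding bin.simps by (intro exI[of _ f] exI[of _ 0]) simp

lemma bin_snd: "bin d f \<Longrightarrow> bin (Suc d) (\<lambda>a b. b * f a b)"
proof (induction d arbitrary: f)
  case 0
  then obtain k where "f = (\<lambda>a b. k)" by auto
  then show ?case unfolding bin.simps by (intro exI[of _ "\<lambda>a b. 0"] exI[of _ k]) (auto simp: fun_eq_iff)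
next
  case (Suc d)
  then obtain f' k where f': "bin d f'" "f = (\<lambda>a b. a * f' a b + k * b ^ Suc d)" by auto
  have eq: "(\<lambda>a b. b * f a b) = (\<lambda>a b. a * (b * f' a b) + k * b ^ Suc (Suc d))"
    by (simp add: f' algebra_simps)
  show ?case unfolding eq bin.simps(2)[of "Suc d"] using Suc.IH[OF f'(1)] by blast
qed

lemma bin_mult: "bin d f \<Longrightarrow> bin e g \<Longrightarrow> bin (d + e) (\<lambda>a b. f a b * g a b)"
proof (induction d arbitrary: f)
  case 0
  then show ?case by (auto intro: bin_scale)
next
  case (Suc d)
  then obtain f' k where f': "bin d f'" "f = (\<lambda>a b. a * f' a b + k * b ^ Suc d)" by auto
  have pow: "bin (n + e) (\<lambda>a b. b ^ n * g a b)" for n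
  proof (induction n)
    case (Suc n)
    then show ?case using bin_snd[OF Suc] by (simp only: mult.assoc power_Suc add_Suc)
  qed (use Suc.prems in simp)
  have eq: "(\<lambda>a b. f a b * g a b) = (\<lambda>a b. a * (f' a b * g a b) + k * (b ^ Suc d * g a b))"
    by (simp add: f' algebra_simps)
  show ?case unfolding eq 
    using bin_add[OF bin_fst[OF Suc.IH[OF f'(1) Suc.prems(2)]], of "\<lambda>a b. k * (b ^ Suc d * g a b)"]
      bin_scale[OF pow[of "Suc d"], of k] by simp
qed

text \<open>Homogeneous remainder theorem for the factor with root (s : t). The power of
  \<open>t\<close> clears denominators; for t = 0 this gives no division by the factor, and
  \<open>bin_factor_infinity\<close> takes over.\<close>

lemma bin_factor:
  "bin (Suc d) f \<Longrightarrow> \<exists>g. bin d g \<and> (\<forall>a b. f a b * t ^ Suc d - f s t * b ^ Suc d = (a * t - b * s) * g a b)"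
proof (induction d arbitrary: f)
  case 0
  then obtain k l where "f = (\<lambda>a b. a * k + l * b)" by auto
  then show ?case by (intro exI[of _ "\<lambda>a b. k"]) (auto simp: algebra_simps)
next
  case (Suc d)
  obtain f' k where f': "bin (Suc d) f'" "f = (\<lambda>a b. a * f' a b + k * b ^ Suc (Suc d))"
    using Suc.prems unfolding bin.simps(2)[of "Suc d"] by blast
  from Suc.IH[OF f'(1)] obtain g where g: "bin d g"
    "\<And>a b. f' a b * t ^ Suc d - f' s t * b ^ Suc d = (a * t - b * s) * g a b" by blast
  have "f a b * t ^ Suc (Suc d) - f s t * b ^ Suc (Suc d)
      = (a * t - b * s) * (a * (t * g a b) + f' s t * b ^ Suc d)" for a b
  proof -
    have "f a b * t ^ Suc (Suc d) - f s t * b ^ Suc (Suc d)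
      = a * t * (f' a b * t ^ Suc d - f' s t * b ^ Suc d) + f' s t * b ^ Suc d * (a * t - b * s)"
      by (simp add: f' algebra_simps)
    then show ?thesis unfolding g by (simp add: algebra_simps)
  qed
  moreover have "bin (Suc d) (\<lambda>a b. a * (t * g a b) + f' s t * b ^ Suc d)"
    using bin_scale[OF g(1), of t] by auto
  ultimately show ?case by blast
qed

lemma bin_factor_infinity:
  "bin (Suc d) f \<Longrightarrow> f s 0 = 0 \<Longrightarrow> s \<noteq> 0 \<Longrightarrow> \<exists>g. bin d g \<and> (\<forall>a b. f a b = b * g a b)"
  for s :: "'a::idom"
proof (induction d arbitrary: f)
  case 0
  then obtain k l where "f = (\<lambda>a b. a * k + l * b)" by auto
  with 0 show ?case by (intro exI[of _ "\<lambda>a b. l"]) (auto simp: mult.commute)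
next
  case (Suc d)
  obtain f' k where f': "bin (Suc d) f'" "f = (\<lambda>a b. a * f' a b + k * b ^ Suc (Suc d))"
    using Suc.prems unfolding bin.simps(2)[of "Suc d"] by blast
  from Suc.IH[OF f'(1)] Suc.prems f' obtain g where g: "bin d g" "\<And>a b. f' a b = b * g a b" by auto
  have "bin (Suc d) (\<lambda>a b. a * g a b + k * b ^ Suc d)" using g(1) by auto
  moreover have "f a b = b * (a * g a b + k * b ^ Suc d)" for a b
    by (simp add: f' g algebra_simps)
  ultimately show ?case by blast
qed

lemma bin_root_factor:
  fixes s t :: "'a::field"
  assumes "bin (Suc d) f" "f s t = 0" "(s, t) \<noteq> (0, 0)"
  shows "\<exists>g. bin d g \<and> (\<forall>a b. f a b = (a * t - b * s) * g a b)"
proof (cases "t = 0")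
  case True
  with assms bin_factor_infinity[of d f s] obtain g where g: "bin d g" "\<And>a b. f a b = b * g a b" by auto
  with True assms(3) show ?thesis
    by (intro exI[of _ "\<lambda>a b. - inverse s * g a b"] conjI bin_scale) auto
next
  case False
  with assms bin_factor[of d f t s] obtain g where
    g: "bin d g" "\<And>a b. f a b * t ^ Suc d = (a * t - b * s) * g a b" by auto
  have "f a b = (a * t - b * s) * (inverse (t ^ Suc d) * g a b)" for a b
    using g(2)[of a b] False by (simp add: field_simps)
  with g(1) show ?thesis by (blast intro: bin_scale)
qed

lemma bin_poly: "bin d f \<Longrightarrow> \<exists>p. (\<forall>a. f a 1 = poly p a) \<and> degree p \<le> d \<and> poly.coeff p d = f 1 0"
proof (induction d arbitrary: f)
  case 0
  then obtain k where "f = (\<lambda>a b. k)" by auto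
  then show ?case by (intro exI[of _ "[:k:]"]) auto
next
  case (Suc d)
  obtain f' k where f': "bin d f'" "f = (\<lambda>a b. a * f' a b + k * b ^ Suc d)"
    using Suc.prems by auto
  from Suc.IH[OF f'(1)] obtain p where "\<And>a. f' a 1 = poly p a" "degree p \<le> d" "poly.coeff p d = f' 1 0"
    by blast
  with f' show ?case
    by (intro exI[of _ "pCons k p"]) (auto simp: degree_pCons_le intro: order_trans[OF degree_pCons_le])
qed

text \<open>Either (1 : 0) is a root, or the leading coefficient \<open>f 1 0\<close> is nonzero and
  the dehomogenised polynomial has full positive degree.\<close>

lemma bin_has_root:
  fixes f :: "'a::alg_closed_field \<Rightarrow> 'a \<Rightarrow> 'a"
  assumes "bin (Suc d) f"
  shows "\<exists>s t. (s, t) \<noteq> (0, 0) \<and> f s t = 0"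
proof (cases "f 1 0 = 0")
  case False
  from bin_poly[OF assms] obtain p where
    p: "\<And>a. f a 1 = poly p a" "degree p \<le> Suc d" "poly.coeff p (Suc d) = f 1 0" by blast
  with False have "degree p = Suc d" by (metis le_degree le_antisym)
  then obtain a where "poly p a = 0" using alg_closed_imp_poly_has_root[of p] by auto
  with p(1) show ?thesis by (metis prod.inject zero_neq_one)
qed (intro exI[of _ 1] exI[of _ 0], simp)

lemma bin_form: "bin d f \<Longrightarrow> form d (\<lambda>x. f (x $ i) (x $ j))"
proof (induction d arbitrary: f)
  case (Suc d)
  then obtain f' k where f': "bin d f'" "f = (\<lambda>a b. a * f' a b + k * b ^ Suc d)" by auto
  have "form (1 + d) (\<lambda>x. x $ i * f' (x $ i) (x $ j))"
    by (intro form_mult form_var Suc.IH f')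
  moreover have "form (Suc d * 1) (\<lambda>x. k * x $ j ^ Suc d)"
    by (intro form_scale form_power form_var)
  ultimately show ?case using form_add[of "Suc d"] by (simp add: f')
qed (auto intro: form_const)

section \<open>The cone over the curve\<close>

definition vec4 :: "'a \<Rightarrow> 'a \<Rightarrow> 'a \<Rightarrow> 'a \<Rightarrow> 'a ^ 4" where
  "vec4 a b c d = (\<chi> i. if i = 0 then a else if i = 1 then b else if i = 2 then c else d)"

lemma vec4_nth [simp]:
  "vec4 a b c d $ 0 = a" "vec4 a b c d $ 1 = b" "vec4 a b c d $ 2 = c" "vec4 a b c d $ 3 = d"
  by (auto simp: vec4_def)

lemma exhaust_4_0: "(i::4) = 0 \<or> i = 1 \<or> i = 2 \<or> i = 3"
proof -
  have "(4::4) = 0" by simp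
  with exhaust_4[of i] show ?thesis by metis
qed

lemma forall_4_0: "(\<forall>i::4. P i) \<longleftrightarrow> P 0 \<and> P 1 \<and> P 2 \<and> P 3"
  by (metis exhaust_4_0)

lemma sum_4_0: "sum f (UNIV :: 4 set) = f 0 + f 1 + f 2 + f 3"
proof -
  have "(4::4) = 0" by simp
  then show ?thesis by (simp only: sum_4 ac_simps)
qed

lemma vec4_eq_iff: "x = y \<longleftrightarrow> x $ 0 = y $ 0 \<and> x $ 1 = y $ 1 \<and> x $ 2 = y $ 2 \<and> x $ (3::4) = y $ 3"
  by (simp add: vec_eq_iff forall_4_0)

lemma hom_coords_vec4: "hom_coords a b c d = proj_class (vec4 a b c d)"
  by (simp add: hom_coords_def vec4_def)

lemma form_1_vec4:
  fixes L :: "'a::alg_closed_field ^ 4 \<Rightarrow> 'a"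
  shows "form 1 L \<longleftrightarrow> (\<exists>a b c d. L = (\<lambda>x. a * x $ 0 + b * x $ 1 + c * x $ 2 + d * x $ 3))"
proof -
  have "(\<exists>a. L = (\<lambda>x. \<Sum>i\<in>UNIV. a i * x $ i)) \<longleftrightarrow>
      (\<exists>a b c d. L = (\<lambda>x. a * x $ 0 + b * x $ 1 + c * x $ 2 + d * x $ 3))"
  proof
    assume "\<exists>a b c d. L = (\<lambda>x. a * x $ 0 + b * x $ 1 + c * x $ 2 + d * x $ 3)"
    then obtain a b c d where "L = (\<lambda>x. a * x $ 0 + b * x $ 1 + c * x $ 2 + d * x $ 3)" by blast
    then show "\<exists>a. L = (\<lambda>x. \<Sum>i\<in>UNIV. a i * x $ i)"
      by (intro exI[of _ "($) (vec4 a b c d)"]) (simp add: sum_4_0)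
  qed (auto simp: sum_4_0)
  then show ?thesis by (simp only: form_1_iff)
qed

lemma proj_class_self: "x \<in> proj_class x"
  unfolding proj_class_def by (rule CollectI, rule exI[of _ 1]) simp

lemma proj_class_scale: "s \<noteq> 0 \<Longrightarrow> proj_class (s *s x) = proj_class x"
proof -
  assume s: "s \<noteq> 0"
  have "t *s x = (t / s) *s (s *s x)" for t using s by (simp add: vector_smult_assoc)
  moreover have "t *s (s *s x) = (t * s) *s x" for t by (simp add: vector_smult_assoc)
  ultimately show ?thesis using s unfolding proj_class_def
    by (auto simp: vector_smult_assoc) (metis divide_eq_0_iff nonzero_divide_eq_eq)
qed

lemma proj_class_eq_iff: "proj_class x = proj_class y \<longleftrightarrow> (\<exists>s. s \<noteq> 0 \<and> y = s *s x)"
proof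
  assume "proj_class x = proj_class y"
  then have "y \<in> proj_class x" using proj_class_self by blast
  then show "\<exists>s. s \<noteq> 0 \<and> y = s *s x" by (auto simp: proj_class_def)
qed (auto simp: proj_class_scale)

lemma vanishes_at_iff:
  assumes "form d F"
  shows "vanishes_at F (proj_class x) \<longleftrightarrow> F x = 0"
proof
  show "F x = 0" if "vanishes_at F (proj_class x)"
    using that proj_class_self by (auto simp: vanishes_at_def)
qed (auto simp: vanishes_at_def proj_class_def form_homogeneous[OF assms])

text \<open>Everything takes place over the algebraic closure, where \<open>e\<close> will be the
  image of the parameter \<open>c\<close>. Irreducibility makes the homogeneous coordinate ring a
  domain; cancellation and the additivity of orders rest on it.\<close>

locale mu4 =
  fixes e :: "'a::alg_closed_field" and C :: "('a ^ 4) set set"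
  assumes char2: "CHAR('a) = 2"
    and e_nz: "e \<noteq> 0"
    and C_eq: "C = {P \<in> proj_space. \<forall>x\<in>P.
        (x $ 0 + x $ 2)\<^sup>2 = e\<^sup>2 * x $ 1 * x $ 3 \<and> (x $ 1 + x $ 3)\<^sup>2 = e\<^sup>2 * x $ 0 * x $ 2}"
    and irreducible: "irreducible_set C"
begin

lemma two_eq_0: "(2::'a) = 0"
  using of_nat_CHAR[where 'a = 'a] char2 by simp

lemma add_self: "a + a = (0::'a)"
  using two_eq_0 by (metis mult_2 mult_zero_left)

lemma add_self_left: "a + (a + b) = (b::'a)"
  by (simp add: add_self flip: add.assoc)

lemma numeral_even: "numeral (num.Bit0 n) = (0::'a)"
  by (simp only: numeral_Bit0 add_self)

lemma numeral_odd: "numeral (num.Bit1 n) = (1::'a)"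
  by (simp only: numeral_Bit1 add_self add_0_left)

lemmas char2_simps = add_self add_self_left numeral_even numeral_odd
  minus_CHAR_2[OF char2] uminus_CHAR_2[OF char2]

lemma eq_iff_add: "a = b \<longleftrightarrow> a + b = (0::'a)"
  using minus_CHAR_2[OF char2, of a b] by (metis eq_iff_diff_eq_0)

lemma square_add: "(a + b)\<^sup>2 = a\<^sup>2 + (b::'a)\<^sup>2"
  by (simp add: power2_sum two_eq_0)

lemma square_inj: "a\<^sup>2 = (b::'a)\<^sup>2 \<longleftrightarrow> a = b"
  by (metis eq_iff_add square_add zero_eq_power2)

lemma sqrt_exists: "\<exists>s. s\<^sup>2 = (a::'a)"
  using nth_root_exists[of 2 a] by auto

definition cone :: "('a ^ 4) set" where
  "cone = {x. x \<noteq> 0 \<and> (x $ 0 + x $ 2)\<^sup>2 = e\<^sup>2 * x $ 1 * x $ 3 \<and> (x $ 1 + x $ 3)\<^sup>2 = e\<^sup>2 * x $ 0 * x $ 2}"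

lemma coneD:
  assumes "x \<in> cone"
  shows "(x $ 0 + x $ 2)\<^sup>2 = e\<^sup>2 * x $ 1 * x $ 3" "(x $ 1 + x $ 3)\<^sup>2 = e\<^sup>2 * x $ 0 * x $ 2" "x \<noteq> 0"
  using assms by (auto simp: cone_def)

lemma vec4_cone:
  "vec4 a b c d \<in> cone \<longleftrightarrow> (a, b, c, d) \<noteq> (0, 0, 0, 0) \<and> (a + c)\<^sup>2 = e\<^sup>2 * b * d \<and> (b + d)\<^sup>2 = e\<^sup>2 * a * c"
  by (auto simp: cone_def vec4_eq_iff)

lemma cone_scale: "s \<noteq> 0 \<Longrightarrow> s *s x \<in> cone \<longleftrightarrow> x \<in> cone"
proof -
  assume s: "s \<noteq> 0"
  have "(s * a + s * b)\<^sup>2 = e\<^sup>2 * (s * c) * (s * d) \<longleftrightarrow> (a + b)\<^sup>2 = e\<^sup>2 * c * d" for a b c d :: 'a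
  proof -
    have "(s * a + s * b)\<^sup>2 = s\<^sup>2 * (a + b)\<^sup>2" "e\<^sup>2 * (s * c) * (s * d) = s\<^sup>2 * (e\<^sup>2 * c * d)"
      by (simp_all add: power2_eq_square algebra_simps)
    with s show ?thesis by (metis mult_cancel_left power_not_zero)
  qed
  with s show ?thesis by (simp add: cone_def)
qed

lemma proj_class_C: "proj_class x \<in> C \<longleftrightarrow> x \<in> cone"
proof
  assume *: "proj_class x \<in> C"
  then have "proj_class x \<in> proj_space" by (simp add: C_eq)
  then obtain y where "y \<noteq> 0" "proj_class x = proj_class y" by (auto simp: proj_space_def)
  then have "x \<noteq> 0" by (metis proj_class_eq_iff vector_smult_rzero)
  with * show "x \<in> cone" using proj_class_self[of x] by (auto simp: C_eq cone_def)
next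
  assume x: "x \<in> cone"
  then have "y \<in> cone" if "y \<in> proj_class x" for y
    using that by (auto simp: proj_class_def cone_scale)
  with x show "proj_class x \<in> C" by (auto simp: C_eq proj_space_def cone_def)
qed

lemma C_rep:
  assumes "P \<in> C"
  obtains x where "x \<in> cone" "P = proj_class x"
  using assms proj_class_C by (auto simp: C_eq proj_space_def)

lemma C_eq_image: "C = proj_class ` cone"
  by (metis C_rep image_eqI image_subsetI proj_class_C subsetI subset_antisym)

lemma vanishes_on_iff: "form d F \<Longrightarrow> vanishes_on F C \<longleftrightarrow> (\<forall>x\<in>cone. F x = 0)"
  by (simp add: vanishes_on_def C_eq_image vanishes_at_iff)

lemma domain:
  assumes "form d F" "form k G" "\<forall>x\<in>cone. F x * G x = 0"
  shows "(\<forall>x\<in>cone. F x = 0) \<or> (\<forall>x\<in>cone. G x = 0)"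
proof -
  have "vanishes_on (F * G) C"
    using assms vanishes_on_iff[OF form_mult[OF assms(1,2)]] by (simp add: times_fun_def)
  with irreducible assms(1,2) have "vanishes_on F C \<or> vanishes_on G C"
    unfolding irreducible_set_def by blast
  with assms(1,2) show ?thesis by (simp add: vanishes_on_iff)
qed

definition nonzero :: "('a ^ 4 \<Rightarrow> 'a) \<Rightarrow> bool" where
  "nonzero F \<longleftrightarrow> (\<exists>x\<in>cone. F x \<noteq> 0)"

lemma nonzero_iff: "form d F \<Longrightarrow> \<not> vanishes_on F C \<longleftrightarrow> nonzero F"
  by (auto simp: vanishes_on_iff nonzero_def)

lemma nonzero_mult: "form d F \<Longrightarrow> form k G \<Longrightarrow> nonzero (\<lambda>x. F x * G x) \<longleftrightarrow> nonzero F \<and> nonzero G"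
  using domain[of d F k G] by (auto simp: nonzero_def)

lemma nonzero_power: "form d F \<Longrightarrow> nonzero F \<Longrightarrow> nonzero (\<lambda>x. F x ^ n)"
proof (induction n)
  case 0
  then show ?case by (auto simp: nonzero_def)
next
  case (Suc n)
  then show ?case using nonzero_mult[of d F "n * d" "\<lambda>x. F x ^ n"] form_power by auto
qed

text \<open>These four points turn out to be \<open>O\<close>, \<open>T\<close>, \<open>2T\<close> and \<open>3T\<close>.\<close>

definition O4 where "O4 = vec4 e 1 0 1"
definition T4 where "T4 = vec4 1 e 1 0"
definition U4 where "U4 = vec4 0 1 e 1"
definition W4 where "W4 = vec4 1 0 1 e"

lemmas torsion_defs = O4_def T4_def U4_def W4_def

lemma torsion_cone: "O4 \<in> cone" "T4 \<in> cone" "U4 \<in> cone" "W4 \<in> cone"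
  by (simp_all add: torsion_defs vec4_cone char2_simps)

text \<open>The four points span the whole space: their matrix is circulant with first row (e, 1, 0,
  1), and in characteristic 2 its determinant is e^4. Thus no plane contains the curve.\<close>

lemma linear_nonzero:
  assumes "form 1 L" "\<not> nonzero L"
  shows "L = (\<lambda>x. 0)"
proof -
  obtain a b c d where L: "L = (\<lambda>x. a * x $ 0 + b * x $ 1 + c * x $ 2 + d * x $ 3)"
    using assms(1) form_1_vec4 by blast
  have "L O4 = 0" "L T4 = 0" "L U4 = 0" "L W4 = 0"
    using assms(2) torsion_cone by (auto simp: nonzero_def)
  then have *: "a * e + b + d = 0" "a + b * e + c = 0" "b + c * e + d = 0" "a + c + d * e = 0"
    by (simp_all add: L torsion_defs algebra_simps)
  have "(a + c) * e = (a * e + b + d) + (b + c * e + d)" "(b + d) * e = (a + b * e + c) + (a + c + d * e)"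
    by (simp_all add: algebra_simps char2_simps)
  then have "a + c = 0" "b + d = 0" using * e_nz by simp_all
  then have "c = a" "d = b" by (metis add.commute eq_iff_add)+
  have "a * e = (a * e + b + d) + (b + d)" "b * e = (a + b * e + c) + (a + c)"
    by (simp_all add: algebra_simps char2_simps)
  with * \<open>a + c = 0\<close> \<open>b + d = 0\<close> e_nz have "a = 0" "b = 0" by auto
  with \<open>c = a\<close> \<open>d = b\<close> show ?thesis by (simp add: L)
qed

text \<open>The witness \<open>y\<close> need not lie on the curve, so unit vectors can be
  used.\<close>

lemma nonzero_linearI: "form 1 L \<Longrightarrow> L y \<noteq> 0 \<Longrightarrow> nonzero L"
  using linear_nonzero by force

text \<open>Makes (X1 : X3) a morphism from the whole curve to the projective line.\<close>

lemma cone_1_3: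
  assumes "x \<in> cone"
  shows "x $ 1 \<noteq> 0 \<or> x $ 3 \<noteq> 0"
proof (rule ccontr)
  assume "\<not> ?thesis"
  moreover from this have "(x $ 0 + x $ 2)\<^sup>2 = 0" "x $ 0 * x $ 2 = 0" 
    using coneD[OF assms] e_nz by auto
  then have "x $ 0 = 0" "x $ 2 = 0" by (auto simp: eq_iff_add[symmetric])
  ultimately show False using coneD(3)[OF assms] by (simp add: vec4_eq_iff)
qed

section \<open>Orders of vanishing\<close>

text \<open>\<open>F\<close> is divisible by \<open>\<pi>\<^sup>n\<close> in the local ring at \<open>x\<close>; here \<open>G\<close> is a denominator.\<close>

definition dvn :: "'a ^ 4 \<Rightarrow> ('a ^ 4 \<Rightarrow> 'a) \<Rightarrow> nat \<Rightarrow> nat \<Rightarrow> ('a ^ 4 \<Rightarrow> 'a) \<Rightarrow> bool" where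
  "dvn x \<pi> n d F \<longleftrightarrow> (\<exists>g G k F'. form g G \<and> G x \<noteq> 0 \<and> form k F' \<and> d + g = k + n \<and>
     (\<forall>y\<in>cone. G y * F y = \<pi> y ^ n * F' y))"

text \<open>The cofactor is a unit too, so \<open>n\<close> is the exact order. The degree equation
  presupposes a linear \<open>\<pi>\<close>; it makes both sides of the identity forms of equal
  degree, so that \<open>domain\<close> can be applied to differences.\<close>

definition ordn :: "'a ^ 4 \<Rightarrow> ('a ^ 4 \<Rightarrow> 'a) \<Rightarrow> nat \<Rightarrow> nat \<Rightarrow> ('a ^ 4 \<Rightarrow> 'a) \<Rightarrow> bool" where
  "ordn x \<pi> n d F \<longleftrightarrow> (\<exists>g G k F'. form g G \<and> G x \<noteq> 0 \<and> form k F' \<and> F' x \<noteq> 0 \<and> d + g = k + n \<and>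
     (\<forall>y\<in>cone. G y * F y = \<pi> y ^ n * F' y))"

lemma dvnI:
  "form g G \<Longrightarrow> G x \<noteq> 0 \<Longrightarrow> form k F' \<Longrightarrow> d + g = k + n \<Longrightarrow>
    (\<And>y. y \<in> cone \<Longrightarrow> G y * F y = \<pi> y ^ n * F' y) \<Longrightarrow> dvn x \<pi> n d F"
  unfolding dvn_def by blast

lemma ordnI:
  "form g G \<Longrightarrow> G x \<noteq> 0 \<Longrightarrow> form k F' \<Longrightarrow> F' x \<noteq> 0 \<Longrightarrow> d + g = k + n \<Longrightarrow>
    (\<And>y. y \<in> cone \<Longrightarrow> G y * F y = \<pi> y ^ n * F' y) \<Longrightarrow> ordn x \<pi> n d F"
  unfolding ordn_def by blast

lemma ordn_dvn: "ordn x \<pi> n d F \<Longrightarrow> dvn x \<pi> n d F"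
  unfolding ordn_def dvn_def by blast

lemma dvn_form: "form d F \<Longrightarrow> dvn x \<pi> 0 d F"
  by (rule dvnI[of 0 "\<lambda>_. 1" _ d F]) (auto intro: form_const)

lemma ordn_form: "form d F \<Longrightarrow> F x \<noteq> 0 \<Longrightarrow> ordn x \<pi> 0 d F"
  by (rule ordnI[of 0 "\<lambda>_. 1" _ d F]) (auto intro: form_const)

lemma dvn_mult:
  assumes "dvn x \<pi> n d F" "dvn x \<pi> m k H"
  shows "dvn x \<pi> (n + m) (d + k) (\<lambda>y. F y * H y)"
proof -
  from assms obtain g G j F' g2 G2 j2 F2 where
    1: "form g G" "G x \<noteq> 0" "form j F'" "d + g = j + n" "\<And>y. y \<in> cone \<Longrightarrow> G y * F y = \<pi> y ^ n * F' y" and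
    2: "form g2 G2" "G2 x \<noteq> 0" "form j2 F2" "k + g2 = j2 + m" "\<And>y. y \<in> cone \<Longrightarrow> G2 y * H y = \<pi> y ^ m * F2 y"
    unfolding dvn_def by metis
  have "(G y * G2 y) * (F y * H y) = \<pi> y ^ (n + m) * (F' y * F2 y)" if "y \<in> cone" for y
  proof -
    have "(G y * G2 y) * (F y * H y) = (G y * F y) * (G2 y * H y)" by (simp add: mult_ac)
    then show ?thesis unfolding 1(5)[OF that] 2(5)[OF that] by (simp add: power_add mult_ac)
  qed
  then show ?thesis using 1 2
    by (intro dvnI[OF form_mult[OF 1(1) 2(1)] _ form_mult[OF 1(3) 2(3)]]) auto
qed

lemma ordn_mult:
  assumes "ordn x \<pi> n d F" "ordn x \<pi> m k H"
  shows "ordn x \<pi> (n + m) (d + k) (\<lambda>y. F y * H y)"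
proof -
  from assms obtain g G j F' g2 G2 j2 F2 where
    1: "form g G" "G x \<noteq> 0" "form j F'" "F' x \<noteq> 0" "d + g = j + n" "\<And>y. y \<in> cone \<Longrightarrow> G y * F y = \<pi> y ^ n * F' y" and
    2: "form g2 G2" "G2 x \<noteq> 0" "form j2 F2" "F2 x \<noteq> 0" "k + g2 = j2 + m" "\<And>y. y \<in> cone \<Longrightarrow> G2 y * H y = \<pi> y ^ m * F2 y"
    unfolding ordn_def by metis
  have "(G y * G2 y) * (F y * H y) = \<pi> y ^ (n + m) * (F' y * F2 y)" if "y \<in> cone" for y
  proof -
    have "(G y * G2 y) * (F y * H y) = (G y * F y) * (G2 y * H y)" by (simp add: mult_ac)
    then show ?thesis unfolding 1(6)[OF that] 2(6)[OF that] by (simp add: power_add mult_ac)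
  qed
  then show ?thesis using 1 2
    by (intro ordnI[OF form_mult[OF 1(1) 2(1)] _ form_mult[OF 1(3) 2(3)]]) auto
qed

lemma dvn_cong: "dvn x \<pi> n d F \<Longrightarrow> (\<And>y. y \<in> cone \<Longrightarrow> F y = F' y) \<Longrightarrow> dvn x \<pi> n d F'"
  unfolding dvn_def by metis

lemma ordn_cong: "ordn x \<pi> n d F \<Longrightarrow> (\<And>y. y \<in> cone \<Longrightarrow> F y = F' y) \<Longrightarrow> ordn x \<pi> n d F'"
  unfolding ordn_def by metis

lemma dvn_scale: "dvn x \<pi> n d F \<Longrightarrow> dvn x \<pi> n d (\<lambda>y. c * F y)"
  using dvn_mult[OF dvn_form[OF form_const], of x \<pi> n d F c] by simp

text \<open>Passing to the common denominator \<open>G * G2\<close> also gives the two cofactors the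
  same degree, so that linear combinations of them are again forms.\<close>

lemma dvn_combination:
  assumes "dvn x \<pi> n d F" "dvn x \<pi> n d H"
  obtains g G j A B where "form g G" "G x \<noteq> 0" "form j A" "form j B" "d + g = j + n"
    "\<And>y. y \<in> cone \<Longrightarrow> G y * F y = \<pi> y ^ n * A y" "\<And>y. y \<in> cone \<Longrightarrow> G y * H y = \<pi> y ^ n * B y"
proof -
  from assms obtain g G j F' g2 G2 j2 F2 where
    1: "form g G" "G x \<noteq> 0" "form j F'" "d + g = j + n" "\<And>y. y \<in> cone \<Longrightarrow> G y * F y = \<pi> y ^ n * F' y" and
    2: "form g2 G2" "G2 x \<noteq> 0" "form j2 F2" "d + g2 = j2 + n" "\<And>y. y \<in> cone \<Longrightarrow> G2 y * H y = \<pi> y ^ n * F2 y"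
    unfolding dvn_def by metis
  have "G2 y * G y * F y = \<pi> y ^ n * (G2 y * F' y)" "G2 y * G y * H y = \<pi> y ^ n * (G y * F2 y)" if "y \<in> cone" for y
    using 1(5)[OF that] 2(5)[OF that] by (metis mult.commute mult.left_commute)+
  moreover have "form (g2 + j) (\<lambda>y. G2 y * F' y)" "form (g + j2) (\<lambda>y. G y * F2 y)" "form (g2 + g) (\<lambda>y. G2 y * G y)"
    using 1 2 by (auto intro: form_mult)
  moreover have "g + j2 = g2 + j" "d + (g2 + g) = g2 + j + n" using 1(4) 2(4) by auto
  ultimately show ?thesis using that[of "g2 + g" "\<lambda>y. G2 y * G y" "g2 + j" "\<lambda>y. G2 y * F' y" "\<lambda>y. G y * F2 y"]
      1(2) 2(2) by auto
qed

lemma dvn_add: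
  assumes "dvn x \<pi> n d F" "dvn x \<pi> n d H"
  shows "dvn x \<pi> n d (\<lambda>y. F y + H y)"
proof -
  obtain g G j A B where *: "form g G" "G x \<noteq> 0" "form j A" "form j B" "d + g = j + n"
    "\<And>y. y \<in> cone \<Longrightarrow> G y * F y = \<pi> y ^ n * A y" "\<And>y. y \<in> cone \<Longrightarrow> G y * H y = \<pi> y ^ n * B y"
    using dvn_combination[OF assms] by metis
  then show ?thesis
    by (intro dvnI[OF *(1,2) form_add[OF *(3,4)]]) (auto simp: distrib_left)
qed

lemma dvn_zero:
  assumes "x \<noteq> 0" "\<And>y. y \<in> cone \<Longrightarrow> F y = 0"
  shows "dvn x \<pi> n d F"
proof -
  from \<open>x \<noteq> 0\<close> obtain i where "x $ i \<noteq> 0" by (auto simp: vec_eq_iff)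
  \<comment> \<open>The denominator only supplies the degree \<open>n\<close> that lets the zero
    cofactor have degree \<open>d\<close>.\<close>
  then show ?thesis using assms
    by (intro dvnI[of "n * 1" "\<lambda>y. y $ i ^ n" _ d "\<lambda>y. 0"] form_power form_var) (auto intro: form_zero)
qed

lemma dvn_divide:
  assumes "form k K" "K x \<noteq> 0" "dvn x \<pi> n (d + k) H" "\<And>y. y \<in> cone \<Longrightarrow> K y * F y = H y"
  shows "dvn x \<pi> n d F"
proof -
  from assms(3) obtain g G j F' where
    1: "form g G" "G x \<noteq> 0" "form j F'" "d + k + g = j + n" "\<And>y. y \<in> cone \<Longrightarrow> G y * H y = \<pi> y ^ n * F' y"
    unfolding dvn_def by metis
  show ?thesis using 1 assms
    by (intro dvnI[OF form_mult[OF 1(1) assms(1)] _ 1(3)]) (auto simp: mult.assoc)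
qed

lemma ordn_divide:
  assumes "form k K" "K x \<noteq> 0" "ordn x \<pi> n (d + k) H" "\<And>y. y \<in> cone \<Longrightarrow> K y * F y = H y"
  shows "ordn x \<pi> n d F"
proof -
  from assms(3) obtain g G j F' where
    1: "form g G" "G x \<noteq> 0" "form j F'" "F' x \<noteq> 0" "d + k + g = j + n" "\<And>y. y \<in> cone \<Longrightarrow> G y * H y = \<pi> y ^ n * F' y"
    unfolding ordn_def by metis
  show ?thesis using 1 assms
    by (intro ordnI[OF form_mult[OF 1(1) assms(1)] _ 1(3,4)]) (auto simp: mult.assoc)
qed

text \<open>A linear form inducing a generator of the maximal ideal of the local ring at
  \<open>x\<close>. That there is one expresses nonsingularity at \<open>x\<close>.\<close>

definition uniformizer :: "'a ^ 4 \<Rightarrow> ('a ^ 4 \<Rightarrow> 'a) \<Rightarrow> bool" where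
  "uniformizer x \<pi> \<longleftrightarrow> form 1 \<pi> \<and> \<pi> x = 0 \<and> nonzero \<pi> \<and> (\<forall>d F. form d F \<and> F x = 0 \<longrightarrow> dvn x \<pi> 1 d F)"

text \<open>It suffices to divide the linear forms vanishing at \<open>x\<close>, since these generate the ideal of the point.\<close>

lemma uniformizerI:
  assumes "form 1 \<pi>" "\<pi> x = 0" "nonzero \<pi>" "x $ p = 1"
    and lin: "\<And>i. dvn x \<pi> 1 1 (\<lambda>y. y $ i + x $ i * y $ p)"
  shows "uniformizer x \<pi>"
proof -
  have nz: "x \<noteq> 0" using assms(4) by auto
  \<comment> \<open>This is F minus its value at \<open>x\<close>, homogenised by
    \<open>y $ p\<close>, which is 1 at \<open>x\<close>. Multiplication by a variable is then
    handled like the product rule: one factor is replaced by its value at a time.\<close>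
  have "dvn x \<pi> 1 d (\<lambda>y. F y + F x * y $ p ^ d)" if "form d F" for d F
    using that
  proof (induction rule: form_induct)
    case (const c)
    then show ?case by (intro dvn_zero nz) (simp add: char2_simps)
  next
    case (var d F i)
    have "dvn x \<pi> (0 + 1) (1 + d) (\<lambda>y. y $ i * (F y + F x * y $ p ^ d))"
      by (intro dvn_mult dvn_form form_var var.IH)
    moreover have "dvn x \<pi> (0 + 1) (d * 1 + 1) (\<lambda>y. y $ p ^ d * (y $ i + x $ i * y $ p))"
      by (intro dvn_mult dvn_form form_power form_var lin)
    then have "dvn x \<pi> 1 (Suc d) (\<lambda>y. F x * (y $ p ^ d * (y $ i + x $ i * y $ p)))"
      by (intro dvn_scale) simp
    ultimately have "dvn x \<pi> 1 (Suc d) (\<lambda>y. y $ i * (F y + F x * y $ p ^ d) + F x * (y $ p ^ d * (y $ i + x $ i * y $ p)))"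
      by (intro dvn_add) simp_all
    then show ?case
      by (rule dvn_cong) (simp add: algebra_simps char2_simps)
  next
    case (add d F G)
    show ?case by (rule dvn_cong[OF dvn_add[OF add.IH]]) (simp add: algebra_simps)
  qed
  then have "\<forall>d F. form d F \<and> F x = 0 \<longrightarrow> dvn x \<pi> 1 d F"
    by (metis (no_types, lifting) add.right_neutral dvn_cong mult_zero_left)
  with assms show ?thesis unfolding uniformizer_def by simp
qed

lemma uniformizer_dvn: "uniformizer x \<pi> \<Longrightarrow> form d F \<Longrightarrow> F x = 0 \<Longrightarrow> dvn x \<pi> 1 d F"
  by (simp add: uniformizer_def)

lemma form_nz_scale: "form d F \<Longrightarrow> s \<noteq> 0 \<Longrightarrow> F (s *s x) \<noteq> 0 \<longleftrightarrow> F x \<noteq> 0"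
  by (simp add: form_homogeneous)

lemma dvn_vec_scale: "s \<noteq> 0 \<Longrightarrow> dvn (s *s x) \<pi> n d F \<longleftrightarrow> dvn x \<pi> n d F"
  unfolding dvn_def using form_nz_scale by metis

lemma ordn_vec_scale: "s \<noteq> 0 \<Longrightarrow> ordn (s *s x) \<pi> n d F \<longleftrightarrow> ordn x \<pi> n d F"
  unfolding ordn_def using form_nz_scale by metis

lemma uniformizer_scale: "s \<noteq> 0 \<Longrightarrow> uniformizer (s *s x) \<pi> \<longleftrightarrow> uniformizer x \<pi>"
  unfolding uniformizer_def dvn_vec_scale by (metis form_nz_scale)


text \<open>
  Normalise \<open>x $ p = 1\<close>, where \<open>{p, q} = {1, 3}\<close>, and write \<open>u = X\<^sub>0 + X\<^sub>2\<close>. The first equation shows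
  that \<open>X\<^sub>q\<close> is quadratic in \<open>u\<close>, and the second is a relation between \<open>u\<close> and \<open>X\<^sub>0\<close> whose linear part
  at \<open>x\<close> is \<open>u(x) X\<^sub>0 + x\<^sub>0 u\<close>. So \<open>u\<close> is a uniformizer, except where \<open>u(x) = 0\<close>, and there \<open>X\<^sub>0\<close> is.
\<close>

lemma uniformizer_normalised:
  assumes x: "x \<in> cone" and xp: "x $ p = 1" and pq: "(p, q) = (1, 3) \<or> (p, q) = (3, 1)"
  obtains \<pi> where "uniformizer x \<pi>"
    "ordn x \<pi> (if x $ 0 = x $ 2 then 4 else 2) 1 (\<lambda>y. y $ q + x $ q * y $ p)"
    "x $ 0 = x $ 2 \<Longrightarrow> ordn x \<pi> 1 1 (\<lambda>y. y $ 0 + x $ 0 * y $ p)"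
proof -
  \<comment> \<open>The functions X0 + X2, X0 and X_q minus their values at \<open>x\<close>,
    homogenised by X_p. The form \<open>g\<close> comes from splitting X0 X2 - x_0 x_2 X_p^2 as v g
    + x_0 X_p u.\<close>
  define u where "u = (\<lambda>y :: 'a ^ 4. y $ 0 + y $ 2 + (x $ 0 + x $ 2) * y $ p)"
  define v where "v = (\<lambda>y :: 'a ^ 4. y $ 0 + x $ 0 * y $ p)"
  define w where "w = (\<lambda>y :: 'a ^ 4. y $ q + x $ q * y $ p)"
  define g where "g = (\<lambda>y :: 'a ^ 4. y $ 2 + x $ 0 * y $ p)"
  have form_u: "form 1 u" and form_v: "form 1 v" and form_w: "form 1 w" and form_g: "form 1 g"
    unfolding u_def v_def w_def g_def by (intro form_add form_var form_scale)+
  have at_x: "u x = 0" "v x = 0" "w x = 0" "g x = x $ 0 + x $ 2"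
    by (simp_all add: u_def v_def w_def g_def xp char2_simps)
  have xc: "(x $ 0 + x $ 2)\<^sup>2 = e\<^sup>2 * x $ q" "(1 + x $ q)\<^sup>2 = e\<^sup>2 * x $ 0 * x $ 2"
    using coneD(1,2)[OF x] pq xp by (auto simp: add.commute)
  have x_nz: "x \<noteq> 0" using x by (simp add: cone_def)
  have y_cone: "(y $ 0 + y $ 2)\<^sup>2 = e\<^sup>2 * y $ p * y $ q" "(y $ p + y $ q)\<^sup>2 = e\<^sup>2 * y $ 0 * y $ 2"
    if "y \<in> cone" for y
    using coneD(1,2)[OF that] pq by (auto simp: mult_ac add.commute)
  have w_eq: "e\<^sup>2 * y $ p * w y = u y ^ 2" if "y \<in> cone" for y
  proof -
    have "u y ^ 2 = (y $ 0 + y $ 2)\<^sup>2 + (x $ 0 + x $ 2)\<^sup>2 * (y $ p)\<^sup>2"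
      unfolding u_def by (simp only: square_add power_mult_distrib)
    then show ?thesis unfolding y_cone(1)[OF that] xc(1)
      by (simp add: w_def power2_eq_square algebra_simps)
  qed
  have v_eq: "e\<^sup>2 * (v y * g y + x $ 0 * y $ p * u y) = (w y)\<^sup>2" if "y \<in> cone" for y
  proof -
    have "(w y)\<^sup>2 = (y $ p + y $ q)\<^sup>2 + (1 + x $ q)\<^sup>2 * (y $ p)\<^sup>2"
      unfolding w_def by (simp add: square_add power_mult_distrib algebra_simps char2_simps)
    then show ?thesis unfolding y_cone(2)[OF that] xc(2)
      by (simp add: v_def g_def u_def power2_eq_square algebra_simps char2_simps)
  qed
  have e6: "e ^ 6 = e ^ 4 * e\<^sup>2" by (simp flip: power_add)
  \<comment> \<open>Eliminating \<open>w\<close> leaves one relation between \<open>u\<close> and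
    \<open>v\<close>. Up to a unit its linear part at \<open>x\<close> has coefficient g(x) = x_0 +
    x_2 at \<open>v\<close> and x_0 at \<open>u\<close>; the two cases below are decided by which of
    these is a unit.\<close>
  have uv_eq: "u y ^ 4 = e ^ 6 * (y $ p)\<^sup>2 * (v y * g y + x $ 0 * y $ p * u y)" if "y \<in> cone" for y
  proof -
    have "u y ^ 4 = (e\<^sup>2 * y $ p * w y)\<^sup>2" by (simp add: w_eq[OF that])
    also have "\<dots> = e ^ 4 * (y $ p)\<^sup>2 * (w y)\<^sup>2" by (simp add: power_mult_distrib)
    also have "\<dots> = e ^ 6 * (y $ p)\<^sup>2 * (v y * g y + x $ 0 * y $ p * u y)"
      unfolding v_eq[OF that, symmetric] e6 by (simp only: mult_ac)
    finally show ?thesis .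
  qed
  have form_ep: "form 1 (\<lambda>y. e\<^sup>2 * y $ p)" by (intro form_scale form_var)
  have ep_x: "e\<^sup>2 * x $ p \<noteq> 0" by (simp add: e_nz xp)
  have lin: "dvn x \<pi> 1 1 (\<lambda>y. y $ i + x $ i * y $ p)"
    if u: "dvn x \<pi> 1 1 u" and v: "dvn x \<pi> 1 1 v" for \<pi> i
  proof -
    have "dvn x \<pi> (1 + 0) (1 + 1) (\<lambda>y. u y * u y)" by (intro dvn_mult u dvn_form form_u)
    then have "dvn x \<pi> 1 (1 + 1) (\<lambda>y. (u y)\<^sup>2)" by (simp only: power2_eq_square add_0_right)
    from dvn_divide[OF form_ep ep_x this w_eq] have w: "dvn x \<pi> 1 1 w" .
    have "dvn x \<pi> 1 1 (\<lambda>y. u y + v y)" by (intro dvn_add u v)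
    then have 2: "dvn x \<pi> 1 1 (\<lambda>y. y $ 2 + x $ 2 * y $ p)"
      by (rule dvn_cong) (simp add: u_def v_def algebra_simps char2_simps)
    have p: "dvn x \<pi> 1 1 (\<lambda>y. y $ p + x $ p * y $ p)"
      by (rule dvn_zero[OF x_nz]) (simp add: xp char2_simps)
    show ?thesis using exhaust_4_0[of i] pq v 2 w p by (auto simp: v_def w_def)
  qed
  have "u (vec4 1 0 0 0) \<noteq> 0" "v (vec4 1 0 0 0) \<noteq> 0" using pq by (auto simp: u_def v_def)
  then have nz: "nonzero u" "nonzero v" using form_u form_v nonzero_linearI by blast+
  show ?thesis
  proof (cases "x $ 0 = x $ 2")
    case False
    have one: "form 0 (\<lambda>y. 1 :: 'a)" by (rule form_const)
    have "ordn x u 1 1 u" by (rule ordnI[OF one _ one]) auto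
    then have u: "dvn x u 1 1 u" by (rule ordn_dvn)
    have fG: "form (2 + 1) (\<lambda>y. (e ^ 6 * y $ p ^ 2) * g y)"
      using form_mult[OF form_scale[OF form_power[OF form_var[of p], of 2]] form_g] by simp
    have fF: "form 3 (\<lambda>y. u y ^ 3 + (e ^ 6 * x $ 0) * y $ p ^ 3)"
      using form_add[OF form_power[OF form_u, of 3] form_scale[OF form_power[OF form_var[of p], of 3]]] by simp
    \<comment> \<open>Since g(x) is nonzero, the relation can be solved for \<open>v\<close>, with
      every other term carrying a factor \<open>u\<close>.\<close>
    have v: "dvn x u 1 1 v"
    proof (rule dvnI[OF fG _ fF])
      show "e ^ 6 * x $ p ^ 2 * g x \<noteq> 0" using False e_nz eq_iff_add[of "x $ 0" "x $ 2"] by (simp add: at_x xp)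
      fix y assume "y \<in> cone"
      have "(e ^ 6 * y $ p ^ 2) * g y * v y
          = e ^ 6 * (y $ p)\<^sup>2 * (v y * g y + x $ 0 * y $ p * u y) + u y * (e ^ 6 * x $ 0 * y $ p ^ 3)"
        by (simp add: algebra_simps char2_simps power2_eq_square power3_eq_cube)
      also have "\<dots> = u y * u y ^ 3 + u y * (e ^ 6 * x $ 0 * y $ p ^ 3)"
        unfolding uv_eq[OF \<open>y \<in> cone\<close>, symmetric] by (simp add: power3_eq_cube power4_eq_xxxx mult.assoc)
      finally show "e ^ 6 * y $ p ^ 2 * g y * v y = u y ^ 1 * (u y ^ 3 + (e ^ 6 * x $ 0) * y $ p ^ 3)"
        by (simp add: distrib_left)
    qed simp
    have "uniformizer x u" by (rule uniformizerI[OF form_u at_x(1) nz(1) xp lin[OF u v]])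
    moreover have "ordn x u 2 1 w"
      by (rule ordnI[OF form_ep _ one]) (use w_eq e_nz xp in auto)
    ultimately show ?thesis using that False by (simp add: w_def)
  next
    case True
    \<comment> \<open>A ramification point of the double cover: the linear part of the relation
      reduces to x_0 u, and x_0 is a unit.\<close>
    then have "x $ q = 0" using xc(1) e_nz by (simp add: char2_simps)
    with xc(2) have x0: "x $ 0 \<noteq> 0" by auto
    have one: "form 0 (\<lambda>y. 1 :: 'a)" by (rule form_const)
    have ov: "ordn x v 1 1 v" by (rule ordnI[OF one _ one]) auto
    then have v: "dvn x v 1 1 v" by (rule ordn_dvn)
    have g: "g y = v y + u y" for y
      using True by (simp add: g_def u_def v_def char2_simps algebra_simps)
    have fG: "form 3 (\<lambda>y. u y ^ 3 + (e ^ 6 * (y $ p ^ 2 * v y) + (e ^ 6 * x $ 0) * y $ p ^ 3))"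
    proof (intro form_add form_scale)
      show "form 3 (\<lambda>y. u y ^ 3)" using form_power[OF form_u, of 3] by simp
      show "form 3 (\<lambda>y. y $ p ^ 3)" using form_power[OF form_var[of p], of 3] by simp
      show "form 3 (\<lambda>y. y $ p ^ 2 * v y)"
        using form_mult[OF form_power[OF form_var[of p], of 2] form_v] by simp
    qed
    have fF: "form 2 (\<lambda>y. e ^ 6 * y $ p ^ 2)"
      using form_scale[OF form_power[OF form_var[of p], of 2]] by simp
    \<comment> \<open>With g = v + u the relation becomes u (u^3 + e^6 X_p^2 (v + x_0 X_p)) = e^6
      X_p^2 v^2, where the bracket is nonzero at \<open>x\<close>. So \<open>u\<close> has order 2,
      and \<open>w\<close>, which is u^2 up to a unit, has order 4.\<close>
    have ou: "ordn x v 2 1 u"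
    proof (rule ordnI[OF fG _ fF])
      show "u x ^ 3 + (e ^ 6 * (x $ p ^ 2 * v x) + (e ^ 6 * x $ 0) * x $ p ^ 3) \<noteq> 0"
        using e_nz x0 by (simp add: at_x xp)
      show "e ^ 6 * x $ p ^ 2 \<noteq> 0" using e_nz xp by simp
      fix y assume "y \<in> cone"
      have "(u y ^ 3 + (e ^ 6 * (y $ p ^ 2 * v y) + (e ^ 6 * x $ 0) * y $ p ^ 3)) * u y
         = u y ^ 4 + e ^ 6 * y $ p ^ 2 * (v y * u y + x $ 0 * y $ p * u y)"
        by (simp add: algebra_simps power2_eq_square power3_eq_cube power4_eq_xxxx)
      also have "\<dots> = v y ^ 2 * (e ^ 6 * y $ p ^ 2)"
        unfolding uv_eq[OF \<open>y \<in> cone\<close>] g 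
        by (simp add: algebra_simps char2_simps power2_eq_square)
      finally show "(u y ^ 3 + (e ^ 6 * (y $ p ^ 2 * v y) + (e ^ 6 * x $ 0) * y $ p ^ 3)) * u y
         = v y ^ 2 * (e ^ 6 * y $ p ^ 2)" .
    qed simp
    have u: "dvn x v 1 1 u"
      using ordn_dvn[OF ou] unfolding dvn_def
    proof (elim exE conjE)
      fix k G j F' assume *: "form k G" "G x \<noteq> 0" "form j F'" "1 + k = j + 2" "\<forall>y\<in>cone. G y * u y = v y ^ 2 * F' y"
      have "form (1 + j) (\<lambda>y. v y * F' y)" using form_v *(3) by (rule form_mult)
      with * show "\<exists>g G k F'. form g G \<and> G x \<noteq> 0 \<and> form k F' \<and> 1 + g = k + 1 \<and> (\<forall>y\<in>cone. G y * u y = v y ^ 1 * F' y)"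
        by (intro exI[of _ k] exI[of _ G] exI[of _ "1 + j"] exI[of _ "\<lambda>y. v y * F' y"])
          (auto simp: power2_eq_square mult.assoc)
    qed
    have "uniformizer x v" by (rule uniformizerI[OF form_v at_x(2) nz(2) xp lin[OF u v]])
    moreover have "ordn x v (2 + 2) (1 + 1) (\<lambda>y. u y * u y)" by (intro ordn_mult ou)
    then have "ordn x v 4 (1 + 1) (\<lambda>y. (u y)\<^sup>2)" by (simp add: power2_eq_square)
    from ordn_divide[OF form_ep ep_x this w_eq] have "ordn x v 4 1 w" .
    ultimately show ?thesis using that True ov by (simp add: w_def v_def)
  qed
qed

text \<open>A linear form in X1, X3 is a square on the conic, so its order at a zero is 2, doubled
  where the cover ramifies, that is where X0 = X2. The last clause gives an explicit form of order 1
  at the ramified points, needed to test divisibility there.\<close>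

lemma uniformizer_exists:
  assumes x: "x \<in> cone"
  obtains \<pi> where "uniformizer x \<pi>"
    "\<And>a b. (a, b) \<noteq> (0, 0) \<Longrightarrow> a * x $ 1 + b * x $ 3 = 0 \<Longrightarrow>
      ordn x \<pi> (if x $ 0 = x $ 2 then 4 else 2) 1 (\<lambda>y. a * y $ 1 + b * y $ 3)"
    "\<And>p. x $ 0 = x $ 2 \<Longrightarrow> p \<in> {1, 3} \<Longrightarrow> x $ p \<noteq> 0 \<Longrightarrow> ordn x \<pi> 1 1 (\<lambda>y. y $ 0 + x $ 0 / x $ p * y $ p)"
proof -
  obtain p q where pq: "(p, q) = (1, 3) \<or> (p, q) = (3, 1 :: 4)" and xp: "x $ p \<noteq> 0"
    using cone_1_3[OF x] by auto
  define s where "s = inverse (x $ p)"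
  have s: "s \<noteq> 0" using xp by (simp add: s_def)
  have "s *s x \<in> cone" "(s *s x) $ p = 1" using x s xp by (simp_all add: cone_scale s_def)
  from uniformizer_normalised[OF this pq] obtain \<pi> where
    \<pi>: "uniformizer (s *s x) \<pi>" 
    "ordn (s *s x) \<pi> (if (s *s x) $ 0 = (s *s x) $ 2 then 4 else 2) 1 (\<lambda>y. y $ q + (s *s x) $ q * y $ p)" and
    \<pi>': "(s *s x) $ 0 = (s *s x) $ 2 \<Longrightarrow> ordn (s *s x) \<pi> 1 1 (\<lambda>y. y $ 0 + (s *s x) $ 0 * y $ p)"
    by blast
  from \<pi> s have \<pi>: "uniformizer x \<pi>"
    "ordn x \<pi> (if x $ 0 = x $ 2 then 4 else 2) 1 (\<lambda>y. y $ q + s * x $ q * y $ p)"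
    by (simp_all add: ordn_vec_scale uniformizer_scale)
  show ?thesis
  proof (rule that[OF \<pi>(1)])
    fix a b assume ab: "(a, b) \<noteq> (0, 0)" "a * x $ 1 + b * x $ 3 = 0"
    obtain c d where cd: "c * x $ q + d * x $ p = 0" "(\<lambda>y. a * y $ 1 + b * y $ 3) = (\<lambda>y. c * y $ q + d * y $ p)" "(c, d) \<noteq> (0, 0)"
    proof (cases "p = 1")
      case True with pq ab that[of b a] show ?thesis by (auto simp: add.commute)
    next
      case False with pq ab that[of a b] show ?thesis by auto
    qed
    from cd(1) have "d * x $ p = c * x $ q" using uminus_CHAR_2[OF char2] by (metis add.commute add_eq_0_iff)
    then have d: "d = c * (s * x $ q)" using xp by (simp add: s_def field_simps)
    with cd(3) have "c \<noteq> 0" by auto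
    have "ordn x \<pi> ((if x $ 0 = x $ 2 then 4 else 2) + 0) (1 + 0) (\<lambda>y. (y $ q + s * x $ q * y $ p) * c)"
      by (intro ordn_mult \<pi> ordn_form form_const \<open>c \<noteq> 0\<close>)
    then show "ordn x \<pi> (if x $ 0 = x $ 2 then 4 else 2) 1 (\<lambda>y. a * y $ 1 + b * y $ 3)"
      unfolding cd(2) d by (simp add: algebra_simps)
  next
    fix r :: 4 assume r: "x $ 0 = x $ 2" "r \<in> {1, 3}" "x $ r \<noteq> 0"
    have "x $ 1 * x $ 3 = 0" using coneD(1)[OF x] r(1) e_nz by (simp add: char2_simps)
    with r xp pq have "r = p" by auto
    with \<pi>' r s show "ordn x \<pi> 1 1 (\<lambda>y. y $ 0 + x $ 0 / x $ r * y $ r)"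
      by (simp add: ordn_vec_scale s_def divide_inverse mult.commute)
  qed
qed

lemma dvn_step:
  assumes "uniformizer x \<pi>" "dvn x \<pi> n d F"
  shows "ordn x \<pi> n d F \<or> dvn x \<pi> (Suc n) d F"
proof -
  from assms(2) obtain g G j F' where
    1: "form g G" "G x \<noteq> 0" "form j F'" "d + g = j + n" "\<And>y. y \<in> cone \<Longrightarrow> G y * F y = \<pi> y ^ n * F' y"
    unfolding dvn_def by metis
  show ?thesis
  proof (cases "F' x = 0")
    case True
    then have "dvn x \<pi> 1 j F'" using assms(1) 1(3) uniformizer_dvn by blast
    then obtain h H i E where
      2: "form h H" "H x \<noteq> 0" "form i E" "j + h = i + 1" "\<And>y. y \<in> cone \<Longrightarrow> H y * F' y = \<pi> y * E y"
      unfolding dvn_def by auto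
    have "dvn x \<pi> (Suc n) d F"
    proof (rule dvnI[OF form_mult[OF 1(1) 2(1)] _ 2(3)])
      fix y assume y: "y \<in> cone"
      have "G y * H y * F y = (G y * F y) * H y" by (simp add: mult_ac)
      also have "\<dots> = \<pi> y ^ n * (H y * F' y)" using 1(5)[OF y] by simp
      finally show "G y * H y * F y = \<pi> y ^ Suc n * E y" using 2(5)[OF y] by simp
    qed (use 1 2 in auto)
    then show ?thesis ..
  qed (use 1 ordnI in blast)
qed

text \<open>If m exceeded n, cancelling \<open>\<pi> y ^ n\<close> between the two representations,
  which is possible in a domain, would leave an identity whose one side is nonzero at
  \<open>x\<close> while the other still contains a factor \<open>\<pi>\<close>.\<close>

lemma dvn_le_ordn:
  assumes x: "x \<in> cone" and \<pi>: "uniformizer x \<pi>" and "ordn x \<pi> n d F" "dvn x \<pi> m d F"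
  shows "m \<le> n"
proof (rule ccontr)
  assume "\<not> m \<le> n"
  then obtain l where m: "m = n + Suc l" by (metis add_Suc_right less_imp_Suc_add not_le)
  from assms obtain g G j A h H i B where
    1: "form g G" "G x \<noteq> 0" "form j A" "A x \<noteq> 0" "d + g = j + n" "\<And>y. y \<in> cone \<Longrightarrow> G y * F y = \<pi> y ^ n * A y" and
    2: "form h H" "H x \<noteq> 0" "form i B" "d + h = i + m" "\<And>y. y \<in> cone \<Longrightarrow> H y * F y = \<pi> y ^ m * B y"
    unfolding dvn_def ordn_def by metis
  have f\<pi>: "form 1 \<pi>" and \<pi>x: "\<pi> x = 0" using \<pi> by (simp_all add: uniformizer_def)
  have "form (h + j) (\<lambda>y. H y * A y)" using 2 1 by (intro form_mult)
  moreover have "form (Suc l * 1 + (g + i)) (\<lambda>y. \<pi> y ^ Suc l * (G y * B y))"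
    by (intro form_mult form_power f\<pi> 1 2)
  moreover have "Suc l * 1 + (g + i) = h + j" using 1(5) 2(4) m by simp
  ultimately have D: "form (h + j) (\<lambda>y. H y * A y - \<pi> y ^ Suc l * (G y * B y))"
    by (intro form_diff) simp_all
  have "\<pi> y ^ n * (H y * A y - \<pi> y ^ Suc l * (G y * B y)) = 0" if y: "y \<in> cone" for y
  proof -
    have "\<pi> y ^ n * (H y * A y) = H y * (G y * F y)" using 1(6)[OF y] by (simp add: mult_ac)
    also have "\<dots> = G y * (H y * F y)" by (simp add: mult_ac)
    also have "\<dots> = \<pi> y ^ n * (\<pi> y ^ Suc l * (G y * B y))" using 2(5)[OF y] by (simp add: m power_add mult_ac)
    finally show ?thesis by (simp add: right_diff_distrib)
  qed
  then have "\<not> nonzero (\<lambda>y. \<pi> y ^ n * (H y * A y - \<pi> y ^ Suc l * (G y * B y)))" by (simp add: nonzero_def)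
  then have "\<not> nonzero (\<lambda>y. H y * A y - \<pi> y ^ Suc l * (G y * B y))"
    using nonzero_mult[OF form_power[OF f\<pi>] D] nonzero_power[OF f\<pi>, of n] \<pi> by (auto simp: uniformizer_def)
  then have "H x * A x - \<pi> x ^ Suc l * (G x * B x) = 0" using x by (simp add: nonzero_def)
  with \<pi>x 1 2 show False by simp
qed

lemma dvn_power_le:
  assumes "dvn x \<pi> n d F" "m \<le> n" "form 1 \<pi>"
  shows "dvn x \<pi> m d F"
proof -
  from assms(1) obtain g G j F' where
    1: "form g G" "G x \<noteq> 0" "form j F'" "d + g = j + n" "\<And>y. y \<in> cone \<Longrightarrow> G y * F y = \<pi> y ^ n * F' y"
    unfolding dvn_def by metis
  have "form ((n - m) * 1 + j) (\<lambda>y. \<pi> y ^ (n - m) * F' y)"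
    by (intro form_mult form_power 1 assms(3))
  then show ?thesis using 1 assms(2)
    by (intro dvnI[OF 1(1,2)]) (auto simp flip: power_add mult.assoc)
qed

text \<open>Stands in for Krull's intersection theorem: divisibility of \<open>F\<close> to every
  order would pass to a multiple of \<open>F\<close> whose order is known to be finite.\<close>

lemma ordn_exists:
  assumes "x \<in> cone" "uniformizer x \<pi>" "form d F" "form k Q" "ordn x \<pi> n (d + k) (\<lambda>y. F y * Q y)"
  shows "\<exists>m. ordn x \<pi> m d F"
proof (rule ccontr)
  assume *: "\<not> ?thesis"
  have "dvn x \<pi> m d F" for m
    by (induction m) (use * dvn_step[OF assms(2)] dvn_form[OF assms(3)] in auto)
  then have "dvn x \<pi> (Suc n + 0) (d + k) (\<lambda>y. F y * Q y)" by (intro dvn_mult dvn_form assms)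
  with dvn_le_ordn[OF assms(1,2,5)] show False by force
qed

lemma dvn_iff_le_ordn:
  assumes "x \<in> cone" "uniformizer x \<pi>" "ordn x \<pi> n d F"
  shows "dvn x \<pi> m d F \<longleftrightarrow> m \<le> n"
  using assms dvn_le_ordn[OF assms] dvn_power_le[OF ordn_dvn[OF assms(3)]] by (auto simp: uniformizer_def)

end

lemma prod_fun_apply: "(\<Prod>i<n. B i) x = (\<Prod>i<n. B i x)"
  for B :: "nat \<Rightarrow> 'b \<Rightarrow> 'a::comm_monoid_mult"
  by (induction n) (simp_all add: times_fun_def one_fun_def)

context mu4 begin

section \<open>Agreement of orders with the multiplicities defined by powers of the ideal of a
  point\<close>

lemma dvn_prod:
  assumes "\<And>i. i < m \<Longrightarrow> dvn x \<pi> 1 (d i) (B i)"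
  shows "dvn x \<pi> m (\<Sum>i<m. d i) (\<lambda>y. \<Prod>i<m. B i y)"
  using assms
proof (induction m)
  case 0
  then show ?case using dvn_form[OF form_const[of 1]] by simp
next
  case (Suc m)
  have "dvn x \<pi> (m + 1) ((\<Sum>i<m. d i) + d m) (\<lambda>y. (\<Prod>i<m. B i y) * B m y)"
    using Suc by (intro dvn_mult) auto
  then show ?case by simp
qed

lemma ideal_power_dvn:
  assumes x: "x \<in> cone" and \<pi>: "uniformizer x \<pi>" and "H \<in> ideal_power (proj_class x) n d"
  shows "dvn x \<pi> n d H"
proof -
  have x_nz: "x \<noteq> 0" using x by (simp add: cone_def)
  show ?thesis using assms(3) unfolding ideal_power_def
  proof (induction rule: fn.span_induct_alt)
    case base
    show ?case by (rule dvn_zero[OF x_nz]) simp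
  next
    case (step c F H)
    then obtain A B where F: "F = A * (\<Prod>i<n. B i)" "form d (A * (\<Prod>i<n. B i))" "\<exists>e. form e A"
      "\<And>i. i < n \<Longrightarrow> (\<exists>e. form e (B i)) \<and> vanishes_at (B i) (proj_class x)" by blast
    from F(3) obtain k where k: "form k A" ..
    from F(4) obtain b where b: "\<And>i. i < n \<Longrightarrow> form (b i) (B i)" by metis
    have FAB: "F y = A y * (\<Prod>i<n. B i y)" for y by (simp add: F(1) prod_fun_apply)
    have "dvn x \<pi> n d F"
    \<comment> \<open>The degrees of the factors add up to \<open>d\<close> only if the product is
      not the zero function, since the zero function is a form of every degree.\<close>
    proof (cases "\<exists>y. F y \<noteq> 0")
      case True
      have "form (k + (\<Sum>i<n. b i)) F"
        using form_mult[OF k form_prod[OF b]] by (simp add: FAB[abs_def])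
      with True F(1,2) have d: "k + (\<Sum>i<n. b i) = d" using form_degree_unique by blast
      have "dvn x \<pi> 1 (b i) (B i)" if "i < n" for i
        using uniformizer_dvn[OF \<pi> b[OF that]] F(4)[OF that] vanishes_at_iff[OF b[OF that]] by blast
      then have "dvn x \<pi> (0 + n) (k + (\<Sum>i<n. b i)) (\<lambda>y. A y * (\<Prod>i<n. B i y))"
        by (intro dvn_mult dvn_form k dvn_prod)
      then show ?thesis unfolding d by (simp add: FAB[abs_def])
    qed (auto intro: dvn_zero[OF x_nz])
    from dvn_add[OF dvn_scale[OF this, of c] step(2)] show ?case by (simp add: plus_fun_def)
  qed
qed

abbreviation "in_max \<equiv> in_max_ideal_power C"

text \<open>In the local ring the n-th power of the maximal ideal is generated by the n-th power of
  a uniformizer. Conversely a multiple of it lies in the ideal power as a product with all factors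
  \<open>B i\<close> equal to \<open>\<pi>\<close>.\<close>

lemma in_max_iff:
  assumes x: "x \<in> cone" and \<pi>: "uniformizer x \<pi>" and F: "form d F"
  shows "in_max (proj_class x) n F \<longleftrightarrow> dvn x \<pi> n d F"
proof
  assume "in_max (proj_class x) n F"
  then obtain k g G H where *: "form k F" "form g G" "\<not> vanishes_at G (proj_class x)"
    "H \<in> ideal_power (proj_class x) n (k + g)" "vanishes_on (G * F - H) C"
    unfolding in_max_ideal_power_def by blast
  have eq: "G y * F y = H y" if "y \<in> cone" for y
    using *(5) that proj_class_self[of y] by (auto simp: vanishes_on_def vanishes_at_def C_eq_image)
  show "dvn x \<pi> n d F"
  proof (cases "\<exists>y. F y \<noteq> 0")
    case True
    with F *(1) have "k = d" using form_degree_unique by blast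
    with *(4) have "dvn x \<pi> n (d + g) H" using ideal_power_dvn[OF x \<pi>] by blast
    moreover have "G x \<noteq> 0" using *(2,3) vanishes_at_iff by blast
    ultimately show ?thesis using dvn_divide[OF *(2) _ _ eq] by blast
  qed (use x in \<open>auto intro: dvn_zero simp: cone_def\<close>)
next
  assume "dvn x \<pi> n d F"
  then obtain g G k F' where *: "form g G" "G x \<noteq> 0" "form k F'" "d + g = k + n" 
    "\<And>y. y \<in> cone \<Longrightarrow> G y * F y = \<pi> y ^ n * F' y"
    unfolding dvn_def by metis
  have f\<pi>: "form 1 \<pi>" "\<pi> x = 0" using \<pi> by (simp_all add: uniformizer_def)
  let ?H = "F' * (\<Prod>i<n. \<pi>)"
  have H: "?H = (\<lambda>y. \<pi> y ^ n * F' y)"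
  proof
    fix y
    have "?H y = F' y * (\<Prod>i<n. \<pi>) y" by (rule times_fun_apply)
    also have "(\<Prod>i<n. \<pi>) y = (\<Prod>i<n. \<pi> y)" by (rule prod_fun_apply)
    finally show "?H y = \<pi> y ^ n * F' y" by (simp add: mult.commute)
  qed
  have fH: "form (d + g) ?H"
    unfolding H using form_mult[OF form_power[OF f\<pi>(1), of n] *(3)] *(4) by (simp add: add.commute)
  have "vanishes_at \<pi> (proj_class x)" using f\<pi> vanishes_at_iff by blast
  then have "?H \<in> ideal_power (proj_class x) n (d + g)"
    unfolding ideal_power_def using f\<pi>(1) *(3) fH by (intro fn.span_base) blast
  moreover have "vanishes_on (G * F - ?H) C"
  proof -
    have "form (d + g) (\<lambda>y. G y * F y - ?H y)"
      using form_diff[OF form_mult[OF *(1) F, unfolded add.commute[of g d]] fH] .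
    then have "form (d + g) (G * F - ?H)" by (simp only: fun_diff_def times_fun_def)
    then show ?thesis unfolding H using *(5) by (simp add: vanishes_on_iff)
  qed
  ultimately show "in_max (proj_class x) n F"
    unfolding in_max_ideal_power_def using F *(1,2) vanishes_at_iff[OF *(1)] by blast
qed

lemma mult_at_ordn:
  assumes "x \<in> cone" "uniformizer x \<pi>" "form d F" "ordn x \<pi> n d F"
  shows "mult_at C (proj_class x) F = n"
  unfolding mult_at_def in_max_iff[OF assms(1-3)] dvn_iff_le_ordn[OF assms(1,2,4)]
  by (rule Greatest_equality) auto

section \<open>Squares of forms on the curve\<close>

text \<open>Binary forms of degree \<open>d - 2\<close>; the zero form is allowed also for \<open>d < 2\<close>.\<close>

definition bin2 :: "nat \<Rightarrow> ('a \<Rightarrow> 'a \<Rightarrow> 'a) \<Rightarrow> bool" where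
  "bin2 d B \<longleftrightarrow> B = (\<lambda>a b. 0) \<or> (\<exists>m. d = m + 2 \<and> bin m B)"

lemma bin2_zero: "bin2 d (\<lambda>a b. 0)"
  by (simp add: bin2_def)

lemma bin2_add: "bin2 d A \<Longrightarrow> bin2 d B \<Longrightarrow> bin2 d (\<lambda>a b. A a b + B a b)"
  unfolding bin2_def using bin_add by auto

lemma bin2_scale: "bin2 d A \<Longrightarrow> bin2 d (\<lambda>a b. c * A a b)"
  unfolding bin2_def using bin_scale by auto

lemma bin2_mult: "bin k A \<Longrightarrow> bin2 d B \<Longrightarrow> bin2 (k + d) (\<lambda>a b. A a b * B a b)"
  unfolding bin2_def using bin_mult by fastforce

lemma bin2_bin: "bin 2 Q \<Longrightarrow> bin2 d B \<Longrightarrow> bin d (\<lambda>a b. Q a b * B a b)"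
  unfolding bin2_def using bin_zero bin_mult[of 2 Q] by (auto simp: add.commute)

lemma bin_1: "bin 1 (\<lambda>a b. r * a + s * b :: 'a)"
  unfolding One_nat_def bin.simps by (rule exI[of _ "\<lambda>a b. r"]) (auto simp: mult.commute)

lemma bin_fst_mult_snd: "bin 2 (\<lambda>a b. a * b :: 'a)"
  using bin_mult[OF bin_1[of 1 0] bin_1[of 0 1]] by (simp add: numeral_2_eq_2)

lemma bin_add_square: "bin 2 (\<lambda>a b. (a + b)\<^sup>2 :: 'a)"
  using bin_mult[OF bin_1[of 1 1] bin_1[of 1 1]] by (simp add: numeral_2_eq_2 power2_eq_square)

text \<open>Expansion over the binary forms in X1, X3 with respect to 1 and X0^2. Degrees are those
  of the squared form, so a square of a form of degree k is recorded with d = 2k.\<close>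

definition nf :: "nat \<Rightarrow> ('a ^ 4 \<Rightarrow> 'a) \<Rightarrow> bool" where
  "nf d f \<longleftrightarrow> (\<exists>A B. bin d A \<and> bin2 d B \<and>
     (\<forall>x\<in>cone. f x = A (x $ 1) (x $ 3) + (x $ 0)\<^sup>2 * B (x $ 1) (x $ 3)))"

lemma nfI:
  "bin d A \<Longrightarrow> bin2 d B \<Longrightarrow> (\<And>x. x \<in> cone \<Longrightarrow> f x = A (x $ 1) (x $ 3) + (x $ 0)\<^sup>2 * B (x $ 1) (x $ 3)) \<Longrightarrow> nf d f"
  unfolding nf_def by blast

lemma nf_bin: "bin d A \<Longrightarrow> nf d (\<lambda>x. A (x $ 1) (x $ 3))"
  by (rule nfI[OF _ bin2_zero]) auto

lemma nf_add:
  assumes "nf d f" "nf d g"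
  shows "nf d (\<lambda>x. f x + g x)"
proof -
  from assms obtain A B A' B' where *: "bin d A" "bin2 d B" "bin d A'" "bin2 d B'"
    "\<And>x. x \<in> cone \<Longrightarrow> f x = A (x $ 1) (x $ 3) + (x $ 0)\<^sup>2 * B (x $ 1) (x $ 3)"
    "\<And>x. x \<in> cone \<Longrightarrow> g x = A' (x $ 1) (x $ 3) + (x $ 0)\<^sup>2 * B' (x $ 1) (x $ 3)"
    unfolding nf_def by metis
  show ?thesis
    by (rule nfI[OF bin_add[OF *(1,3)] bin2_add[OF *(2,4)]]) (simp add: *(5,6) algebra_simps)
qed

lemma cone_0_mult_2: "x \<in> cone \<Longrightarrow> x $ 0 * x $ 2 = (x $ 1 + x $ 3)\<^sup>2 / e\<^sup>2"
  using coneD(2)[of x] e_nz by (simp add: field_simps)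

lemma cone_2_square: "x \<in> cone \<Longrightarrow> (x $ 2)\<^sup>2 = (x $ 0)\<^sup>2 + e\<^sup>2 * (x $ 1 * x $ 3)"
  using coneD(1)[of x] by (simp add: square_add mult.assoc[symmetric] flip: eq_iff_add) 
    (metis add.commute add_self_left)

text \<open>X0^2 and X2^2 have sum e^2 X1 X3 and product (X1 + X3)^4 / e^4, so this is the quadratic
  equation of X0^2 over the binary forms in X1, X3.\<close>

lemma cone_0_fourth:
  assumes "x \<in> cone"
  shows "(x $ 0)\<^sup>2 * (x $ 0)\<^sup>2 = (x $ 0)\<^sup>2 * (e\<^sup>2 * (x $ 1 * x $ 3)) + ((x $ 1 + x $ 3)\<^sup>2)\<^sup>2 / e ^ 4"
proof -
  have "(x $ 0 * x $ 2)\<^sup>2 = (x $ 0)\<^sup>2 * ((x $ 0)\<^sup>2 + e\<^sup>2 * (x $ 1 * x $ 3))"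
    by (simp add: power_mult_distrib cone_2_square[OF assms])
  moreover have "(x $ 0 * x $ 2)\<^sup>2 = ((x $ 1 + x $ 3)\<^sup>2)\<^sup>2 / e ^ 4"
    unfolding cone_0_mult_2[OF assms] by (simp add: power_divide)
  ultimately have "(x $ 0)\<^sup>2 * (x $ 0)\<^sup>2 + (x $ 0)\<^sup>2 * (e\<^sup>2 * (x $ 1 * x $ 3)) = ((x $ 1 + x $ 3)\<^sup>2)\<^sup>2 / e ^ 4"
    by (simp add: distrib_left)
  then show ?thesis by (metis add.commute add_self_left)
qed

lemma nf_mult:
  assumes "nf d f" "nf k g"
  shows "nf (d + k) (\<lambda>x. f x * g x)"
proof -
  from assms obtain A B A' B' where *: "bin d A" "bin2 d B" "bin k A'" "bin2 k B'"
    "\<And>x. x \<in> cone \<Longrightarrow> f x = A (x $ 1) (x $ 3) + (x $ 0)\<^sup>2 * B (x $ 1) (x $ 3)"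
    "\<And>x. x \<in> cone \<Longrightarrow> g x = A' (x $ 1) (x $ 3) + (x $ 0)\<^sup>2 * B' (x $ 1) (x $ 3)"
    unfolding nf_def by metis
  \<comment> \<open>The two contributions of the term X0^4 B B' after \<open>cone_0_fourth\<close>:
    \<open>P\<close> divided by e^4 joins the constant part, and e^2 times \<open>Q\<close> joins
    the coefficient of X0^2.\<close>
  define P where "P = (\<lambda>a b. ((a + b)\<^sup>2 * B a b) * ((a + b)\<^sup>2 * B' a b))"
  define Q where "Q = (\<lambda>a b. (a * b * B a b) * B' a b)"
  have P: "bin (d + k) P" unfolding P_def
    by (rule bin_mult[OF bin2_bin[OF bin_add_square *(2)] bin2_bin[OF bin_add_square *(4)]])
  have Q: "bin2 (d + k) Q" unfolding Q_def
    by (rule bin2_mult[OF bin2_bin[OF bin_fst_mult_snd *(2)] *(4)])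
  show ?thesis
  proof (rule nfI)
    show "bin (d + k) (\<lambda>a b. A a b * A' a b + 1 / e ^ 4 * P a b)"
      by (intro bin_add bin_mult bin_scale P *)
    have A'B: "bin2 (d + k) (\<lambda>a b. A' a b * B a b)" using bin2_mult[OF *(3,2)] by (simp add: add.commute)
    show "bin2 (d + k) (\<lambda>a b. A a b * B' a b + (A' a b * B a b + e\<^sup>2 * Q a b))"
      by (intro bin2_add bin2_mult[OF *(1,4)] bin2_scale[OF Q] A'B)
    fix x assume x: "x \<in> cone"
    have "f x * g x = A (x $ 1) (x $ 3) * A' (x $ 1) (x $ 3) +
       (x $ 0)\<^sup>2 * (A (x $ 1) (x $ 3) * B' (x $ 1) (x $ 3) + A' (x $ 1) (x $ 3) * B (x $ 1) (x $ 3)) +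
       (x $ 0)\<^sup>2 * (x $ 0)\<^sup>2 * (B (x $ 1) (x $ 3) * B' (x $ 1) (x $ 3))"
      by (simp add: *(5,6)[OF x] algebra_simps)
    also have "\<dots> = A (x $ 1) (x $ 3) * A' (x $ 1) (x $ 3) + 1 / e ^ 4 * P (x $ 1) (x $ 3) + (x $ 0)\<^sup>2 *
          (A (x $ 1) (x $ 3) * B' (x $ 1) (x $ 3) + (A' (x $ 1) (x $ 3) * B (x $ 1) (x $ 3) + e\<^sup>2 * Q (x $ 1) (x $ 3)))"
      unfolding cone_0_fourth[OF x] by (simp add: P_def Q_def power2_eq_square[of "_\<^sup>2"] field_simps)
    finally show "f x * g x = \<dots>" .
  qed
qed

lemma nf_square: "form d F \<Longrightarrow> nf (2 * d) (\<lambda>x. (F x)\<^sup>2)"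
proof (induction rule: form_induct)
  case (const c)
  then show ?case using nf_bin[of 0 "\<lambda>a b. c\<^sup>2"] by auto
next
  case (var d F i)
  have b0: "bin2 2 (\<lambda>a b. 1 :: 'a)" by (auto simp: bin2_def)
  have 0: "nf 2 (\<lambda>x. (x $ 0)\<^sup>2)" by (rule nfI[OF bin_zero b0]) simp
  have 1: "nf 2 (\<lambda>x. (x $ 1)\<^sup>2)" "nf 2 (\<lambda>x. (x $ 3)\<^sup>2)"
    using nf_bin[OF bin_mult[OF bin_1[of 1 0] bin_1[of 1 0]]] nf_bin[OF bin_mult[OF bin_1[of 0 1] bin_1[of 0 1]]]
    by (simp_all add: power2_eq_square numeral_2_eq_2)
  have 2: "nf 2 (\<lambda>x. (x $ 2)\<^sup>2)"
    by (rule nfI[OF bin_scale[OF bin_fst_mult_snd, of "e\<^sup>2"] b0]) (simp add: cone_2_square add.commute)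
  have "nf 2 (\<lambda>x. (x $ i)\<^sup>2)" using exhaust_4_0[of i] 0 1 2 by auto
  from nf_mult[OF this var.IH] show ?case by (simp add: power_mult_distrib)
next
  case (add d F G)
  then show ?case using nf_add by (simp add: square_add)
qed

text \<open>In even degree the exponents of X1 and X3 have the same parity. Monomials with even
  exponents are squares, and a remaining factor X1 X3 is the square of (X0 + X2) / e by the first
  equation; coefficients have square roots, and sums of squares are squares.\<close>

lemma bin_sqrt: "bin (2 * d) A \<Longrightarrow> \<exists>L. form d L \<and> (\<forall>x\<in>cone. A (x $ 1) (x $ 3) = (L x)\<^sup>2)"
proof (induction d arbitrary: A)
  case 0
  then obtain k where A: "A = (\<lambda>a b. k)" by auto
  obtain s where "s\<^sup>2 = k" using sqrt_exists by blast
  then show ?case using A by (intro exI[of _ "\<lambda>x. s"]) (auto intro: form_const)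
next
  case (Suc d)
  then obtain f k l where f: "bin (2 * d) f"
    "A = (\<lambda>a b. a * (a * f a b + k * b ^ (2 * d + 1)) + l * b ^ (2 * d + 2))"
    by auto
  from Suc.IH[OF f(1)] obtain L where L: "form d L" "\<And>x. x \<in> cone \<Longrightarrow> f (x $ 1) (x $ 3) = (L x)\<^sup>2" by blast
  obtain s t where st: "s\<^sup>2 = k / e\<^sup>2" "t\<^sup>2 = l" using sqrt_exists by metis
  let ?L = "\<lambda>x. x $ 1 * L x + (s * ((x $ 0 + x $ 2) * x $ 3 ^ d) + t * x $ 3 ^ Suc d)"
  have "form (1 + d) (\<lambda>x. x $ 1 * L x)" by (intro form_mult form_var L)
  moreover have "form (1 + d * 1) (\<lambda>x :: 'a ^ 4. (x $ 0 + x $ 2) * x $ 3 ^ d)"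
    by (intro form_mult form_add form_power form_var)
  moreover have "form (Suc d * 1) (\<lambda>x :: 'a ^ 4. x $ 3 ^ Suc d)" by (intro form_power form_var)
  ultimately have "form (Suc d) ?L" by (intro form_add form_scale) simp_all
  moreover have "A (x $ 1) (x $ 3) = (?L x)\<^sup>2" if x: "x \<in> cone" for x
  proof -
    have "(?L x)\<^sup>2 = (x $ 1)\<^sup>2 * (L x)\<^sup>2 + (s\<^sup>2 * ((x $ 0 + x $ 2)\<^sup>2 * (x $ 3 ^ d)\<^sup>2) + t\<^sup>2 * (x $ 3 ^ Suc d)\<^sup>2)"
      by (simp only: square_add power_mult_distrib)
    also have "\<dots> = A (x $ 1) (x $ 3)"
      unfolding coneD(1)[OF x] st L(2)[OF x, symmetric] f(2) using e_nz
      by (simp add: power2_eq_square algebra_simps mult_2_right[of d] power_add[of _ d d])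
    finally show ?thesis ..
  qed
  ultimately show ?case by blast
qed

lemma nf_sqrt:
  assumes "nf (2 * d) f"
  shows "\<exists>L. form d L \<and> (\<forall>x\<in>cone. f x = (L x)\<^sup>2)"
proof -
  from assms obtain A B where *: "bin (2 * d) A" "bin2 (2 * d) B"
    "\<And>x. x \<in> cone \<Longrightarrow> f x = A (x $ 1) (x $ 3) + (x $ 0)\<^sup>2 * B (x $ 1) (x $ 3)"
    unfolding nf_def by metis
  from bin_sqrt[OF *(1)] obtain L where L: "form d L" "\<And>x. x \<in> cone \<Longrightarrow> A (x $ 1) (x $ 3) = (L x)\<^sup>2" by blast
  have "\<exists>M. form d M \<and> (\<forall>x\<in>cone. (x $ 0)\<^sup>2 * B (x $ 1) (x $ 3) = (M x)\<^sup>2)"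
  proof (cases "B = (\<lambda>a b. 0)")
    case True
    then show ?thesis by (intro exI[of _ "\<lambda>x. 0"]) (simp add: form_zero)
  next
    case False
    with *(2) obtain m where m: "2 * d = m + 2" "bin m B" by (auto simp: bin2_def)
    then obtain k where k: "d = Suc k" "m = 2 * k" by (cases d) auto
    with m bin_sqrt[of k B] obtain M where "form k M" "\<And>x. x \<in> cone \<Longrightarrow> B (x $ 1) (x $ 3) = (M x)\<^sup>2" by blast
    then show ?thesis using form_mult[OF form_var[of 0], of k M] k(1)
      by (intro exI[of _ "\<lambda>x. x $ 0 * M x"]) (simp add: power_mult_distrib)
  qed
  then obtain M where "form d M" "\<And>x. x \<in> cone \<Longrightarrow> (x $ 0)\<^sup>2 * B (x $ 1) (x $ 3) = (M x)\<^sup>2" by blast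
  with L * show ?thesis
    by (intro exI[of _ "\<lambda>x. L x + M x"]) (simp add: form_add square_add)
qed

text \<open>The involution exchanging the two points over a point of the conic, i.e. the conjugation of the
  quadratic extension defining the norm.\<close>

definition conj4 :: "'a ^ 4 \<Rightarrow> 'a ^ 4" where
  "conj4 x = (\<chi> i. x $ (if i = 0 then 2 else if i = 2 then 0 else i))"

lemma conj4_nth [simp]: "conj4 x $ 0 = x $ 2" "conj4 x $ 1 = x $ 1" "conj4 x $ 2 = x $ 0" "conj4 x $ 3 = x $ 3"
  by (simp_all add: conj4_def)

lemma conj4_conj4 [simp]: "conj4 (conj4 x) = x"
  by (simp add: vec4_eq_iff)

lemma conj4_cone_imp: "x \<in> cone \<Longrightarrow> conj4 x \<in> cone"
  by (auto simp: cone_def add.commute mult.commute mult.left_commute vec4_eq_iff)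

lemma conj4_cone [simp]: "conj4 x \<in> cone \<longleftrightarrow> x \<in> cone"
  using conj4_cone_imp[of x] conj4_cone_imp[of "conj4 x"] by auto

lemma form_conj4: "form d F \<Longrightarrow> form d (\<lambda>x. F (conj4 x))"
  unfolding conj4_def by (rule form_permute)

lemma nonzero_conj4: "nonzero (\<lambda>x. F (conj4 x)) \<longleftrightarrow> nonzero F"
  unfolding nonzero_def by (metis conj4_cone conj4_conj4)

lemma norm_exists:
  assumes "form d F"
  shows "\<exists>N. bin (4 * d) N \<and> (\<forall>x\<in>cone. (F x * F (conj4 x))\<^sup>2 = N (x $ 1) (x $ 3))"
proof -
  from nf_square[OF assms] obtain A B where *: "bin (2 * d) A" "bin2 (2 * d) B"
    "\<And>x. x \<in> cone \<Longrightarrow> (F x)\<^sup>2 = A (x $ 1) (x $ 3) + (x $ 0)\<^sup>2 * B (x $ 1) (x $ 3)"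
    unfolding nf_def by metis
  \<comment> \<open>For F^2 = a + b X0^2 the conjugate is a + b X2^2, and the product is a^2 +
    (trace) a b + (norm) b^2, with trace e^2 X1 X3 and norm (X1 + X3)^4 / e^4 of X0^2.\<close>
  define N where "N = (\<lambda>a b. A a b * A a b + (e\<^sup>2 * ((a * b * B a b) * A a b) +
     1 / e ^ 4 * (((a + b)\<^sup>2 * B a b) * ((a + b)\<^sup>2 * B a b))))"
  have "bin (2 * d + 2 * d) N" unfolding N_def
    by (intro bin_add bin_scale bin_mult[OF *(1) *(1)] bin_mult[OF bin2_bin[OF bin_fst_mult_snd *(2)] *(1)]
        bin_mult[OF bin2_bin[OF bin_add_square *(2)] bin2_bin[OF bin_add_square *(2)]])
  moreover have "(F x * F (conj4 x))\<^sup>2 = N (x $ 1) (x $ 3)" if x: "x \<in> cone" for x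
  proof -
    have 1: "(x $ 0)\<^sup>2 * (x $ 2)\<^sup>2 = ((x $ 1 + x $ 3)\<^sup>2)\<^sup>2 / e ^ 4"
      using cone_0_mult_2[OF x] by (simp add: power_divide flip: power_mult_distrib)
    have 2: "(x $ 0)\<^sup>2 + (x $ 2)\<^sup>2 = e\<^sup>2 * (x $ 1 * x $ 3)"
      by (simp add: cone_2_square[OF x] char2_simps)
    define a b where "a = A (x $ 1) (x $ 3)" and "b = B (x $ 1) (x $ 3)"
    have "(F x * F (conj4 x))\<^sup>2 = (a + (x $ 0)\<^sup>2 * b) * (a + (x $ 2)\<^sup>2 * b)"
      using *(3)[OF x] *(3)[of "conj4 x"] x by (simp add: power_mult_distrib a_def b_def)
    also have "\<dots> = a * a + ((x $ 0)\<^sup>2 + (x $ 2)\<^sup>2) * a * b + (x $ 0)\<^sup>2 * (x $ 2)\<^sup>2 * (b * b)"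
      by (simp add: algebra_simps)
    also have "\<dots> = N (x $ 1) (x $ 3)"
      unfolding 1 2 N_def a_def b_def by (simp add: power2_eq_square[of "_\<^sup>2"] field_simps)
    finally show ?thesis .
  qed
  ultimately show ?thesis by auto
qed


section \<open>Orders and multiplicities of arbitrary forms\<close>

lemma bin_ordn:
  assumes x: "x \<in> cone" and \<pi>: "uniformizer x \<pi>"
    and lin: "\<And>a b. (a, b) \<noteq> (0, 0) \<Longrightarrow> a * x $ 1 + b * x $ 3 = 0 \<Longrightarrow>
      ordn x \<pi> (if x $ 0 = x $ 2 then 4 else 2) 1 (\<lambda>y. a * y $ 1 + b * y $ 3)"
    and "bin n N" "N s t \<noteq> 0"
  shows "\<exists>m. ordn x \<pi> m n (\<lambda>y. N (y $ 1) (y $ 3))"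
  using assms(4,5)
proof (induction n arbitrary: N)
  case 0
  then obtain k where "N = (\<lambda>a b. k)" by auto
  with 0 show ?case by (intro exI[of _ 0] ordn_form) (auto intro: form_const)
next
  case (Suc n)
  from bin_has_root[OF Suc.prems(1)] obtain a b where ab: "(a, b) \<noteq> (0, 0)" "N a b = 0" by auto
  with bin_root_factor[OF Suc.prems(1), of a b] obtain g where
    g: "bin n g" "\<And>c d. N c d = (c * b - d * a) * g c d" by blast
  with Suc.prems have "g s t \<noteq> 0" by auto
  with Suc.IH g(1) obtain m where m: "ordn x \<pi> m n (\<lambda>y. g (y $ 1) (y $ 3))" by blast
  let ?L = "\<lambda>y :: 'a ^ 4. b * y $ 1 + a * y $ 3"
  have L: "form 1 ?L" by (intro form_add form_scale form_var)
  have "\<exists>k. ordn x \<pi> k 1 ?L"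
    using lin[of b a] ab(1) ordn_form[OF L] by (cases "?L x = 0") auto
  then obtain k where "ordn x \<pi> k 1 ?L" ..
  from ordn_mult[OF this m] have "ordn x \<pi> (k + m) (Suc n) (\<lambda>y. N (y $ 1) (y $ 3))"
    by (simp add: g(2) char2_simps mult.commute)
  then show ?case ..
qed

text \<open>Every form that is nonzero on the curve has a finite order because it divides the square
  of its norm, a product of linear forms in X1, X3 with known orders. The representative
  \<open>x\<close> is the one supplied here; callers with another representative have to
  rescale.\<close>

lemma local_data:
  assumes "P \<in> C"
  obtains x \<pi> where "x \<in> cone" "P = proj_class x" "uniformizer x \<pi>"
    "\<And>d F. form d F \<Longrightarrow> nonzero F \<Longrightarrow> ordn x \<pi> (mult_at C P F) d F"
    "\<And>a b. (a, b) \<noteq> (0, 0) \<Longrightarrow> a * x $ 1 + b * x $ 3 = 0 \<Longrightarrow>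
      mult_at C P (\<lambda>y. a * y $ 1 + b * y $ 3) = (if x $ 0 = x $ 2 then 4 else 2)"
    "\<And>p. x $ 0 = x $ 2 \<Longrightarrow> p \<in> {1, 3} \<Longrightarrow> x $ p \<noteq> 0 \<Longrightarrow>
      mult_at C P (\<lambda>y. y $ 0 + x $ 0 / x $ p * y $ p) = 1"
proof -
  from assms obtain x where x: "x \<in> cone" "P = proj_class x" by (rule C_rep)
  obtain \<pi> where \<pi>: "uniformizer x \<pi>" and
    lin: "\<And>a b. (a, b) \<noteq> (0, 0) \<Longrightarrow> a * x $ 1 + b * x $ 3 = 0 \<Longrightarrow>
      ordn x \<pi> (if x $ 0 = x $ 2 then 4 else 2) 1 (\<lambda>y. a * y $ 1 + b * y $ 3)" and
    ram: "\<And>p. x $ 0 = x $ 2 \<Longrightarrow> p \<in> {1, 3} \<Longrightarrow> x $ p \<noteq> 0 \<Longrightarrow> ordn x \<pi> 1 1 (\<lambda>y. y $ 0 + x $ 0 / x $ p * y $ p)"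
    by (rule uniformizer_exists[OF x(1)]) (rule that)
  have m1: "ordn x \<pi> (mult_at C P F) d F" if F: "form d F" "nonzero F" for d F
  proof -
    from norm_exists[OF F(1)] obtain N where N: "bin (4 * d) N"
      "\<And>x. x \<in> cone \<Longrightarrow> (F x * F (conj4 x))\<^sup>2 = N (x $ 1) (x $ 3)" by blast
    have "nonzero (\<lambda>x. F x * F (conj4 x))"
      using F nonzero_conj4 form_conj4 nonzero_mult by blast
    then obtain y where "y \<in> cone" "F y * F (conj4 y) \<noteq> 0" by (auto simp: nonzero_def)
    with N(2)[of y] have "N (y $ 1) (y $ 3) \<noteq> 0" by (metis zero_eq_power2)
    from bin_ordn[OF x(1) \<pi> lin N(1) this] obtain m where m: "ordn x \<pi> m (4 * d) (\<lambda>y. N (y $ 1) (y $ 3))" by blast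
    have Q: "form (d + (d + d)) (\<lambda>y. F y * (F (conj4 y) * F (conj4 y)))"
      by (intro form_mult form_conj4 F)
    have "ordn x \<pi> m (d + (d + (d + d))) (\<lambda>y. F y * (F y * (F (conj4 y) * F (conj4 y))))"
    proof -
      have eq: "d + (d + (d + d)) = 4 * d" by simp
      show ?thesis unfolding eq
        by (rule ordn_cong[OF m]) (simp add: N(2)[symmetric] power2_eq_square mult_ac)
    qed
    from ordn_exists[OF x(1) \<pi> F(1) Q this] obtain k where "ordn x \<pi> k d F" by blast
    with mult_at_ordn[OF x(1) \<pi> F(1) this] x(2) show ?thesis by simp
  qed
  have m2: "mult_at C P (\<lambda>y. a * y $ 1 + b * y $ 3) = (if x $ 0 = x $ 2 then 4 else 2)"
    if "(a, b) \<noteq> (0, 0)" "a * x $ 1 + b * x $ 3 = 0" for a b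
    unfolding x(2) by (rule mult_at_ordn[OF x(1) \<pi> _ lin[OF that]]) (intro form_add form_scale form_var)
  have m3: "mult_at C P (\<lambda>y. y $ 0 + x $ 0 / x $ p * y $ p) = 1"
    if "x $ 0 = x $ 2" "p \<in> {1, 3}" "x $ p \<noteq> 0" for p
    unfolding x(2) by (rule mult_at_ordn[OF x(1) \<pi> _ ram[OF that]]) (intro form_add form_scale form_var)
  show ?thesis by (rule that[OF x \<pi> m1 m2 m3])
qed

lemma mult_mult:
  assumes "P \<in> C" "form d F" "nonzero F" "form k G" "nonzero G"
  shows "mult_at C P (\<lambda>x. F x * G x) = mult_at C P F + mult_at C P G"
proof -
  from assms(1) obtain x \<pi> where *: "x \<in> cone" "P = proj_class x" "uniformizer x \<pi>"
    "\<And>d F. form d F \<Longrightarrow> nonzero F \<Longrightarrow> ordn x \<pi> (mult_at C P F) d F" by (rule local_data) (rule that)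
  show ?thesis
    by (rule mult_at_ordn[OF *(1,3) form_mult[OF assms(2,4)] ordn_mult[OF *(4)[OF assms(2,3)] *(4)[OF assms(4,5)]], folded *(2)])
qed

lemma mult_pos:
  assumes "P \<in> C" "form d F" "nonzero F"
  shows "mult_at C P F > 0 \<longleftrightarrow> vanishes_at F P"
proof -
  from assms(1) obtain x \<pi> where *: "x \<in> cone" "P = proj_class x" "uniformizer x \<pi>"
    "\<And>d F. form d F \<Longrightarrow> nonzero F \<Longrightarrow> ordn x \<pi> (mult_at C P F) d F" by (rule local_data) (rule that)
  from *(4)[OF assms(2,3)] obtain G F' where
    "G x \<noteq> 0" "F' x \<noteq> 0" "\<And>y. y \<in> cone \<Longrightarrow> G y * F y = \<pi> y ^ mult_at C P F * F' y"
    unfolding ordn_def by metis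
  moreover from this have "G x * F x = \<pi> x ^ mult_at C P F * F' x" using *(1) by blast
  moreover have "\<pi> x = 0" using *(3) by (simp add: uniformizer_def)
  ultimately have "F x = 0 \<longleftrightarrow> mult_at C P F > 0" by (auto simp: power_0_left split: if_splits)
  then show ?thesis using vanishes_at_iff[OF assms(2)] *(2) by simp
qed

lemma in_max_le:
  assumes "P \<in> C" "form d F" "nonzero F"
  shows "in_max P n F \<longleftrightarrow> n \<le> mult_at C P F"
proof -
  from assms(1) obtain x \<pi> where *: "x \<in> cone" "P = proj_class x" "uniformizer x \<pi>"
    "\<And>d F. form d F \<Longrightarrow> nonzero F \<Longrightarrow> ordn x \<pi> (mult_at C P F) d F" by (rule local_data) (rule that)
  with in_max_iff[OF *(1,3) assms(2)] dvn_iff_le_ordn[OF *(1,3) *(4)[OF assms(2,3)]] show ?thesis by simp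
qed

lemma in_max_zero:
  assumes "P \<in> C" "form d F" "\<not> nonzero F"
  shows "in_max P n F"
proof -
  from assms(1) obtain x \<pi> where *: "x \<in> cone" "P = proj_class x" "uniformizer x \<pi>" by (rule local_data) (rule that)
  have "dvn x \<pi> n d F" using *(1) assms(3) by (intro dvn_zero) (auto simp: cone_def nonzero_def)
  with in_max_iff[OF *(1,3) assms(2)] *(2) show ?thesis by simp
qed

lemma in_max_add:
  assumes "P \<in> C" "form d F" "form d G" "in_max P n F" "in_max P n G"
  shows "in_max P n (\<lambda>x. F x + G x)"
proof -
  from assms(1) obtain x \<pi> where *: "x \<in> cone" "P = proj_class x" "uniformizer x \<pi>" by (rule local_data) (rule that)
  show ?thesis using assms(2-) dvn_add form_add[OF assms(2,3)] unfolding *(2)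
    by (simp add: in_max_iff[OF *(1,3)])
qed

text \<open>Successive powers of the maximal ideal have one-dimensional quotients: it suffices to
  cancel the values at the point of the two cofactors of \<open>\<pi> ^ n\<close>.\<close>

lemma in_max_combination:
  assumes "P \<in> C" "form d F" "form d G" "in_max P n F" "in_max P n G"
  obtains a b where "(a, b) \<noteq> (0, 0)" "in_max P (Suc n) (\<lambda>x. a * F x + b * G x)"
proof -
  from assms(1) obtain x \<pi> where *: "x \<in> cone" "P = proj_class x" "uniformizer x \<pi>" by (rule local_data) (rule that)
  have "dvn x \<pi> n d F" "dvn x \<pi> n d G"
    using assms unfolding *(2) in_max_iff[OF *(1,3) assms(2)] in_max_iff[OF *(1,3) assms(3)] by blast+
  from dvn_combination[OF this] obtain g H j A B where
    H: "form g H" "H x \<noteq> 0" "form j A" "form j B" "d + g = j + n"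
    "\<And>y. y \<in> cone \<Longrightarrow> H y * F y = \<pi> y ^ n * A y" "\<And>y. y \<in> cone \<Longrightarrow> H y * G y = \<pi> y ^ n * B y" by metis
  obtain a b where ab: "(a, b) \<noteq> (0, 0)" "a * A x + b * B x = 0"
  proof (cases "A x = 0")
    case True then show ?thesis using that[of 1 0] by simp
  next
    case False then show ?thesis using that[of "- B x" "A x"] by (simp add: mult.commute)
  qed
  have E: "form j (\<lambda>y. a * A y + b * B y)" by (intro form_add form_scale H)
  have f\<pi>: "form 1 \<pi>" using *(3) by (simp add: uniformizer_def)
  have "dvn x \<pi> (n + 1) (n * 1 + j) (\<lambda>y. \<pi> y ^ n * (a * A y + b * B y))"
  proof (intro dvn_mult)
    show "dvn x \<pi> n (n * 1) (\<lambda>y. \<pi> y ^ n)"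
      by (rule dvnI[OF form_const[of 1] _ form_const[of 1]]) auto
    show "dvn x \<pi> 1 j (\<lambda>y. a * A y + b * B y)" by (rule uniformizer_dvn[OF *(3) E ab(2)])
  qed
  then have "dvn x \<pi> (Suc n) (d + g) (\<lambda>y. \<pi> y ^ n * (a * A y + b * B y))" using H(5) by (simp add: add.commute)
  then have "dvn x \<pi> (Suc n) d (\<lambda>y. a * F y + b * G y)"
    by (rule dvn_divide[OF H(1,2)]) (use H(6,7) in \<open>simp add: distrib_left mult.left_commute\<close>)
  then have "in_max P (Suc n) (\<lambda>y. a * F y + b * G y)"
    unfolding *(2) in_max_iff[OF *(1,3) form_add[OF form_scale[OF assms(2)] form_scale[OF assms(3)]]] .
  with ab(1) that show ?thesis by blast
qed

lemma mult_cong: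
  assumes "P \<in> C" "form d F" "form d G" "nonzero F" "\<And>x. x \<in> cone \<Longrightarrow> F x = G x"
  shows "mult_at C P F = mult_at C P G"
proof -
  from assms(1) obtain x \<pi> where *: "x \<in> cone" "P = proj_class x" "uniformizer x \<pi>"
    "\<And>d F. form d F \<Longrightarrow> nonzero F \<Longrightarrow> ordn x \<pi> (mult_at C P F) d F" by (rule local_data) (rule that)
  show ?thesis
    using mult_at_ordn[OF *(1,3) assms(3) ordn_cong[OF *(4)[OF assms(2,4)] assms(5)]] *(2) by simp
qed

lemma mult_const: "P \<in> C \<Longrightarrow> c \<noteq> 0 \<Longrightarrow> mult_at C P (\<lambda>x. c) = 0"
proof -
  assume P: "P \<in> C" and c: "c \<noteq> 0"
  then obtain x where "x \<in> cone" "P = proj_class x" by (metis C_rep)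
  with c have "nonzero (\<lambda>x. c)" by (auto simp: nonzero_def)
  from mult_pos[OF P form_const this] c proj_class_self \<open>P = proj_class x\<close> show ?thesis
    by (auto simp: vanishes_at_def)
qed

lemma nonzero_const: "c \<noteq> 0 \<Longrightarrow> nonzero (\<lambda>x. c)"
  using torsion_cone(1) by (auto simp: nonzero_def)

lemma mult_scale:
  assumes "P \<in> C" "c \<noteq> 0" "form d F" "nonzero F"
  shows "mult_at C P (\<lambda>x. c * F x) = mult_at C P F"
  using mult_mult[OF assms(1) form_const nonzero_const assms(3,4)] mult_const assms by simp

lemma mult_square:
  assumes "P \<in> C" "form d F" "nonzero F"
  shows "mult_at C P (\<lambda>x. (F x)\<^sup>2) = 2 * mult_at C P F"
  using mult_mult[OF assms assms(2,3)] by (simp add: power2_eq_square)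

text \<open>Conjugation carries the local factorisation of \<open>F\<close> to the conjugate point,
  where the conjugate of \<open>\<pi>\<close> vanishes and so has multiplicity at least 1. An
  inequality is enough, as the conjugation is an involution.\<close>

lemma mult_conj4_le:
  assumes x: "x \<in> cone" and F: "form d F" "nonzero F"
  shows "mult_at C (proj_class x) F \<le> mult_at C (proj_class (conj4 x)) (\<lambda>y. F (conj4 y))"
proof -
  let ?P = "proj_class x" and ?Q = "proj_class (conj4 x)"
  have P: "?P \<in> C" and Q: "?Q \<in> C" using x by (simp_all add: proj_class_C)
  from P obtain z \<pi> where *: "z \<in> cone" "?P = proj_class z" "uniformizer z \<pi>"
    "\<And>d F. form d F \<Longrightarrow> nonzero F \<Longrightarrow> ordn z \<pi> (mult_at C ?P F) d F" by (rule local_data) (rule that)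
  have f\<pi>: "form 1 \<pi>" "nonzero \<pi>" "\<pi> z = 0" using *(3) by (simp_all add: uniformizer_def)
  from *(4)[OF F] obtain g G k F' where
    G: "form g G" "G z \<noteq> 0" "form k F'" "F' z \<noteq> 0" "\<And>y. y \<in> cone \<Longrightarrow> G y * F y = \<pi> y ^ mult_at C ?P F * F' y"
    "d + g = k + mult_at C ?P F"
    unfolding ordn_def by metis
  let ?n = "mult_at C ?P F"
  let ?c = "\<lambda>F y. F (conj4 y) :: 'a"
  have nz: "nonzero G" "nonzero F'" using G *(1) by (auto simp: nonzero_def)
  obtain s where s: "s \<noteq> 0" "z = s *s x" using *(2) proj_class_eq_iff by blast
  have "conj4 z = s *s conj4 x" unfolding s(2) by (simp add: vec4_eq_iff)
  then have Qz: "?Q = proj_class (conj4 z)" using s(1) by (simp add: proj_class_scale)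
  have mG: "mult_at C ?Q (?c G) = 0"
    using mult_pos[OF Q form_conj4[OF G(1)]] nz G(2) vanishes_at_iff[OF form_conj4[OF G(1)], of "conj4 z"] Qz
    by (simp add: nonzero_conj4)
  have m\<pi>: "mult_at C ?Q (?c \<pi>) > 0"
    using mult_pos[OF Q form_conj4[OF f\<pi>(1)]] f\<pi> vanishes_at_iff[OF form_conj4[OF f\<pi>(1)], of "conj4 z"] Qz
    by (simp add: nonzero_conj4)
  have pow: "mult_at C ?Q (\<lambda>y. \<pi> (conj4 y) ^ m) = m * mult_at C ?Q (?c \<pi>)" for m
  proof (induction m)
    case 0 then show ?case using mult_const[OF Q, of 1] by simp
  next
    case (Suc m)
    have nzc: "nonzero (\<lambda>y. \<pi> (conj4 y))" using f\<pi>(2) by (simp add: nonzero_conj4)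
    note form_power[OF form_conj4[OF f\<pi>(1)], of m] nonzero_power[OF form_conj4[OF f\<pi>(1)] nzc, of m]
    from mult_mult[OF Q form_conj4[OF f\<pi>(1)] _ this] Suc f\<pi> show ?case by (simp add: nonzero_conj4)
  qed
  have p: "form (?n * 1) (\<lambda>y. \<pi> y ^ ?n)" "nonzero (\<lambda>y. \<pi> y ^ ?n)"
    by (rule form_power[OF f\<pi>(1)], rule nonzero_power[OF f\<pi>(1,2)])
  have "mult_at C ?Q (\<lambda>y. G (conj4 y) * F (conj4 y)) = mult_at C ?Q (?c G) + mult_at C ?Q (?c F)"
    using F G nz by (intro mult_mult[OF Q]) (auto simp: nonzero_conj4 intro: form_conj4)
  moreover have "mult_at C ?Q (\<lambda>y. \<pi> (conj4 y) ^ ?n * F' (conj4 y)) = mult_at C ?Q (\<lambda>y. \<pi> (conj4 y) ^ ?n) + mult_at C ?Q (?c F')"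
    using p G nz nonzero_conj4[of "\<lambda>y. \<pi> y ^ ?n"] nonzero_conj4[of F']
    by (intro mult_mult[OF Q form_conj4[OF p(1)] _ form_conj4[OF G(3)]]) auto
  moreover have "mult_at C ?Q (\<lambda>y. G (conj4 y) * F (conj4 y)) = mult_at C ?Q (\<lambda>y. \<pi> (conj4 y) ^ ?n * F' (conj4 y))"
  proof (rule mult_cong[OF Q])
    show "form (g + d) (\<lambda>y. G (conj4 y) * F (conj4 y))" by (intro form_mult form_conj4 G F)
    have "g + d = ?n * 1 + k" using G(6) by simp
    then show "form (g + d) (\<lambda>y. \<pi> (conj4 y) ^ ?n * F' (conj4 y))"
      using form_conj4[OF form_mult[OF p(1) G(3)]] by simp
    show "nonzero (\<lambda>y. G (conj4 y) * F (conj4 y))"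
      using nonzero_conj4[of "\<lambda>y. G y * F y"] nonzero_mult[OF G(1) F(1)] nz F by simp
  qed (use G(5) in simp)
  ultimately have "mult_at C ?Q (?c F) \<ge> ?n * mult_at C ?Q (?c \<pi>)" by (simp add: mG pow)
  moreover have "?n * 1 \<le> ?n * mult_at C ?Q (?c \<pi>)" using m\<pi> by (intro mult_le_mono2) simp
  ultimately have "?n * 1 \<le> mult_at C ?Q (?c F)" by (rule order_trans[rotated])
  then show ?thesis by simp
qed

lemma mult_conj4:
  assumes x: "x \<in> cone" and F: "form d F" "nonzero F"
  shows "mult_at C (proj_class (conj4 x)) (\<lambda>y. F (conj4 y)) = mult_at C (proj_class x) F"
proof (rule antisym)
  show "mult_at C (proj_class (conj4 x)) (\<lambda>y. F (conj4 y)) \<le> mult_at C (proj_class x) F"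
    using mult_conj4_le[of "conj4 x" d "\<lambda>y. F (conj4 y)"] x F form_conj4[OF F(1)] by (simp add: nonzero_conj4)
qed (rule mult_conj4_le[OF assms])

end

abbreviation "lookup \<equiv> Poly_Mapping.lookup"

lemma divisor_degree_superset:
  assumes "finite S" "Poly_Mapping.keys D \<subseteq> S"
  shows "divisor_degree D = (\<Sum>P\<in>S. lookup D P)"
  unfolding divisor_degree_def using assms
  by (intro sum.mono_neutral_left) (auto simp: in_keys_iff)

lemma divisor_degree_add: "divisor_degree (D + E) = divisor_degree D + divisor_degree E"
proof -
  let ?S = "Poly_Mapping.keys D \<union> Poly_Mapping.keys E"
  have "divisor_degree (D + E) = (\<Sum>P\<in>?S. lookup (D + E) P)"
    by (intro divisor_degree_superset) (auto simp: keys_add)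
  then show ?thesis
    by (simp add: divisor_degree_superset[of ?S] lookup_add sum.distrib)
qed

lemma divisor_degree_uminus: "divisor_degree (- D) = - divisor_degree D"
  by (simp add: divisor_degree_def sum_negf)

lemma divisor_degree_diff: "divisor_degree (D - E) = divisor_degree D - divisor_degree E"
  using divisor_degree_add[of D "- E"] by (simp add: divisor_degree_uminus)

lemma divisor_degree_frag_of: "divisor_degree (frag_of P) = 1"
  by (simp add: divisor_degree_def)

lemma divisor_degree_cmul: "divisor_degree (frag_cmul k D) = k * divisor_degree D"
  using divisor_degree_superset[of "Poly_Mapping.keys D" "frag_cmul k D"] keys_cmul[of k D]
  by (simp add: divisor_degree_def sum_distrib_left)

context mu4 begin

section \<open>The degree of a divisor of a form\<close>

definition zeros :: "('a ^ 4 \<Rightarrow> 'a) \<Rightarrow> ('a ^ 4) set set" where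
  "zeros F = proj_class ` {x \<in> cone. F x = 0}"

lemma zeros_eq: "form d F \<Longrightarrow> {P \<in> C. vanishes_at F P} = zeros F"
  unfolding zeros_def C_eq_image by (auto simp: vanishes_at_iff)

lemma zeros_mult: "zeros (\<lambda>x. F x * G x) = zeros F \<union> zeros G"
  by (auto simp: zeros_def)

text \<open>Over (s : t) the coordinates X0, X2 have sum u with u^2 = e^2 s t and product ((s + t) /
  e)^2, so they are the two roots of a quadratic polynomial; the roots coincide exactly when u =
  0.\<close>

lemma fiber:
  assumes st: "(s, t) \<noteq> (0, 0)"
  obtains x where "x \<in> cone" "x $ 1 = s" "x $ 3 = t" "x $ 0 = x $ 2 \<longleftrightarrow> s * t = 0"
    "zeros (\<lambda>y. t * y $ 1 + s * y $ 3) = {proj_class x, proj_class (conj4 x)}"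
proof -
  obtain w where w: "w\<^sup>2 = s * t" using sqrt_exists by blast
  define u where "u = e * w"
  have u: "u\<^sup>2 = e\<^sup>2 * s * t" by (simp add: u_def power_mult_distrib w)
  obtain r where "poly [:((s + t) / e)\<^sup>2, u, 1:] r = 0"
    using alg_closed_imp_poly_has_root[of "[:((s + t) / e)\<^sup>2, u, 1:]"] by auto
  then have "r * (r + u) + ((s + t) / e)\<^sup>2 = 0" by (simp add: algebra_simps)
  then have r: "r * (r + u) = ((s + t) / e)\<^sup>2" by (rule eq_iff_add[THEN iffD2])
  define x where "x = vec4 r s (r + u) t"
  have "(r + (r + u))\<^sup>2 = e\<^sup>2 * s * t" using u by (simp add: add_self_left)
  moreover have "(s + t)\<^sup>2 = e\<^sup>2 * (r * (r + u))" unfolding r using e_nz by (simp add: power_divide)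
  ultimately have xc: "x \<in> cone" unfolding x_def vec4_cone using st by (auto simp: mult.assoc)
  have "r = r + u \<longleftrightarrow> s * t = 0" using u e_nz by auto
  moreover have "zeros (\<lambda>y. t * y $ 1 + s * y $ 3) = {proj_class x, proj_class (conj4 x)}"
  proof (intro subset_antisym subsetI)
    fix P assume "P \<in> zeros (\<lambda>y. t * y $ 1 + s * y $ 3)"
    then obtain y where y: "y \<in> cone" "P = proj_class y" "t * y $ 1 + s * y $ 3 = 0" by (auto simp: zeros_def)
    then have ts: "t * y $ 1 = s * y $ 3" using eq_iff_add by blast
    obtain l where l: "y $ 1 = l * s" "y $ 3 = l * t"
    proof (cases "s = 0")
      case True with ts st that[of "y $ 3 / t"] show ?thesis by auto
    next
      case False with ts that[of "y $ 1 / s"] show ?thesis by (auto simp: field_simps)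
    qed
    with cone_1_3[OF y(1)] have "l \<noteq> 0" by auto
    define z where "z = inverse l *s y"
    have z: "z \<in> cone" "P = proj_class z" "z $ 1 = s" "z $ 3 = t"
      using y \<open>l \<noteq> 0\<close> l by (simp_all add: z_def cone_scale proj_class_scale)
    have "(z $ 0 + z $ 2)\<^sup>2 = u\<^sup>2" using coneD(1)[OF z(1)] u z by simp
    then have zu: "z $ 2 = z $ 0 + u" by (metis add_self_left square_inj)
    have "z $ 0 * (z $ 0 + u) = r * (r + u)"
      using cone_0_mult_2[OF z(1)] r z zu by (simp add: power_divide)
    then have "(z $ 0 + r) * (z $ 0 + (r + u)) = 0" 
      by (simp add: algebra_simps char2_simps)
    then have "z $ 0 = r \<or> z $ 0 = r + u" using eq_iff_add by (metis mult_eq_0_iff)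
    then have "z = x \<or> z = conj4 x" using z zu by (auto simp: x_def vec4_eq_iff char2_simps add.assoc)
    with z(2) show "P \<in> {proj_class x, proj_class (conj4 x)}" by blast
  next
    fix P assume "P \<in> {proj_class x, proj_class (conj4 x)}"
    then show "P \<in> zeros (\<lambda>y. t * y $ 1 + s * y $ 3)" using xc 
      by (auto simp: zeros_def x_def mult.commute char2_simps)
  qed
  ultimately show ?thesis using that[of x] xc by (simp add: x_def)
qed

lemma proj_class_conj4_eq: "x \<in> cone \<Longrightarrow> proj_class x = proj_class (conj4 x) \<longleftrightarrow> x $ 0 = x $ 2"
  using cone_1_3[of x] by (auto simp: proj_class_eq_iff vec4_eq_iff)

lemma nonzero_bin: "N s t \<noteq> 0 \<Longrightarrow> (s, t) \<noteq> (0, 0) \<Longrightarrow> nonzero (\<lambda>y. N (y $ 1) (y $ 3))"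
  by (rule fiber[of s t]) (auto simp: nonzero_def)

lemma nonzero_bin_linear: "(a, b) \<noteq> (0, 0) \<Longrightarrow> nonzero (\<lambda>y. a * y $ 1 + b * y $ 3)"
  using nonzero_bin[of "\<lambda>c d. a * c + b * d" 1 0] nonzero_bin[of "\<lambda>c d. a * c + b * d" 0 1] by auto

lemma nonzero_bin_iff:
  assumes "bin n N" "nonzero (\<lambda>y. N (y $ 1) (y $ 3))"
  shows "n = 0 \<or> (\<exists>s t g. (s, t) \<noteq> (0, 0) \<and> bin (n - 1) g \<and> N = (\<lambda>a b. (t * a + s * b) * g a b) \<and>
    nonzero (\<lambda>y. g (y $ 1) (y $ 3)))"
proof (cases n)
  case (Suc m)
  with bin_has_root[of m N] assms(1) obtain s t where st: "(s, t) \<noteq> (0, 0)" "N s t = 0" by auto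
  with bin_root_factor[of m N s t] assms(1) Suc obtain g where
    g: "bin m g" "\<And>a b. N a b = (a * t - b * s) * g a b" by blast
  have "N = (\<lambda>a b. (t * a + s * b) * g a b)"
    by (simp add: g(2) fun_eq_iff char2_simps mult.commute)
  moreover have "nonzero (\<lambda>y. g (y $ 1) (y $ 3))"
    using assms(2) by (auto simp: nonzero_def g(2))
  ultimately show ?thesis using st(1) g(1) Suc by auto
qed auto

text \<open>A zero of \<open>F\<close> is a zero of the square of its norm, and a binary form in X1,
  X3 vanishes on finitely many fibres, each of at most two points.\<close>

lemma finite_zeros:
  assumes "form d F" "nonzero F"
  shows "finite (zeros F)"
proof -
  have bin: "finite (zeros (\<lambda>y. N (y $ 1) (y $ 3)))" if "bin n N" "nonzero (\<lambda>y. N (y $ 1) (y $ 3))" for n N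
    using that
  proof (induction n arbitrary: N)
    case 0
    then obtain k where "N = (\<lambda>a b. k)" by auto
    with 0 show ?case by (auto simp: zeros_def nonzero_def)
  next
    case (Suc n)
    from nonzero_bin_iff[OF Suc.prems] obtain s t g where *: "(s, t) \<noteq> (0, 0)" "bin n g"
      "N = (\<lambda>a b. (t * a + s * b) * g a b)" "nonzero (\<lambda>y. g (y $ 1) (y $ 3))" by auto
    have "finite (zeros (\<lambda>y. t * y $ 1 + s * y $ 3))" by (rule fiber[OF *(1)]) simp
    with Suc.IH[OF *(2,4)] show ?case by (simp add: *(3) zeros_mult)
  qed
  from norm_exists[OF assms(1)] obtain N where N: "bin (4 * d) N"
    "\<And>x. x \<in> cone \<Longrightarrow> (F x * F (conj4 x))\<^sup>2 = N (x $ 1) (x $ 3)" by blast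
  have "nonzero (\<lambda>x. F x * F (conj4 x))"
    using nonzero_mult[OF assms(1) form_conj4[OF assms(1)]] assms(2) nonzero_conj4 by blast
  then obtain x where "x \<in> cone" "F x * F (conj4 x) \<noteq> 0" by (auto simp: nonzero_def)
  with N(2)[of x] have "N (x $ 1) (x $ 3) \<noteq> 0" by (metis zero_eq_power2)
  with \<open>x \<in> cone\<close> have "finite (zeros (\<lambda>y. N (y $ 1) (y $ 3)))" by (intro bin[OF N(1)]) (auto simp: nonzero_def)
  moreover have "zeros F \<subseteq> zeros (\<lambda>y. N (y $ 1) (y $ 3))" by (auto simp: zeros_def N(2)[symmetric])
  ultimately show ?thesis by (rule rev_finite_subset)
qed

lemma mult_eq_0_outside_zeros:
  assumes "form d F" "nonzero F" "P \<in> C" "P \<notin> zeros F"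
  shows "mult_at C P F = 0"
  using mult_pos[OF assms(3,1,2)] assms(3,4) zeros_eq[OF assms(1)] by blast

text \<open>Finiteness of the zero set matters here: a sum over an infinite set would be 0 by
  convention.\<close>

lemma lookup_div:
  assumes "form d F" "nonzero F"
  shows "lookup (div_of_form C F) P = (if P \<in> C then int (mult_at C P F) else 0)"
proof -
  have "lookup (div_of_form C F) P
      = (\<Sum>Q\<in>zeros F. int (mult_at C Q F) * (if P = Q then 1 else 0))"
    unfolding div_of_form_def zeros_eq[OF assms(1)] by (simp add: lookup_sum)
  also have "\<dots> = (if P \<in> zeros F then int (mult_at C P F) else 0)"
    using finite_zeros[OF assms] by (simp add: if_distrib cong: if_cong)
  finally show ?thesis
    using mult_eq_0_outside_zeros[OF assms] zeros_eq[OF assms(1)] by auto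
qed

lemma div_mult:
  assumes "form d F" "nonzero F" "form k G" "nonzero G"
  shows "div_of_form C (\<lambda>x. F x * G x) = div_of_form C F + div_of_form C G"
proof (rule poly_mapping_eqI)
  fix P
  have "nonzero (\<lambda>x. F x * G x)" using nonzero_mult assms by blast
  with assms show "lookup (div_of_form C (\<lambda>x. F x * G x)) P
    = lookup (div_of_form C F + div_of_form C G) P"
    by (simp add: lookup_div[OF form_mult[OF assms(1,3)]] lookup_div[OF assms(1,2)] lookup_div[OF assms(3,4)]
      lookup_add mult_mult[OF _ assms])
qed

lemma div_cong:
  assumes "form d F" "form d G" "nonzero F" "\<And>x. x \<in> cone \<Longrightarrow> F x = G x"
  shows "div_of_form C F = div_of_form C G"
proof (rule poly_mapping_eqI)
  fix P
  have "nonzero G" using assms(3,4) by (auto simp: nonzero_def)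
  then show "lookup (div_of_form C F) P = lookup (div_of_form C G) P"
    by (simp add: lookup_div[OF assms(1,3)] lookup_div[OF assms(2)] mult_cong[OF _ assms])
qed

lemma keys_div:
  assumes "form d F" "nonzero F"
  shows "Poly_Mapping.keys (div_of_form C F) = zeros F"
proof -
  have "Poly_Mapping.keys (div_of_form C F) = {P \<in> C. mult_at C P F > 0}"
    by (auto simp: in_keys_iff lookup_div[OF assms] split: if_splits)
  also have "\<dots> = {P \<in> C. vanishes_at F P}" using mult_pos[OF _ assms] by blast
  finally show ?thesis by (simp only: zeros_eq[OF assms(1)])
qed

lemma degree_div_sum:
  assumes "form d F" "nonzero F"
  shows "divisor_degree (div_of_form C F) = (\<Sum>P\<in>zeros F. int (mult_at C P F))"
  unfolding divisor_degree_def keys_div[OF assms]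
  by (rule sum.cong) (use zeros_eq[OF assms(1)] in \<open>auto simp: lookup_div[OF assms]\<close>)

lemma mult_bin_linear:
  assumes "x \<in> cone" "(a, b) \<noteq> (0, 0)" "a * x $ 1 + b * x $ 3 = 0"
  shows "mult_at C (proj_class x) (\<lambda>y. a * y $ 1 + b * y $ 3) = (if x $ 0 = x $ 2 then 4 else 2)"
proof -
  from assms(1) have "proj_class x \<in> C" by (simp add: proj_class_C)
  then obtain z where z: "z \<in> cone" "proj_class x = proj_class z"
    "\<And>a b. (a, b) \<noteq> (0, 0) \<Longrightarrow> a * z $ 1 + b * z $ 3 = 0 \<Longrightarrow>
      mult_at C (proj_class x) (\<lambda>y. a * y $ 1 + b * y $ 3) = (if z $ 0 = z $ 2 then 4 else 2)"
    by (rule local_data) (rule that)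
  then obtain s where s: "s \<noteq> 0" "z = s *s x" using proj_class_eq_iff by blast
  have "a * (s * x $ 1) + b * (s * x $ 3) = s * (a * x $ 1 + b * x $ 3)" by (simp add: algebra_simps)
  with assms s z(3)[OF assms(2)] show ?thesis by simp
qed

text \<open>The fibre consists either of two points of multiplicity 2 or of one ramified point of
  multiplicity 4.\<close>

lemma degree_bin_linear:
  assumes st: "(s, t) \<noteq> (0, 0)"
  shows "divisor_degree (div_of_form C (\<lambda>y. t * y $ 1 + s * y $ 3)) = 4"
proof -
  obtain x where x: "x \<in> cone" "x $ 1 = s" "x $ 3 = t" "x $ 0 = x $ 2 \<longleftrightarrow> s * t = 0"
    "zeros (\<lambda>y. t * y $ 1 + s * y $ 3) = {proj_class x, proj_class (conj4 x)}" using fiber[OF st] .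
  have "form 1 (\<lambda>y :: 'a ^ 4. t * y $ 1 + s * y $ 3)" "nonzero (\<lambda>y. t * y $ 1 + s * y $ 3)"
    using nonzero_bin_linear[of t s] st by (auto intro!: form_add form_scale form_var simp del: One_nat_def)
  note deg = degree_div_sum[OF this]
  have ts: "(t, s) \<noteq> (0, 0)" using st by auto
  have "t * x $ 1 + s * x $ 3 = 0" "t * conj4 x $ 1 + s * conj4 x $ 3 = 0"
    by (simp_all add: x mult.commute char2_simps)
  with mult_bin_linear[OF x(1) ts] mult_bin_linear[of "conj4 x", OF _ ts] x(1)
  have m: "mult_at C (proj_class x) (\<lambda>y. t * y $ 1 + s * y $ 3) = (if x $ 0 = x $ 2 then 4 else 2)"
    "mult_at C (proj_class (conj4 x)) (\<lambda>y. t * y $ 1 + s * y $ 3) = (if x $ 0 = x $ 2 then 4 else 2)"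
    by auto
  show ?thesis unfolding deg x(5) using proj_class_conj4_eq[OF x(1)] m
    by (cases "x $ 0 = x $ 2") auto
qed

lemma degree_bin:
  assumes "bin n N" "nonzero (\<lambda>y. N (y $ 1) (y $ 3))"
  shows "divisor_degree (div_of_form C (\<lambda>y. N (y $ 1) (y $ 3))) = 4 * int n"
  using assms
proof (induction n arbitrary: N)
  case 0
  then obtain k where k: "N = (\<lambda>a b. k)" by auto
  have "zeros (\<lambda>y. k) = {}" using 0 by (auto simp: k zeros_def nonzero_def)
  with degree_div_sum[OF form_const, of k] 0 show ?case by (simp add: k)
next
  case (Suc n)
  from nonzero_bin_iff[OF Suc.prems] obtain s t g where *: "(s, t) \<noteq> (0, 0)" "bin n g"
    "N = (\<lambda>a b. (t * a + s * b) * g a b)" "nonzero (\<lambda>y. g (y $ 1) (y $ 3))" by auto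
  have "form 1 (\<lambda>y :: 'a ^ 4. t * y $ 1 + s * y $ 3)" "nonzero (\<lambda>y. t * y $ 1 + s * y $ 3)"
    using nonzero_bin_linear[of t s] *(1) by (auto intro!: form_add form_scale form_var simp del: One_nat_def)
  from div_mult[OF this bin_form[OF *(2)] *(4)] Suc.IH[OF *(2,4)] degree_bin_linear[OF *(1)]
  show ?case by (simp add: *(3) divisor_degree_add)
qed

lemma degree_conj4:
  assumes "form d F" "nonzero F"
  shows "divisor_degree (div_of_form C (\<lambda>y. F (conj4 y))) = divisor_degree (div_of_form C F)"
proof -
  have nz: "nonzero (\<lambda>y. F (conj4 y))" using assms nonzero_conj4 by blast
  have im: "conj4 ` proj_class x = proj_class (conj4 x)" for x
  proof -
    have "conj4 (s *s x) = s *s conj4 x" for s by (simp add: vec4_eq_iff)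
    then show ?thesis by (auto simp: proj_class_def image_iff) metis
  qed
  have "(\<Sum>P\<in>zeros (\<lambda>y. F (conj4 y)). int (mult_at C P (\<lambda>y. F (conj4 y)))) = (\<Sum>P\<in>zeros F. int (mult_at C P F))"
  proof (rule sum.reindex_bij_witness[where i = "image conj4" and j = "image conj4"])
    fix P assume "P \<in> zeros (\<lambda>y. F (conj4 y))"
    then obtain x where x: "x \<in> cone" "F (conj4 x) = 0" "P = proj_class x" by (auto simp: zeros_def)
    then show "conj4 ` P \<in> zeros F" by (auto simp: zeros_def im)
    show "int (mult_at C (conj4 ` P) F) = int (mult_at C P (\<lambda>y. F (conj4 y)))"
      using mult_conj4[of "conj4 x", OF _ assms] x by (simp add: im)
  next
    fix P assume "P \<in> zeros F"
    then obtain x where x: "x \<in> cone" "F x = 0" "P = proj_class x" by (auto simp: zeros_def)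
    then show "conj4 ` P \<in> zeros (\<lambda>y. F (conj4 y))"
      by (auto simp: zeros_def im intro!: image_eqI[of _ _ "conj4 x"])
  qed (simp_all add: image_image)
  then show ?thesis by (simp add: degree_div_sum[OF assms] degree_div_sum[OF form_conj4[OF assms(1)] nz])
qed

text \<open>The square of the norm is a binary form of degree 4d, so its divisor has degree 16d. It
  is a product of four factors, twice \<open>F\<close> and twice its conjugate, whose divisors have
  equal degree.\<close>

lemma degree_div:
  assumes "form d F" "nonzero F"
  shows "divisor_degree (div_of_form C F) = 4 * int d"
proof -
  from norm_exists[OF assms(1)] obtain N where N: "bin (4 * d) N"
    "\<And>x. x \<in> cone \<Longrightarrow> (F x * F (conj4 x))\<^sup>2 = N (x $ 1) (x $ 3)" by blast
  let ?G = "\<lambda>x. F x * F (conj4 x)"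
  have F': "form d (\<lambda>y. F (conj4 y))" "nonzero (\<lambda>y. F (conj4 y))" using assms form_conj4 nonzero_conj4 by blast+
  have G: "form (d + d) ?G" "nonzero ?G" using assms F' nonzero_mult form_mult by blast+
  have "d + d + (d + d) = 4 * d" by simp
  with form_mult[OF G(1) G(1)] have GG: "form (4 * d) (\<lambda>x. ?G x * ?G x)" "nonzero (\<lambda>x. ?G x * ?G x)"
    using nonzero_mult[OF G(1) G(1)] G(2) by simp_all
  have NG: "?G x * ?G x = N (x $ 1) (x $ 3)" if "x \<in> cone" for x using N(2)[OF that] by (simp add: power2_eq_square)
  have "nonzero (\<lambda>y. N (y $ 1) (y $ 3))" using GG(2) NG by (auto simp: nonzero_def)
  from degree_bin[OF N(1) this] div_cong[OF GG(1) bin_form[OF N(1)] GG(2) NG]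
  have "divisor_degree (div_of_form C (\<lambda>x. ?G x * ?G x)) = 16 * int d" by simp
  then show ?thesis
    using div_mult[OF G G] div_mult[OF assms F'] degree_conj4[OF assms] by (simp add: divisor_degree_add)
qed


section \<open>Completeness of the linear systems of forms\<close>

lemma form_nf:
  assumes "bin d A" "bin2 d B"
  shows "form d (\<lambda>x. A (x $ 1) (x $ 3) + (x $ 0)\<^sup>2 * B (x $ 1) (x $ 3))"
proof (rule form_add)
  show "form d (\<lambda>x. (x $ 0)\<^sup>2 * B (x $ 1) (x $ 3))"
  proof (cases "B = (\<lambda>a b. 0)")
    case False
    with assms(2) obtain m where "d = 2 * 1 + m" "bin m B" by (auto simp: bin2_def)
    then show ?thesis using form_mult[OF form_power[OF form_var[of 0], of 2] bin_form] by blast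
  qed (simp add: form_zero)
qed (rule bin_form[OF assms(1)])

lemma linear_factor:
  assumes A: "bin d A" and B: "bin2 d B" and "A s t = 0" "B s t = 0" "(s, t) \<noteq> (0, 0)"
    and nz: "nonzero (\<lambda>x. A (x $ 1) (x $ 3) + (x $ 0)\<^sup>2 * B (x $ 1) (x $ 3))"
  obtains m A' B' where "d = Suc m" "bin m A'" "bin2 m B'"
    "A = (\<lambda>a b. (t * a + s * b) * A' a b)" "B = (\<lambda>a b. (t * a + s * b) * B' a b)"
proof -
  have "d \<noteq> 0"
  proof
    assume "d = 0"
    with A B have "B = (\<lambda>a b. 0)" "\<exists>k. A = (\<lambda>a b. k)" by (auto simp: bin2_def)
    with \<open>A s t = 0\<close> nz show False by (auto simp: nonzero_def)
  qed
  then obtain m where d: "d = Suc m" by (cases d) auto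
  from bin_root_factor[OF A[unfolded d] assms(3,5)] obtain A' where
    A': "bin m A'" "\<And>a b. A a b = (a * t - b * s) * A' a b" by blast
  obtain B' where B': "bin2 m B'" "\<And>a b. B a b = (a * t - b * s) * B' a b"
  proof (cases "B = (\<lambda>a b. 0)")
    case True
    with that[of "\<lambda>a b. 0"] show ?thesis by (simp add: bin2_zero)
  next
    case False
    with B obtain k where k: "d = k + 2" "bin k B" by (auto simp: bin2_def)
    show ?thesis
    proof (cases k)
      case 0
      with k have "\<exists>c. B = (\<lambda>a b. c)" by auto
      with \<open>B s t = 0\<close> False show ?thesis by auto
    next
      case (Suc l)
      with k bin_root_factor[of l B, OF _ assms(4,5)] obtain B' where
        "bin l B'" "\<And>a b. B a b = (a * t - b * s) * B' a b" by blast
      with that[of B'] k d Suc show ?thesis by (auto simp: bin2_def)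
    qed
  qed
  show ?thesis
    by (rule that[OF d A'(1) B'(1)]) (simp_all add: A'(2) B'(2) fun_eq_iff char2_simps mult.commute)
qed

text \<open>Over an unramified point the two equations A + x_0^2 B = 0 and A + x_2^2 B = 0 already
  give A = B = 0. Over a ramified one they coincide, and the missing condition has to come from the
  multiplicity 4 of the linear form there.\<close>

lemma vanish_of_divisible:
  assumes A: "bin d A" and B: "bin2 d B" and st: "(s, t) \<noteq> (0, 0)"
    and nz: "nonzero (\<lambda>x. A (x $ 1) (x $ 3) + (x $ 0)\<^sup>2 * B (x $ 1) (x $ 3))"
    and div: "\<And>P. P \<in> C \<Longrightarrow> mult_at C P (\<lambda>y. t * y $ 1 + s * y $ 3)
      \<le> mult_at C P (\<lambda>x. A (x $ 1) (x $ 3) + (x $ 0)\<^sup>2 * B (x $ 1) (x $ 3))"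
  shows "A s t = 0 \<and> B s t = 0"
proof -
  let ?L = "\<lambda>y :: 'a ^ 4. t * y $ 1 + s * y $ 3"
  let ?\<Phi> = "\<lambda>x :: 'a ^ 4. A (x $ 1) (x $ 3) + (x $ 0)\<^sup>2 * B (x $ 1) (x $ 3)"
  have ts: "(t, s) \<noteq> (0, 0)" using st by auto
  have L: "form 1 ?L" "nonzero ?L"
    using nonzero_bin_linear[OF ts] by (auto intro!: form_add form_scale form_var simp del: One_nat_def)
  have \<Phi>: "form d ?\<Phi>" by (rule form_nf[OF A B])
  obtain x where x: "x \<in> cone" "x $ 1 = s" "x $ 3 = t" "x $ 0 = x $ 2 \<longleftrightarrow> s * t = 0" using fiber[OF st] .
  have van: "?\<Phi> y = 0" if "y \<in> cone" "?L y = 0" for y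
  proof -
    have P: "proj_class y \<in> C" using that by (simp add: proj_class_C)
    then have "mult_at C (proj_class y) ?L > 0" using mult_pos[OF P L] vanishes_at_iff[OF L(1)] that(2) by blast
    with div[OF P] have "mult_at C (proj_class y) ?\<Phi> > 0" by linarith
    then show ?thesis using mult_pos[OF P \<Phi> nz] vanishes_at_iff[OF \<Phi>] by blast
  qed
  have Lx: "?L x = 0" by (simp add: x mult.commute char2_simps)
  have x0: "A s t + (x $ 0)\<^sup>2 * B s t = 0" using van[OF x(1) Lx] by (simp only: x)
  have x2: "A s t + (x $ 2)\<^sup>2 * B s t = 0"
    using van[of "conj4 x"] x(1) Lx by (simp only: conj4_cone conj4_nth x simp_thms)
  have "B s t = 0"
  proof (cases "x $ 0 = x $ 2")
    case False
    have "(x $ 0 + x $ 2)\<^sup>2 * B s t = (A s t + (x $ 0)\<^sup>2 * B s t) + (A s t + (x $ 2)\<^sup>2 * B s t)"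
      by (simp add: square_add algebra_simps char2_simps)
    then have "(x $ 0 + x $ 2)\<^sup>2 * B s t = 0" using x0 x2 by simp
    moreover have "x $ 0 + x $ 2 \<noteq> 0" using False eq_iff_add by blast
    ultimately show ?thesis by simp
  next
    case True
    have P: "proj_class x \<in> C" using x(1) by (simp add: proj_class_C)
    let ?P = "proj_class x"
    obtain p where p: "p \<in> {1, 3}" "x $ p \<noteq> 0" using cone_1_3[OF x(1)] by auto
    define k where "k = x $ 0 / x $ p"
    let ?E = "\<lambda>y :: 'a ^ 4. y $ 0 + k * y $ p"
    let ?pr = "\<lambda>a b :: 'a. if p = 1 then a else b"
    have pr: "bin 2 (\<lambda>a b. (?pr a b)\<^sup>2)"
      using bin_mult[OF bin_1[of 1 0] bin_1[of 1 0]] bin_mult[OF bin_1[of 0 1] bin_1[of 0 1]]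
      by (cases "p = 1") (simp_all add: power2_eq_square numeral_2_eq_2 del: bin.simps)
    \<comment> \<open>\<open>N\<close> is the given expression with X0 replaced by k X_p. It is a
      binary form vanishing at (s, t), hence zero or divisible by the linear form of order 4. Its
      sum with the expression is E^2 B for the form E = X0 + k X_p of order 1, so B(s, t) nonzero
      would give order 2 where at least 4 is required.\<close>
    define N where "N = (\<lambda>a b. A a b + k\<^sup>2 * ((?pr a b)\<^sup>2 * B a b))"
    have N: "bin d N" unfolding N_def by (intro bin_add bin_scale A bin2_bin[OF pr B])
    have Ny: "N (y $ 1) (y $ 3) = A (y $ 1) (y $ 3) + (k * y $ p)\<^sup>2 * B (y $ 1) (y $ 3)" for y :: "'a ^ 4"
      using p(1) by (auto simp: N_def power_mult_distrib)
    have "N s t = 0" using Ny[of x] x0 p(2) by (simp add: x(2,3) k_def)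
    have fN: "form d (\<lambda>y. N (y $ 1) (y $ 3))" by (rule bin_form[OF N])
    have mL: "mult_at C ?P ?L = 4" using mult_bin_linear[OF x(1) ts Lx] True by simp
    have "in_max ?P 4 (\<lambda>y. N (y $ 1) (y $ 3))"
    proof (cases "nonzero (\<lambda>y. N (y $ 1) (y $ 3))")
      case nzN: True
      have "d \<noteq> 0"
      proof
        assume "d = 0"
        with N have "\<exists>c. N = (\<lambda>a b. c)" by simp
        with \<open>N s t = 0\<close> nzN show False by (auto simp: nonzero_def)
      qed
      then obtain m where "d = Suc m" by (cases d) auto
      with bin_root_factor[of m N, OF _ \<open>N s t = 0\<close> st] N obtain g where
        g: "bin m g" "\<And>a b. N a b = (a * t - b * s) * g a b" by blast
      have eq: "(\<lambda>y :: 'a ^ 4. N (y $ 1) (y $ 3)) = (\<lambda>y. ?L y * g (y $ 1) (y $ 3))"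
        by (simp add: g(2) fun_eq_iff char2_simps mult.commute)
      have "nonzero (\<lambda>y. g (y $ 1) (y $ 3))" using nzN by (auto simp: eq nonzero_def)
      from mult_mult[OF P L bin_form[OF g(1)] this] mL have "4 \<le> mult_at C ?P (\<lambda>y. N (y $ 1) (y $ 3))"
        by (simp add: eq)
      then show ?thesis using in_max_le[OF P fN nzN] by simp
    qed (rule in_max_zero[OF P fN])
    moreover have "in_max ?P 4 ?\<Phi>" using in_max_le[OF P \<Phi> nz] div[OF P] mL by simp
    ultimately have "in_max ?P 4 (\<lambda>y. N (y $ 1) (y $ 3) + ?\<Phi> y)"
      by (intro in_max_add[OF P fN \<Phi>])
    moreover have "N (y $ 1) (y $ 3) + ?\<Phi> y = (?E y)\<^sup>2 * B (y $ 1) (y $ 3)" for y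
      unfolding Ny by (simp add: square_add algebra_simps char2_simps)
    ultimately have im: "in_max ?P 4 (\<lambda>y. (?E y)\<^sup>2 * B (y $ 1) (y $ 3))" by simp
    show ?thesis
    proof (rule ccontr)
      assume B0: "B s t \<noteq> 0"
      with B obtain m where m: "d = m + 2" "bin m B" by (auto simp: bin2_def)
      have E: "form 1 ?E" by (intro form_add form_scale form_var)
      have "?E (vec4 1 0 0 0) \<noteq> 0" using p(1) by auto
      with E have nzE: "nonzero ?E" by (rule nonzero_linearI)
      have fB: "form m (\<lambda>y. B (y $ 1) (y $ 3))" "nonzero (\<lambda>y. B (y $ 1) (y $ 3))"
        using bin_form[OF m(2)] B0 x by (auto simp: nonzero_def)
      have E2: "form (2 * 1) (\<lambda>y. (?E y)\<^sup>2)" "nonzero (\<lambda>y. (?E y)\<^sup>2)"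
        by (rule form_power[OF E], rule nonzero_power[OF E nzE])
      obtain z where z: "z \<in> cone" "?P = proj_class z"
        "\<And>p. z $ 0 = z $ 2 \<Longrightarrow> p \<in> {1, 3} \<Longrightarrow> z $ p \<noteq> 0 \<Longrightarrow>
          mult_at C ?P (\<lambda>y. y $ 0 + z $ 0 / z $ p * y $ p) = 1"
        by (rule local_data[OF P]) (rule that)
      then obtain c where c: "c \<noteq> 0" "z = c *s x" using proj_class_eq_iff by blast
      have "mult_at C ?P ?E = 1" using z(3)[of p] c p True by (simp add: k_def)
      moreover have "mult_at C ?P (\<lambda>y. B (y $ 1) (y $ 3)) = 0"
        using mult_pos[OF P fB] vanishes_at_iff[OF fB(1), of x] B0 x by simp
      ultimately have "mult_at C ?P (\<lambda>y. (?E y)\<^sup>2 * B (y $ 1) (y $ 3)) = 2"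
        using mult_mult[OF P E2 fB] mult_square[OF P E nzE] by simp
      moreover have "nonzero (\<lambda>y. (?E y)\<^sup>2 * B (y $ 1) (y $ 3))" using nonzero_mult[OF E2(1) fB(1)] E2 fB by simp
      ultimately show False using in_max_le[OF P form_mult[OF E2(1) fB(1)]] im by simp
    qed
  qed
  with x0 show ?thesis by simp
qed

text \<open>The linear factors of \<open>N\<close> are split off one at a time; each divides
  \<open>A\<close> and \<open>B\<close> separately, since both vanish at its root.\<close>

lemma bin_divides:
  assumes "bin n N" "nonzero (\<lambda>y. N (y $ 1) (y $ 3))" "bin d A" "bin2 d B"
    "nonzero (\<lambda>x. A (x $ 1) (x $ 3) + (x $ 0)\<^sup>2 * B (x $ 1) (x $ 3))"
    "\<And>P. P \<in> C \<Longrightarrow> mult_at C P (\<lambda>y. N (y $ 1) (y $ 3))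
      \<le> mult_at C P (\<lambda>x. A (x $ 1) (x $ 3) + (x $ 0)\<^sup>2 * B (x $ 1) (x $ 3))"
  shows "\<exists>m A' B'. d = n + m \<and> bin m A' \<and> bin2 m B' \<and>
    A = (\<lambda>a b. N a b * A' a b) \<and> B = (\<lambda>a b. N a b * B' a b)"
  using assms
proof (induction n arbitrary: N d A B)
  case 0
  then obtain k where k: "N = (\<lambda>a b. k)" by auto
  with 0 have "k \<noteq> 0" by (auto simp: nonzero_def)
  with k 0 show ?case
    by (intro exI[of _ d] exI[of _ "\<lambda>a b. inverse k * A a b"] exI[of _ "\<lambda>a b. inverse k * B a b"])
      (simp add: bin_scale bin2_scale)
next
  case (Suc n)
  from nonzero_bin_iff[OF Suc.prems(1,2)] obtain s t g where *: "(s, t) \<noteq> (0, 0)" "bin n g"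
    "N = (\<lambda>a b. (t * a + s * b) * g a b)" "nonzero (\<lambda>y. g (y $ 1) (y $ 3))" by auto
  let ?L = "\<lambda>y :: 'a ^ 4. t * y $ 1 + s * y $ 3"
  have ts: "(t, s) \<noteq> (0, 0)" using *(1) by auto
  have L: "form 1 ?L" "nonzero ?L"
    using nonzero_bin_linear[OF ts] by (auto intro!: form_add form_scale form_var simp del: One_nat_def)
  have mN: "mult_at C P (\<lambda>y. N (y $ 1) (y $ 3)) = mult_at C P ?L + mult_at C P (\<lambda>y. g (y $ 1) (y $ 3))"
    if "P \<in> C" for P
    unfolding *(3) by (rule mult_mult[OF that L bin_form[OF *(2)] *(4)])
  have AB0: "A s t = 0 \<and> B s t = 0"
    by (rule vanish_of_divisible[OF Suc.prems(3,4) *(1) Suc.prems(5)])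
      (use Suc.prems(6) mN in fastforce)
  obtain m A1 B1 where 1: "d = Suc m" "bin m A1" "bin2 m B1"
    "A = (\<lambda>a b. (t * a + s * b) * A1 a b)" "B = (\<lambda>a b. (t * a + s * b) * B1 a b)"
    by (rule linear_factor[OF Suc.prems(3,4) AB0[THEN conjunct1] AB0[THEN conjunct2] *(1) Suc.prems(5)]) (rule that)
  let ?\<Phi> = "\<lambda>x :: 'a ^ 4. A1 (x $ 1) (x $ 3) + (x $ 0)\<^sup>2 * B1 (x $ 1) (x $ 3)"
  have eq: "(\<lambda>x. A (x $ 1) (x $ 3) + (x $ 0)\<^sup>2 * B (x $ 1) (x $ 3)) = (\<lambda>x. ?L x * ?\<Phi> x)"
    by (simp add: 1(4,5) fun_eq_iff algebra_simps)
  have \<Phi>: "form m ?\<Phi>" "nonzero ?\<Phi>"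
    using form_nf[OF 1(2,3)] Suc.prems(5) unfolding eq by (auto simp: nonzero_def)
  have "mult_at C P (\<lambda>y. g (y $ 1) (y $ 3)) \<le> mult_at C P ?\<Phi>" if P: "P \<in> C" for P
    using Suc.prems(6)[OF P] unfolding eq mN[OF P] mult_mult[OF P L \<Phi>] by simp
  from Suc.IH[OF *(2,4) 1(2,3) \<Phi>(2) this] obtain k A' B' where
    "m = n + k" "bin k A'" "bin2 k B'" "A1 = (\<lambda>a b. g a b * A' a b)" "B1 = (\<lambda>a b. g a b * B' a b)" by blast
  then show ?case
    by (intro exI[of _ k] exI[of _ A'] exI[of _ B']) (simp add: 1 *(3) mult.assoc)
qed

text \<open>Multiplying both forms by the conjugate of \<open>G\<close> turns the divisor into a
  norm. After squaring, \<open>bin_divides\<close> performs the division by a binary form, the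
  quotient has a square root, and injectivity of squaring returns from squares to the forms
  themselves.\<close>

lemma noether:
  assumes F: "form n F" "nonzero F" and G: "form m G" "nonzero G"
    and le: "\<And>P. P \<in> C \<Longrightarrow> mult_at C P G \<le> mult_at C P F"
  shows "\<exists>k L. n = m + k \<and> form k L \<and> (\<forall>x\<in>cone. F x = G x * L x)"
proof -
  let ?Gc = "\<lambda>x. G (conj4 x)"
  have Gc: "form m ?Gc" "nonzero ?Gc" using G form_conj4 nonzero_conj4 by blast+
  let ?H = "\<lambda>x. F x * ?Gc x" and ?K = "\<lambda>x. G x * ?Gc x"
  have H: "form (n + m) ?H" "nonzero ?H" using F Gc nonzero_mult form_mult by blast+
  have K: "form (m + m) ?K" "nonzero ?K" using G Gc nonzero_mult form_mult by blast+
  from nf_square[OF H(1)] obtain A B where AB: "bin (2 * (n + m)) A" "bin2 (2 * (n + m)) B"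
    "\<And>x. x \<in> cone \<Longrightarrow> (?H x)\<^sup>2 = A (x $ 1) (x $ 3) + (x $ 0)\<^sup>2 * B (x $ 1) (x $ 3)"
    unfolding nf_def by blast
  from norm_exists[OF G(1)] obtain N where N: "bin (4 * m) N"
    "\<And>x. x \<in> cone \<Longrightarrow> (?K x)\<^sup>2 = N (x $ 1) (x $ 3)" by blast
  let ?\<Phi> = "\<lambda>x. A (x $ 1) (x $ 3) + (x $ 0)\<^sup>2 * B (x $ 1) (x $ 3)"
  have H2: "form (2 * (n + m)) (\<lambda>x. (?H x)\<^sup>2)" "nonzero (\<lambda>x. (?H x)\<^sup>2)"
    by (rule form_power[OF H(1)], rule nonzero_power[OF H])
  have "2 * (m + m) = 4 * m" by simp
  then have K2: "form (4 * m) (\<lambda>x. (?K x)\<^sup>2)" "nonzero (\<lambda>x. (?K x)\<^sup>2)"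
    using form_power[OF K(1), of 2] nonzero_power[OF K, of 2] by simp_all
  have nz\<Phi>: "nonzero ?\<Phi>" using H2(2) AB(3) by (auto simp: nonzero_def)
  have nzN: "nonzero (\<lambda>y. N (y $ 1) (y $ 3))" using K2(2) N(2) by (auto simp: nonzero_def)
  have "mult_at C P (\<lambda>y. N (y $ 1) (y $ 3)) \<le> mult_at C P ?\<Phi>" if P: "P \<in> C" for P
  proof -
    have "mult_at C P (\<lambda>y. N (y $ 1) (y $ 3)) = 2 * mult_at C P ?K"
      using mult_cong[OF P K2(1) bin_form[OF N(1)] K2(2) N(2)] mult_square[OF P K] by simp
    moreover have "mult_at C P ?\<Phi> = 2 * mult_at C P ?H"
      using mult_cong[OF P H2(1) form_nf[OF AB(1,2)] H2(2) AB(3)] mult_square[OF P H] by simp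
    ultimately show ?thesis using mult_mult[OF P G Gc] mult_mult[OF P F Gc] le[OF P] by simp
  qed
  from bin_divides[OF N(1) nzN AB(1,2) nz\<Phi> this] obtain k' A' B' where
    *: "2 * (n + m) = 4 * m + k'" "bin k' A'" "bin2 k' B'"
    "A = (\<lambda>a b. N a b * A' a b)" "B = (\<lambda>a b. N a b * B' a b)" by blast
  \<comment> \<open>The subtraction does not truncate: the degree equation says 2n = 2m + k', so
    also k' is even, as the square root requires.\<close>
  define k where "k = n - m"
  have k: "k' = 2 * k" "n = m + k" using *(1) by (auto simp: k_def)
  have "nf (2 * k) (\<lambda>x. A' (x $ 1) (x $ 3) + (x $ 0)\<^sup>2 * B' (x $ 1) (x $ 3))"
    using *(2,3) unfolding k(1) by (rule nfI) simp
  from nf_sqrt[OF this] obtain L where L: "form k L"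
    "\<And>x. x \<in> cone \<Longrightarrow> A' (x $ 1) (x $ 3) + (x $ 0)\<^sup>2 * B' (x $ 1) (x $ 3) = (L x)\<^sup>2" by blast
  have GL: "form n (\<lambda>x. G x * L x)" unfolding k(2) by (intro form_mult G L)
  have "(F x - G x * L x) * ?Gc x = 0" if x: "x \<in> cone" for x
  proof -
    have "(?H x)\<^sup>2 = (?K x)\<^sup>2 * (L x)\<^sup>2"
      unfolding AB(3)[OF x] N(2)[OF x] L(2)[OF x, symmetric] *(4,5) by (simp add: algebra_simps)
    then have "?H x = ?K x * L x" unfolding power_mult_distrib[symmetric] square_inj .
    then show ?thesis by (simp add: algebra_simps)
  qed
  then have "\<forall>x\<in>cone. F x - G x * L x = 0"
    using domain[OF form_diff[OF F(1) GL] Gc(1)] Gc(2) by (auto simp: nonzero_def)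
  with k(2) L(1) show ?thesis by auto
qed

text \<open>If D - div H = div F - div G with D effective, then div (F H) exceeds div G, so G
  divides F H on the curve, and the quotient is the required plane.\<close>

lemma complete_linear_system:
  assumes H: "form 1 H" "nonzero H" and D: "effective D" "lin_equiv C D (div_of_form C H)"
  shows "\<exists>L. form 1 L \<and> nonzero L \<and> D = div_of_form C L"
proof -
  from D(2) obtain d F G where *: "form d F" "form d G" "nonzero F" "nonzero G"
    "D - div_of_form C H = div_of_form C F - div_of_form C G"
    unfolding lin_equiv_def principal_def using nonzero_iff by blast
  let ?E = "\<lambda>x. F x * H x"
  have E: "form (d + 1) ?E" "nonzero ?E" using * H nonzero_mult form_mult by blast+
  have div: "D + div_of_form C G = div_of_form C ?E"
    using *(5) unfolding div_mult[OF *(1,3) H] by (simp add: algebra_simps)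
  have "mult_at C P G \<le> mult_at C P ?E" if P: "P \<in> C" for P
  proof -
    have "lookup D P + int (mult_at C P G) = int (mult_at C P ?E)"
      using arg_cong[OF div, of "\<lambda>D. lookup D P"] P
      by (simp add: lookup_add lookup_div[OF *(2,4)] lookup_div[OF E])
    moreover have "lookup D P \<ge> 0" using D(1) by (simp add: effective_def)
    ultimately show ?thesis by linarith
  qed
  from noether[OF E *(2,4) this] obtain L where L: "form 1 L" "\<And>x. x \<in> cone \<Longrightarrow> ?E x = G x * L x" by auto
  have "nonzero L" using E(2) L(2) by (auto simp: nonzero_def)
  moreover have "div_of_form C ?E = div_of_form C G + div_of_form C L"
    using div_cong[OF E(1) form_mult[OF *(2) L(1)] E(2) L(2)] div_mult[OF *(2,4) L(1) \<open>nonzero L\<close>] by simp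
  ultimately show ?thesis using div L(1) by (intro exI[of _ L]) (metis add.commute add_left_cancel)
qed

end

lemma effective_degree_0:
  assumes "effective D" "divisor_degree D = 0"
  shows "D = 0"
proof -
  have "\<forall>P\<in>Poly_Mapping.keys D. lookup D P = 0"
    using assms unfolding divisor_degree_def effective_def
    by (subst (asm) sum_nonneg_eq_0_iff) auto
  then have "Poly_Mapping.keys D = {}" by (metis all_not_in_conv in_keys_iff)
  then show ?thesis by simp
qed

lemma effective_degree_1:
  assumes "effective D" "divisor_degree D = 1"
  obtains P where "D = frag_of P"
proof -
  have "Poly_Mapping.keys D \<noteq> {}" using assms(2) by (auto simp: divisor_degree_def)
  then obtain P where P: "P \<in> Poly_Mapping.keys D" by blast
  have "effective (D - frag_of P)"
    using assms(1) P by (force simp: effective_def lookup_minus in_keys_iff order.order_iff_strict)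
  moreover have "divisor_degree (D - frag_of P) = 0"
    by (simp add: divisor_degree_diff divisor_degree_frag_of assms(2))
  ultimately have "D - frag_of P = 0" by (rule effective_degree_0)
  then show ?thesis using that[of P] by simp
qed

context mu4 begin

section \<open>Linear equivalence\<close>

lemma principalI:
  assumes "form d F" "form d G" "nonzero F" "nonzero G" "D = div_of_form C F - div_of_form C G"
  shows "principal C D"
  unfolding principal_def
  by (intro exI[of _ d] exI[of _ F] exI[of _ G] conjI assms) (use assms nonzero_iff in blast)+

lemma principalE:
  assumes "principal C D"
  obtains d F G where "form d F" "form d G" "nonzero F" "nonzero G" "D = div_of_form C F - div_of_form C G"
  using assms unfolding principal_def using nonzero_iff by blast

lemma principal_add: "principal C D \<Longrightarrow> principal C E \<Longrightarrow> principal C (D + E)"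
proof (elim principalE)
  fix d F G k F' G'
  assume *: "form d F" "form d G" "nonzero F" "nonzero G" "D = div_of_form C F - div_of_form C G"
    "form k F'" "form k G'" "nonzero F'" "nonzero G'" "E = div_of_form C F' - div_of_form C G'"
  show "principal C (D + E)"
  proof (rule principalI)
    show "form (d + k) (\<lambda>x. F x * F' x)" "form (d + k) (\<lambda>x. G x * G' x)" by (intro form_mult *)+
    show "nonzero (\<lambda>x. F x * F' x)" "nonzero (\<lambda>x. G x * G' x)" using * nonzero_mult by blast+
    show "D + E = div_of_form C (\<lambda>x. F x * F' x) - div_of_form C (\<lambda>x. G x * G' x)"
      by (simp add: div_mult[OF *(1,3,6,8)] div_mult[OF *(2,4,7,9)] *(5,10))
  qed
qed

lemma principal_uminus: "principal C D \<Longrightarrow> principal C (- D)"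
  by (elim principalE, rule principalI) auto

lemma lin_equiv_refl: "lin_equiv C D D"
  unfolding lin_equiv_def by (rule principalI[of 0 "\<lambda>_. 1" "\<lambda>_. 1"]) (auto intro: form_const nonzero_const)

lemma lin_equiv_sym: "lin_equiv C D E \<Longrightarrow> lin_equiv C E D"
  using principal_uminus[of "D - E"] by (simp add: lin_equiv_def)

lemma lin_equiv_add: "lin_equiv C D E \<Longrightarrow> lin_equiv C D' E' \<Longrightarrow> lin_equiv C (D + D') (E + E')"
  using principal_add[of "D - E" "D' - E'"] by (simp add: lin_equiv_def algebra_simps)

lemma lin_equiv_trans: "lin_equiv C D E \<Longrightarrow> lin_equiv C E E' \<Longrightarrow> lin_equiv C D E'"
  using principal_add[of "D - E" "E - E'"] by (simp add: lin_equiv_def)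

lemma lin_equiv_diff_cong: "D - E = D' - E' \<Longrightarrow> lin_equiv C D E \<longleftrightarrow> lin_equiv C D' E'"
  by (simp add: lin_equiv_def)

lemma lin_equiv_div:
  assumes "form d F" "form d G" "nonzero F" "nonzero G"
  shows "lin_equiv C (div_of_form C F) (div_of_form C G)"
  unfolding lin_equiv_def using assms by (intro principalI[of d F G]) auto

section \<open>Plane sections\<close>

text \<open>Since the degree is known, lower bounds for the multiplicities adding up to it are
  already equalities; upper bounds need no separate computation.\<close>

lemma div_eqI:
  assumes "form d F" "nonzero F" "\<And>P. lookup E P \<le> lookup (div_of_form C F) P"
    "divisor_degree E = 4 * int d"
  shows "div_of_form C F = E"
proof -
  have "div_of_form C F - E = 0"
  proof (rule effective_degree_0)
    show "effective (div_of_form C F - E)" using assms(3) by (simp add: effective_def lookup_minus)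
    show "divisor_degree (div_of_form C F - E) = 0" using assms by (simp add: divisor_degree_diff degree_div)
  qed
  then show ?thesis by simp
qed

abbreviation "pO \<equiv> proj_class O4"
abbreviation "pT \<equiv> proj_class T4"
abbreviation "pU \<equiv> proj_class U4"
abbreviation "pW \<equiv> proj_class W4"

lemma torsion_C: "pO \<in> C" "pT \<in> C" "pU \<in> C" "pW \<in> C"
  by (simp_all add: proj_class_C torsion_cone)

lemma cone_proj_eqI: "x \<in> cone \<Longrightarrow> x = s *s v \<Longrightarrow> proj_class x = proj_class v"
  by (cases "s = 0") (auto simp: cone_def proj_class_scale)

lemma cone_coord_0:
  assumes "x \<in> cone" "x $ 0 = 0" shows "proj_class x = pU"
proof (rule cone_proj_eqI[OF assms(1)])
  have "(x $ 1 + x $ 3)\<^sup>2 = 0\<^sup>2" using coneD(2)[OF assms(1)] assms(2) by simp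
  then have 1: "x $ 3 = x $ 1" using eq_iff_add square_inj by (metis add.commute)
  have "(x $ 2)\<^sup>2 = (e * x $ 1)\<^sup>2" 
    using coneD(1)[OF assms(1)] assms(2) 1 by (simp add: power_mult_distrib power2_eq_square mult.assoc)
  then show "x = (x $ 1) *s U4" using 1 assms(2) unfolding square_inj
    by (simp add: vec4_eq_iff torsion_defs mult.commute)
qed

lemma cone_coord_2:
  assumes "x \<in> cone" "x $ 2 = 0" shows "proj_class x = pO"
proof (rule cone_proj_eqI[OF assms(1)])
  have "(x $ 1 + x $ 3)\<^sup>2 = 0\<^sup>2" using coneD(2)[OF assms(1)] assms(2) by simp
  then have 1: "x $ 3 = x $ 1" using eq_iff_add square_inj by (metis add.commute)
  have "(x $ 0)\<^sup>2 = (e * x $ 1)\<^sup>2" 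
    using coneD(1)[OF assms(1)] assms(2) 1 by (simp add: power_mult_distrib power2_eq_square mult.assoc)
  then show "x = (x $ 1) *s O4" using 1 assms(2) unfolding square_inj
    by (simp add: vec4_eq_iff torsion_defs mult.commute)
qed

lemma cone_coord_1:
  assumes "x \<in> cone" "x $ 1 = 0" shows "proj_class x = pW"
proof (rule cone_proj_eqI[OF assms(1)])
  have "(x $ 0 + x $ 2)\<^sup>2 = 0\<^sup>2" using coneD(1)[OF assms(1)] assms(2) by simp
  then have 1: "x $ 2 = x $ 0" using eq_iff_add square_inj by (metis add.commute)
  have "(x $ 3)\<^sup>2 = (e * x $ 0)\<^sup>2" 
    using coneD(2)[OF assms(1)] assms(2) 1 by (simp add: power_mult_distrib power2_eq_square mult.assoc)
  then show "x = (x $ 0) *s W4" using 1 assms(2) unfolding square_inj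
    by (simp add: vec4_eq_iff torsion_defs mult.commute)
qed

lemma cone_coord_3:
  assumes "x \<in> cone" "x $ 3 = 0" shows "proj_class x = pT"
proof (rule cone_proj_eqI[OF assms(1)])
  have "(x $ 0 + x $ 2)\<^sup>2 = 0\<^sup>2" using coneD(1)[OF assms(1)] assms(2) by simp
  then have 1: "x $ 2 = x $ 0" using eq_iff_add square_inj by (metis add.commute)
  have "(x $ 1)\<^sup>2 = (e * x $ 0)\<^sup>2" 
    using coneD(2)[OF assms(1)] assms(2) 1 by (simp add: power_mult_distrib power2_eq_square mult.assoc)
  then show "x = (x $ 0) *s T4" using 1 assms(2) unfolding square_inj
    by (simp add: vec4_eq_iff torsion_defs mult.commute)
qed

lemma torsion_distinct:
  "pO \<noteq> pT" "pO \<noteq> pU" "pO \<noteq> pW" "pT \<noteq> pU" "pT \<noteq> pW" "pU \<noteq> pW"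
  using e_nz by (auto simp: proj_class_eq_iff vec4_eq_iff torsion_defs)

lemma form_coord: "form 1 (\<lambda>y. y $ i)" "nonzero (\<lambda>y. y $ i)"
proof -
  show "form 1 (\<lambda>y. y $ i)" by (rule form_var)
  show "nonzero (\<lambda>y. y $ i)" by (rule nonzero_linearI[OF form_var, of "\<chi> j. 1"]) simp
qed

text \<open>By the degree, a plane meeting the curve in a single point has multiplicity 4 there. The
  four coordinate planes are of this kind, at U, W, O and T.\<close>

lemma mult_single_zero:
  assumes "form 1 L" "nonzero L" "\<And>x. x \<in> cone \<Longrightarrow> L x = 0 \<Longrightarrow> proj_class x = P" "P \<in> C" "Q \<in> C"
  shows "mult_at C Q L = (if Q = P then 4 else 0)"
proof -
  have sub: "zeros L \<subseteq> {P}" using assms(3) by (auto simp: zeros_def)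
  have "(\<Sum>P\<in>zeros L. int (mult_at C P L)) = 4"
    using degree_div_sum[OF assms(1,2)] degree_div[OF assms(1,2)] by simp
  with sub have "zeros L = {P}" by (metis empty_iff subset_singletonD sum.empty zero_neq_numeral)
  with \<open>_ = 4\<close> mult_eq_0_outside_zeros[OF assms(1,2,5)] show ?thesis by auto
qed

lemma mult_coord:
  assumes "Q \<in> C"
  shows "mult_at C Q (\<lambda>y. y $ 0) = (if Q = pU then 4 else 0)"
    "mult_at C Q (\<lambda>y. y $ 1) = (if Q = pW then 4 else 0)"
    "mult_at C Q (\<lambda>y. y $ 2) = (if Q = pO then 4 else 0)"
    "mult_at C Q (\<lambda>y. y $ 3) = (if Q = pT then 4 else 0)"
  using mult_single_zero[OF form_coord] cone_coord_0 cone_coord_1 cone_coord_2 cone_coord_3 torsion_C assms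
  by blast+

lemma form_sum13: "form 1 (\<lambda>y :: 'a ^ 4. y $ 1 + y $ 3)" "nonzero (\<lambda>y. y $ 1 + y $ 3)"
proof -
  show *: "form 1 (\<lambda>y :: 'a ^ 4. y $ 1 + y $ 3)" by (intro form_add form_var)
  show "nonzero (\<lambda>y. y $ 1 + y $ 3)" by (rule nonzero_linearI[OF *, of "vec4 0 1 0 0"]) simp
qed

lemma form_sum02: "form 1 (\<lambda>y :: 'a ^ 4. y $ 0 + y $ 2)" "nonzero (\<lambda>y. y $ 0 + y $ 2)"
proof -
  show *: "form 1 (\<lambda>y :: 'a ^ 4. y $ 0 + y $ 2)" by (intro form_add form_var)
  show "nonzero (\<lambda>y. y $ 0 + y $ 2)" by (rule nonzero_linearI[OF *, of "vec4 1 0 0 0"]) simp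
qed

text \<open>Each defining equation expresses the square of a plane, X0 + X2 or X1 + X3, by two
  coordinates with known divisors, so its multiplicities are half their sum.\<close>

lemma mult_product_of_coords:
  assumes "Q \<in> C" "form 1 L" "nonzero L" "\<And>x. x \<in> cone \<Longrightarrow> (L x)\<^sup>2 = e\<^sup>2 * x $ i * x $ j"
  shows "2 * mult_at C Q L = mult_at C Q (\<lambda>y. y $ i) + mult_at C Q (\<lambda>y. y $ j)"
proof -
  have ij: "form (1 + 1) (\<lambda>x. x $ i * x $ j)" "nonzero (\<lambda>x. x $ i * x $ j)"
    using form_coord form_mult nonzero_mult by blast+
  have "2 * mult_at C Q L = mult_at C Q (\<lambda>x. (L x)\<^sup>2)" by (rule mult_square[OF assms(1-3), symmetric])
  also have "\<dots> = mult_at C Q (\<lambda>x. e\<^sup>2 * (x $ i * x $ j))"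
  proof (rule mult_cong[OF assms(1), of "1 + 1"])
    show "form (1 + 1) (\<lambda>x. (L x)\<^sup>2)" using form_mult[OF assms(2) assms(2)] by (simp only: power2_eq_square)
    show "nonzero (\<lambda>x. (L x)\<^sup>2)" by (rule nonzero_power[OF assms(2,3)])
    show "form (1 + 1) (\<lambda>x. e\<^sup>2 * (x $ i * x $ j))" by (rule form_scale[OF ij(1)])
  qed (use assms(4) in \<open>simp add: mult.assoc\<close>)
  also have "\<dots> = mult_at C Q (\<lambda>x. x $ i * x $ j)"
    using e_nz by (intro mult_scale[OF assms(1) _ ij]) simp
  also have "\<dots> = mult_at C Q (\<lambda>y. y $ i) + mult_at C Q (\<lambda>y. y $ j)"
    by (rule mult_mult[OF assms(1) form_coord form_coord])
  finally show ?thesis .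
qed

lemma mult_sum13:
  assumes "Q \<in> C"
  shows "mult_at C Q (\<lambda>y. y $ 1 + y $ 3) = (if Q = pO \<or> Q = pU then 2 else 0)"
  using mult_product_of_coords[OF assms form_sum13 coneD(2)] mult_coord[OF assms] torsion_distinct
  by (auto split: if_splits)

lemma mult_sum02:
  assumes "Q \<in> C"
  shows "mult_at C Q (\<lambda>y. y $ 0 + y $ 2) = (if Q = pT \<or> Q = pW then 2 else 0)"
  using mult_product_of_coords[OF assms form_sum02 coneD(1)] mult_coord[OF assms] torsion_distinct
  by (auto split: if_splits)

lemma in_max_scale:
  assumes "P \<in> C" "form d F" "in_max P n F"
  shows "in_max P n (\<lambda>x. c * F x)"
proof -
  from assms(1) obtain x \<pi> where *: "x \<in> cone" "P = proj_class x" "uniformizer x \<pi>" by (rule local_data) (rule that)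
  show ?thesis using assms(3) dvn_scale unfolding *(2) in_max_iff[OF *(1,3) assms(2)]
    in_max_iff[OF *(1,3) form_scale[OF assms(2)]] by blast
qed

lemma mult_pos_rep: "x \<in> cone \<Longrightarrow> form d F \<Longrightarrow> nonzero F \<Longrightarrow> 0 < mult_at C (proj_class x) F \<longleftrightarrow> F x = 0"
  using mult_pos[of "proj_class x" d F] vanishes_at_iff[of d F x] by (simp add: proj_class_C)

text \<open>The pencil of planes through the tangent line at O: its generators have multiplicity 4
  and 2 there.\<close>

lemma in_max_pencil_O: "in_max pO 2 (\<lambda>y. a * y $ 2 + b * (y $ 1 + y $ 3))"
proof -
  have 1: "in_max pO 2 (\<lambda>y. y $ 2)" and 2: "in_max pO 2 (\<lambda>y. y $ 1 + y $ 3)"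
    using in_max_le[OF torsion_C(1) form_coord, of 2 2] in_max_le[OF torsion_C(1) form_sum13, of 2]
      mult_coord(3)[OF torsion_C(1)] mult_sum13[OF torsion_C(1)] by auto
  show ?thesis
    by (rule in_max_add[OF torsion_C(1) form_scale[OF form_coord(1)] form_scale[OF form_sum13(1)]
        in_max_scale[OF torsion_C(1) form_coord(1) 1] in_max_scale[OF torsion_C(1) form_sum13(1) 2]])
qed

definition neg4 :: "'a ^ 4 \<Rightarrow> 'a ^ 4" where
  "neg4 x = vec4 (x $ 0) (x $ 3) (x $ 2) (x $ 1)"

lemma neg4_nth [simp]: "neg4 x $ 0 = x $ 0" "neg4 x $ 1 = x $ 3" "neg4 x $ 2 = x $ 2" "neg4 x $ 3 = x $ 1"
  by (simp_all add: neg4_def)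

lemma neg4_cone: "x \<in> cone \<Longrightarrow> neg4 x \<in> cone"
  by (auto simp: cone_def vec4_eq_iff add.commute mult.commute mult.left_commute)

lemma neg_div:
  assumes x: "x \<in> cone"
  obtains a b where "form 1 (\<lambda>y :: 'a ^ 4. a * y $ 2 + b * (y $ 1 + y $ 3))" "nonzero (\<lambda>y. a * y $ 2 + b * (y $ 1 + y $ 3))"
    "div_of_form C (\<lambda>y. a * y $ 2 + b * (y $ 1 + y $ 3))
      = frag_of (proj_class x) + frag_of (proj_class (neg4 x)) + frag_cmul 2 (frag_of pO)"
proof -
  let ?P = "proj_class x" and ?N = "proj_class (neg4 x)"
  let ?E = "frag_of ?P + frag_of ?N + frag_cmul 2 (frag_of pO)"
  have deg: "divisor_degree ?E = 4 * int 1"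
    by (simp add: divisor_degree_add divisor_degree_frag_of divisor_degree_cmul)
  have N: "neg4 x \<in> cone" by (rule neg4_cone[OF x])
  have form: "form 1 (\<lambda>y :: 'a ^ 4. a * y $ 2 + b * (y $ 1 + y $ 3))" for a b
    by (intro form_add form_scale form_var)
  have PC: "?P \<in> C" "?N \<in> C" using x N by (simp_all add: proj_class_C)
  \<comment> \<open>In the first two cases \<open>x\<close> is O or U and coincides with its
    inverse, so counting zeros would miss multiplicities; the planes X2 and X1 + X3 have known
    divisors 4(O) and 2(O) + 2(U). In the last case x, its inverse and O are distinct.\<close>
  consider "x $ 2 = 0" | "x $ 2 \<noteq> 0" "x $ 1 = x $ 3" | "x $ 2 \<noteq> 0" "x $ 1 \<noteq> x $ 3" by blast
  then show ?thesis
  proof cases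
    case 1
    then have "?P = pO" "?N = pO" using cone_coord_2[OF x] cone_coord_2[OF N] by simp_all
    then have "div_of_form C (\<lambda>y. y $ 2) = ?E"
      using deg by (intro div_eqI[OF form_coord]) (simp_all add: lookup_add lookup_div[OF form_coord] mult_coord torsion_C)
    then show ?thesis using that[of 1 0] form[of 1 0] form_coord(2) by simp
  next
    case 2
    then have "x $ 0 = 0" using coneD(2)[OF x] e_nz by (simp add: char2_simps)
    then have "?P = pU" "?N = pU" using cone_coord_0[OF x] cone_coord_0[OF N] by simp_all
    then have "div_of_form C (\<lambda>y. y $ 1 + y $ 3) = ?E"
      using deg torsion_distinct
      by (intro div_eqI[OF form_sum13]) (auto simp: lookup_add lookup_div[OF form_sum13] mult_sum13 torsion_C)
    then show ?thesis using that[of 0 1] form[of 0 1] form_sum13(2) by simp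
  next
    case 3
    let ?L = "\<lambda>y. (x $ 1 + x $ 3) * y $ 2 + x $ 2 * (y $ 1 + y $ 3)"
    note L = form[of "x $ 1 + x $ 3" "x $ 2"]
    have "?L (vec4 0 1 0 0) \<noteq> 0" using 3 by simp
    with L have nz: "nonzero ?L" by (rule nonzero_linearI)
    have "?L x = 0" "?L (neg4 x) = 0" by (simp_all add: algebra_simps char2_simps)
    then have m: "mult_at C ?P ?L \<ge> 1" "mult_at C ?N ?L \<ge> 1"
      using mult_pos_rep[OF x L nz] mult_pos_rep[OF N L nz] by linarith+
    have "in_max pO 2 ?L" by (rule in_max_pencil_O)
    then have mO: "mult_at C pO ?L \<ge> 2" using in_max_le[OF torsion_C(1) L nz] by blast
    have d: "?P \<noteq> ?N" "?P \<noteq> pO" "?N \<noteq> pO"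
      using 3 by (auto simp: proj_class_eq_iff vec4_eq_iff torsion_defs)
    have "div_of_form C ?L = ?E"
      using deg m mO d PC torsion_C by (intro div_eqI[OF L nz]) (auto simp: lookup_add lookup_div[OF L nz])
    with that L nz show ?thesis by blast
  qed
qed

section \<open>Planes with prescribed multiplicities\<close>

definition vanishing_ge :: "(('a ^ 4) set \<Rightarrow> nat) \<Rightarrow> ('a ^ 4 \<Rightarrow> 'a) \<Rightarrow> bool" where
  "vanishing_ge m F \<longleftrightarrow> (\<forall>Q\<in>C. in_max Q (m Q) F)"

text \<open>Raising the prescribed multiplicity at one point by 1 costs one dimension, and the
  conditions at all other points survive linear combinations.\<close>

lemma vanishing_ge_step:
  assumes "P \<in> C" "form d F" "form d G" "vanishing_ge m F" "vanishing_ge m G"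
  obtains a b where "(a, b) \<noteq> (0, 0)" "vanishing_ge (m(P := Suc (m P))) (\<lambda>x. a * F x + b * G x)"
proof -
  have "in_max P (m P) F" "in_max P (m P) G" using assms by (auto simp: vanishing_ge_def)
  from in_max_combination[OF assms(1-3) this] obtain a b where
    ab: "(a, b) \<noteq> (0, 0)" "in_max P (Suc (m P)) (\<lambda>x. a * F x + b * G x)" .
  have "in_max Q (m Q) (\<lambda>x. a * F x + b * G x)" if Q: "Q \<in> C" for Q
    using assms Q by (intro in_max_add[OF Q] form_scale in_max_scale[OF Q]) (auto simp: vanishing_ge_def)
  with ab that show ?thesis by (auto simp: vanishing_ge_def)
qed

text \<open>Each point imposes at most one condition on planes: start from three independent planes through \<open>O\<close>.\<close>

lemma plane_through:
  assumes P: "P \<in> C" and Q: "Q \<in> C"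
  obtains L R where "form 1 L" "nonzero L" "R \<in> C" "div_of_form C L = frag_of P + frag_of Q + frag_of pO + frag_of R"
proof -
  \<comment> \<open>The conditions are accumulated in a multiplicity function, so that coincidences
    among \<open>P\<close>, \<open>Q\<close> and O are counted correctly without case
    distinctions.\<close>
  define m0 where "m0 = (\<lambda>_ :: ('a ^ 4) set. 0 :: nat)(pO := 1)"
  define m1 where "m1 = m0(P := Suc (m0 P))"
  define m2 where "m2 = m1(Q := Suc (m1 Q))"
  \<comment> \<open>X2, X1 + X3 and X0 + e X1 span the linear forms vanishing at O = (e : 1 : 0 :
    1).\<close>
  define F where "F = (\<lambda>a b c (y :: 'a ^ 4). a * y $ 2 + b * (y $ 1 + y $ 3) + c * (y $ 0 + e * y $ 1))"
  have form: "form 1 (F a b c)" for a b c unfolding F_def by (intro form_add form_scale form_var)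
  have comb: "(\<lambda>y. r * F a b c y + s * F a' b' c' y) = F (r * a + s * a') (r * b + s * b') (r * c + s * c')"
    for r s a b c a' b' c' by (simp add: F_def fun_eq_iff algebra_simps)
  have nzF: "nonzero (F a b c)" if "(a, b, c) \<noteq> (0, 0, 0)" for a b c
  proof (cases "a = 0 \<and> b = 0")
    case True
    with that have "F a b c (vec4 1 0 0 0) \<noteq> 0" by (simp add: F_def)
    with form show ?thesis by (rule nonzero_linearI)
  next
    case False
    then have "F a b c (vec4 0 0 1 0) \<noteq> 0 \<or> F a b c (vec4 0 0 0 1) \<noteq> 0" by (auto simp: F_def)
    with form nonzero_linearI show ?thesis by blast
  qed
  have ge0: "vanishing_ge m0 (F a b c)" for a b c
    unfolding vanishing_ge_def
  proof
    fix R assume R: "R \<in> C"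
    show "in_max R (m0 R) (F a b c)"
    proof (cases "nonzero (F a b c)")
      case True
      have "F a b c O4 = 0" by (simp add: F_def torsion_defs char2_simps)
      then have "mult_at C pO (F a b c) > 0" using mult_pos_rep[OF torsion_cone(1) form True] by blast
      then have "m0 R \<le> mult_at C R (F a b c)" by (simp add: m0_def)
      then show ?thesis using in_max_le[OF R form True] by blast
    qed (rule in_max_zero[OF R form])
  qed
  obtain r s where 1: "(r, s) \<noteq> (0, 0)" "vanishing_ge m1 (F r 0 s)"
    using vanishing_ge_step[OF P form form ge0[of 1 0 0] ge0[of 0 0 1]] unfolding m1_def comb by auto
  obtain t w where 2: "(t, w) \<noteq> (0, 0)" "vanishing_ge m1 (F 0 t w)"
    using vanishing_ge_step[OF P form form ge0[of 0 1 0] ge0[of 0 0 1]] unfolding m1_def comb by auto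
  obtain p q where 3: "(p, q) \<noteq> (0, 0)" "vanishing_ge m1 (F p q 0)"
    using vanishing_ge_step[OF P form form ge0[of 1 0 0] ge0[of 0 1 0]] unfolding m1_def comb by auto
  \<comment> \<open>Combining the basis planes in pairs gave three planes satisfying the condition
    at \<open>P\<close>. The first two are proportional just when r = t = 0, and then the third is
    independent of the first; an independent pair is combined to meet the condition at
    \<open>Q\<close>.\<close>
  have "\<exists>a b c. (a, b, c) \<noteq> (0, 0, 0) \<and> vanishing_ge m2 (F a b c)"
  proof (cases "r = 0 \<and> t = 0")
    case True
    obtain a b where "(a, b) \<noteq> (0, 0)" "vanishing_ge m2 (F (a * r + b * p) (a * 0 + b * q) (a * s + b * 0))"
      using vanishing_ge_step[OF Q form form 1(2) 3(2)] unfolding m2_def comb by auto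
    moreover from this have "(a * r + b * p, a * 0 + b * q, a * s + b * 0) \<noteq> (0, 0, 0)"
      using True 1(1) 3(1) by auto
    ultimately show ?thesis by blast
  next
    case False
    obtain a b where "(a, b) \<noteq> (0, 0)" "vanishing_ge m2 (F (a * r + b * 0) (a * 0 + b * t) (a * s + b * w))"
      using vanishing_ge_step[OF Q form form 1(2) 2(2)] unfolding m2_def comb by auto
    moreover from this have "(a * r + b * 0, a * 0 + b * t, a * s + b * w) \<noteq> (0, 0, 0)"
      using False 1(1) 2(1) by auto
    ultimately show ?thesis by blast
  qed
  then obtain L where L: "form 1 L" "nonzero L" "vanishing_ge m2 L" using form nzF by blast
  let ?E = "frag_of P + frag_of Q + frag_of pO"
  have E: "lookup ?E R = int (m2 R)" for R
    by (simp add: m2_def m1_def m0_def lookup_add)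
  have le: "lookup ?E R \<le> lookup (div_of_form C L) R" for R
  proof (cases "R \<in> C")
    case True
    then have "m2 R \<le> mult_at C R L" using L in_max_le[OF True L(1,2)] by (auto simp: vanishing_ge_def)
    then show ?thesis using True E[of R] by (simp add: lookup_div[OF L(1,2)])
  next
    case False
    then have "lookup ?E R = 0" using P Q torsion_C(1) by (auto simp: lookup_add)
    then show ?thesis using False by (simp add: lookup_div[OF L(1,2)])
  qed
  have "effective (div_of_form C L - ?E)" using le by (simp add: effective_def lookup_minus)
  moreover have "divisor_degree (div_of_form C L - ?E) = 1"
    using degree_div[OF L(1,2)] by (simp add: divisor_degree_diff divisor_degree_add divisor_degree_frag_of)
  ultimately obtain R where R: "div_of_form C L - ?E = frag_of R" by (rule effective_degree_1)
  then have div: "div_of_form C L = ?E + frag_of R" by (simp add: algebra_simps)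
  have "R \<in> C"
  proof (rule ccontr)
    assume nR: "R \<notin> C"
    then have "lookup ?E R \<ge> 0" "lookup (div_of_form C L) R = 0"
      by (simp_all add: lookup_add lookup_div[OF L(1,2)])
    with div show False by (simp add: lookup_add split: if_splits)
  qed
  with that L(1,2) div show ?thesis by blast
qed

section \<open>Linearly equivalent points are equal\<close>

lemma exists_mult_1:
  assumes "P \<in> C"
  obtains \<pi> where "form 1 \<pi>" "nonzero \<pi>" "mult_at C P \<pi> = 1"
proof -
  from assms obtain x \<pi> where *: "x \<in> cone" "P = proj_class x" "uniformizer x \<pi>" by (rule local_data) (rule that)
  have "form 1 \<pi>" "nonzero \<pi>" using *(3) by (simp_all add: uniformizer_def)
  moreover have "ordn x \<pi> 1 1 \<pi>" by (rule ordnI[OF form_const[of 1] _ form_const[of 1]]) auto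
  from mult_at_ordn[OF *(1,3) \<open>form 1 \<pi>\<close> this] have "mult_at C P \<pi> = 1" by (simp add: *(2))
  ultimately show ?thesis using that by blast
qed

lemma linear_at_O:
  assumes "form 1 L" "L O4 = 0"
  obtains a b c where "L = (\<lambda>y. (a * y $ 2 + b * (y $ 1 + y $ 3)) + c * (y $ 0 + e * y $ 1))"
proof -
  obtain a b c d where L: "L = (\<lambda>x. a * x $ 0 + b * x $ 1 + c * x $ 2 + d * x $ 3)"
    using assms(1) form_1_vec4 by blast
  with assms(2) have "(a * e + d) + b = 0" by (simp add: torsion_defs add_ac)
  then have "b = a * e + d" using eq_iff_add by metis
  then have "L = (\<lambda>y. (c * y $ 2 + d * (y $ 1 + y $ 3)) + a * (y $ 0 + e * y $ 1))"
    by (simp add: L fun_eq_iff algebra_simps)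
  with that show ?thesis by blast
qed

text \<open>The planes through O are spanned by the tangent pencil and X0 + e X1. If a plane outside
  the pencil had multiplicity 2, so would every plane through O, contrary to the existence of a
  linear uniformizer.\<close>

lemma linear_mult_2_at_O:
  assumes L: "form 1 L" "nonzero L" "mult_at C pO L \<ge> 2"
  obtains a b where "L = (\<lambda>y. a * y $ 2 + b * (y $ 1 + y $ 3))"
proof -
  have f: "form 1 (\<lambda>y :: 'a ^ 4. a * y $ 2 + b * (y $ 1 + y $ 3))" for a b
    by (intro form_add form_scale form_var)
  have g: "form 1 (\<lambda>y :: 'a ^ 4. y $ 0 + e * y $ 1)" by (intro form_add form_scale form_var)
  have "L O4 = 0" using mult_pos_rep[OF torsion_cone(1) L(1,2)] L(3) by linarith
  then obtain a b c where Leq: "L = (\<lambda>y. (a * y $ 2 + b * (y $ 1 + y $ 3)) + c * (y $ 0 + e * y $ 1))"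
    using linear_at_O[OF L(1)] by blast
  have "c = 0"
  proof (rule ccontr)
    assume c: "c \<noteq> 0"
    have "in_max pO 2 L" using in_max_le[OF torsion_C(1) L(1,2)] L(3) by blast
    then have "in_max pO 2 (\<lambda>y. L y + (a * y $ 2 + b * (y $ 1 + y $ 3)))"
      by (rule in_max_add[OF torsion_C(1) L(1) f _ in_max_pencil_O])
    from in_max_scale[OF torsion_C(1) form_add[OF L(1) f] this, of "inverse c"]
    have 1: "in_max pO 2 (\<lambda>y. y $ 0 + e * y $ 1)"
      using c by (simp add: Leq add_ac char2_simps)
    obtain \<pi> where \<pi>: "form 1 \<pi>" "nonzero \<pi>" "mult_at C pO \<pi> = 1" using exists_mult_1[OF torsion_C(1)] .
    then have "\<pi> O4 = 0" using mult_pos_rep[OF torsion_cone(1) \<pi>(1,2)] by simp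
    then obtain a' b' c' where \<pi>eq: "\<pi> = (\<lambda>y. (a' * y $ 2 + b' * (y $ 1 + y $ 3)) + c' * (y $ 0 + e * y $ 1))"
      using linear_at_O[OF \<pi>(1)] by blast
    have "in_max pO 2 \<pi>" unfolding \<pi>eq
      by (rule in_max_add[OF torsion_C(1) f form_scale[OF g] in_max_pencil_O in_max_scale[OF torsion_C(1) g 1]])
    with \<pi> in_max_le[OF torsion_C(1) \<pi>(1,2)] show False by simp
  qed
  with Leq that show ?thesis by simp
qed

end

lemma frag_cmul_minus: "frag_cmul k (D - E) = frag_cmul k D - frag_cmul k E"
  by (rule poly_mapping_eqI) (simp add: lookup_minus algebra_simps)

context mu4 begin

lemma zero_of_div:
  assumes "form d F" "nonzero F" "P \<in> C" "P = proj_class x" "lookup (div_of_form C F) P > 0"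
  shows "F x = 0"
proof -
  have "mult_at C P F > 0" using assms(3,5) by (simp add: lookup_div[OF assms(1,2)])
  then show ?thesis using mult_pos[OF assms(3,1,2)] vanishes_at_iff[OF assms(1)] assms(4) by blast
qed

text \<open>Replace R by R' in the section by the plane through R, its inverse N and the tangent
  line at O. By completeness the result is again a plane section, and its plane lies in the same
  pencil. As N and the tangency at O determine a plane of the pencil, both planes agree.\<close>

lemma lin_equiv_points_unique:
  assumes R: "R \<in> C" "R' \<in> C" and eq: "lin_equiv C (frag_of R) (frag_of R')"
  shows "R = R'"
proof -
  obtain x where x: "x \<in> cone" "R = proj_class x" using C_rep[OF R(1)] .
  let ?N = "proj_class (neg4 x)"
  have NC: "?N \<in> C" using neg4_cone[OF x(1)] by (simp add: proj_class_C)
  obtain a b where L: "form 1 (\<lambda>y :: 'a ^ 4. a * y $ 2 + b * (y $ 1 + y $ 3))"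
    "nonzero (\<lambda>y. a * y $ 2 + b * (y $ 1 + y $ 3))"
    "div_of_form C (\<lambda>y. a * y $ 2 + b * (y $ 1 + y $ 3)) = frag_of R + frag_of ?N + frag_cmul 2 (frag_of pO)"
    using neg_div[OF x(1)] unfolding x(2) .
  let ?D = "frag_of R' + frag_of ?N + frag_cmul 2 (frag_of pO)"
  have "effective ?D" by (simp add: effective_def lookup_add)
  moreover have "lin_equiv C ?D (div_of_form C (\<lambda>y. a * y $ 2 + b * (y $ 1 + y $ 3)))"
    unfolding L(3) using lin_equiv_diff_cong[of "frag_of R'" "frag_of R" ?D] lin_equiv_sym[OF eq] by simp
  ultimately obtain L' where L': "form 1 L'" "nonzero L'" "?D = div_of_form C L'"
    using complete_linear_system[OF L(1,2)] by blast
  have lk: "lookup (div_of_form C L') pO = lookup ?D pO" using L'(3) by simp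
  have "mult_at C pO L' \<ge> 2" using lk torsion_C(1)
    by (simp add: lookup_div[OF L'(1,2)] lookup_add split: if_splits)
  then obtain a' b' where L'eq: "L' = (\<lambda>y. a' * y $ 2 + b' * (y $ 1 + y $ 3))"
    using linear_mult_2_at_O[OF L'(1,2)] by blast
  define L0 where "L0 = (\<lambda>y :: 'a ^ 4. a * y $ 2 + b * (y $ 1 + y $ 3))"
  note L = L[folded L0_def]
  \<comment> \<open>Proportionality of the two planes. If N differs from O it follows from their
    common zero N; if N is O, both planes vanish there to order 3.\<close>
  have "a * b' = a' * b"
  proof (cases "?N = pO")
    case False
    obtain z where z: "z \<in> cone" "?N = proj_class z" using C_rep[OF NC] .
    have "L0 z = 0" by (rule zero_of_div[OF L(1,2) NC z(2)]) (simp add: L(3) lookup_add)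
    moreover have "L' z = 0" by (rule zero_of_div[OF L'(1,2) NC z(2)]) (simp add: L'(3)[symmetric] lookup_add)
    ultimately have *: "a * z $ 2 = b * (z $ 1 + z $ 3)" "a' * z $ 2 = b' * (z $ 1 + z $ 3)"
      unfolding L0_def L'eq by (simp_all only: eq_iff_add[symmetric])
    have "z $ 2 \<noteq> 0" using False cone_coord_2[OF z(1)] z(2) by auto
    moreover have "(a * b') * z $ 2 = (a' * b) * z $ 2"
    proof -
      have "(a * b') * z $ 2 = b' * (a * z $ 2)" by (simp only: mult_ac)
      also have "\<dots> = b * (b' * (z $ 1 + z $ 3))" unfolding *(1) by (simp only: mult_ac)
      also have "\<dots> = (a' * b) * z $ 2" unfolding *(2)[symmetric] by (simp only: mult_ac)
      finally show ?thesis .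
    qed
    ultimately show ?thesis by simp
  next
    case True
    have "int (mult_at C pO L0) = lookup (div_of_form C L0) pO"
      "int (mult_at C pO L') = lookup (div_of_form C L') pO"
      using torsion_C(1) by (simp_all add: lookup_div[OF L(1,2)] lookup_div[OF L'(1,2)])
    then have "int (mult_at C pO L0) \<ge> 3" "int (mult_at C pO L') \<ge> 3"
      unfolding L(3) L'(3)[symmetric] True by (simp_all add: lookup_add)
    then have "mult_at C pO L0 \<ge> 3" "mult_at C pO L' \<ge> 3" by simp_all
    then have 3: "in_max pO 3 L0" "in_max pO 3 L'"
      using in_max_le[OF torsion_C(1) L(1,2)] in_max_le[OF torsion_C(1) L'(1,2)] by blast+
    have zero: "s = 0" if "in_max pO 3 (\<lambda>y. r * y $ 2 + s * (y $ 1 + y $ 3))" for r s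
    proof (rule ccontr)
      assume s: "s \<noteq> 0"
      have f: "form 1 (\<lambda>y :: 'a ^ 4. r * y $ 2 + s * (y $ 1 + y $ 3))" by (intro form_add form_scale form_var)
      have "in_max pO 3 (\<lambda>y. y $ 2)"
        using in_max_le[OF torsion_C(1) form_coord, of 3 2] mult_coord(3)[OF torsion_C(1)] by simp
      from in_max_add[OF torsion_C(1) f form_scale[OF form_coord(1)] that in_max_scale[OF torsion_C(1) form_coord(1) this, of r]]
      have "in_max pO 3 (\<lambda>y. s * (y $ 1 + y $ 3))" by (simp add: add_ac char2_simps)
      from in_max_scale[OF torsion_C(1) form_scale[OF form_sum13(1)] this, of "inverse s"]
      have "in_max pO 3 (\<lambda>y. y $ 1 + y $ 3)" using s by (simp flip: mult.assoc)
      then show False using in_max_le[OF torsion_C(1) form_sum13] mult_sum13[OF torsion_C(1)] by simp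
    qed
    have "b = 0" "b' = 0" using zero[of a b] zero[of a' b'] 3 unfolding L0_def L'eq by blast+
    then show ?thesis by simp
  qed
  then obtain r where r: "a' = r * a" "b' = r * b"
  proof (cases "a = 0")
    case True
    then have "b \<noteq> 0" using L(2) by (auto simp: L0_def nonzero_def)
    with True \<open>a * b' = a' * b\<close> that[of "b' / b"] show ?thesis by simp
  next
    case False
    with \<open>a * b' = a' * b\<close> that[of "a' / a"] show ?thesis by (simp add: field_simps)
  qed
  have L'r: "L' = (\<lambda>y. r * L0 y)" by (simp add: L'eq L0_def r algebra_simps)
  have "r \<noteq> 0" using L'(2) by (auto simp: L'r nonzero_def)
  have "div_of_form C L' = div_of_form C L0"
    using mult_scale[OF _ \<open>r \<noteq> 0\<close> L(1,2)]
    by (intro poly_mapping_eqI) (simp add: lookup_div[OF L'(1,2), unfolded L'r] lookup_div[OF L(1,2)] L'r)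
  then have "frag_of R' = frag_of R" using L(3) L'(3) by simp
  then show ?thesis by (simp add: frag_of_eq)
qed

section \<open>The group law\<close>

definition cls :: "('a ^ 4) set \<Rightarrow> ('a, 4) divisor" where
  "cls P = frag_of P - frag_of pO"

lemma cls_pO [simp]: "cls pO = 0"
  by (simp add: cls_def)

lemma cls_lin_equiv: "lin_equiv C (cls P) (cls Q) \<longleftrightarrow> lin_equiv C (frag_of P) (frag_of Q)"
  by (rule lin_equiv_diff_cong) (simp add: cls_def)

lemma cls_inj: "P \<in> C \<Longrightarrow> Q \<in> C \<Longrightarrow> lin_equiv C (cls P) (cls Q) \<Longrightarrow> P = Q"
  using lin_equiv_points_unique by (simp add: cls_lin_equiv)

lemma cls_add_iff:
  "lin_equiv C (frag_of P + frag_of Q) (frag_of R + frag_of pO) \<longleftrightarrow> lin_equiv C (cls P + cls Q) (cls R)"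
  by (rule lin_equiv_diff_cong) (simp add: cls_def)

lemma div_coord_2: "div_of_form C (\<lambda>y. y $ 2) = frag_cmul 4 (frag_of pO)"
  by (rule div_eqI[OF form_coord])
    (simp_all add: lookup_div[OF form_coord] mult_coord torsion_C divisor_degree_cmul divisor_degree_frag_of)

lemma cls_plane:
  assumes "form 1 L" "nonzero L"
    "div_of_form C L = frag_of P + frag_of Q + frag_of R + frag_of S"
  shows "lin_equiv C (cls P + cls Q + cls R + cls S) 0"
proof -
  from div_coord_2 lin_equiv_div[OF assms(1) form_coord(1) assms(2) form_coord(2), of 2] assms(3)
  have "lin_equiv C (frag_of P + frag_of Q + frag_of R + frag_of S) (frag_cmul 4 (frag_of pO))" by simp
  moreover have "frag_cmul 4 (frag_of pO) = frag_of pO + frag_of pO + frag_of pO + frag_of pO"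
    by (rule poly_mapping_eqI) (simp add: lookup_add)
  ultimately show ?thesis
    by (subst lin_equiv_diff_cong) (auto simp: cls_def algebra_simps)
qed

lemma cls_neg:
  assumes "x \<in> cone"
  shows "lin_equiv C (cls (proj_class x) + cls (proj_class (neg4 x))) 0"
proof -
  obtain a b where "form 1 (\<lambda>y :: 'a ^ 4. a * y $ 2 + b * (y $ 1 + y $ 3))"
    "nonzero (\<lambda>y. a * y $ 2 + b * (y $ 1 + y $ 3))"
    "div_of_form C (\<lambda>y. a * y $ 2 + b * (y $ 1 + y $ 3))
      = frag_of (proj_class x) + frag_of (proj_class (neg4 x)) + frag_cmul 2 (frag_of pO)"
    using neg_div[OF assms] .
  moreover have "frag_cmul 2 (frag_of pO) = frag_of pO + frag_of pO"
    by (rule poly_mapping_eqI) (simp add: lookup_add)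
  ultimately show ?thesis
    using cls_plane[of _ "proj_class x" "proj_class (neg4 x)" pO pO] by (simp add: add.assoc)
qed

lemma lin_equiv_cancel: "lin_equiv C (D + E) 0 \<Longrightarrow> lin_equiv C (E + E') 0 \<Longrightarrow> lin_equiv C D E'"
  using lin_equiv_add[of "D + E" 0 0 "E + E'"] lin_equiv_sym lin_equiv_diff_cong[of "D + E + 0" "0 + (E + E')" D E']
  by simp

text \<open>The plane through P, Q and O has a fourth intersection point with the curve; it
  represents the negative of the sum, and \<open>neg4\<close> supplies its inverse.\<close>

lemma sum_exists:
  assumes "P \<in> C" "Q \<in> C"
  shows "\<exists>R\<in>C. lin_equiv C (cls P + cls Q) (cls R)"
proof -
  obtain L R where L: "form 1 L" "nonzero L" "R \<in> C"
    "div_of_form C L = frag_of P + frag_of Q + frag_of pO + frag_of R"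
    using plane_through[OF assms] .
  obtain x where x: "x \<in> cone" "R = proj_class x" using C_rep[OF L(3)] .
  have "lin_equiv C (cls P + cls Q + cls R) 0" using cls_plane[OF L(1,2,4)] by simp
  then have "lin_equiv C (cls P + cls Q) (cls (proj_class (neg4 x)))"
    using cls_neg[OF x(1)] unfolding x(2) by (rule lin_equiv_cancel)
  moreover have "proj_class (neg4 x) \<in> C" using neg4_cone[OF x(1)] by (simp add: proj_class_C)
  ultimately show ?thesis by blast
qed

abbreviation "G \<equiv> point_group C pO"

lemma G_simps [simp]: "carrier G = C" "\<one>\<^bsub>G\<^esub> = pO"
  by (simp_all add: point_group_def)

lemma G_mult_eqI:
  assumes "R \<in> C" "lin_equiv C (cls P + cls Q) (cls R)"
  shows "P \<otimes>\<^bsub>G\<^esub> Q = R"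
proof -
  have "(THE R. R \<in> C \<and> lin_equiv C (frag_of P + frag_of Q) (frag_of R + frag_of pO)) = R"
    unfolding cls_add_iff
  proof (rule the_equality)
    fix R' assume "R' \<in> C \<and> lin_equiv C (cls P + cls Q) (cls R')"
    then show "R' = R" using assms cls_inj lin_equiv_trans lin_equiv_sym by blast
  qed (use assms in blast)
  then show ?thesis by (simp add: point_group_def)
qed

lemma G_mult:
  assumes "P \<in> C" "Q \<in> C"
  shows "P \<otimes>\<^bsub>G\<^esub> Q \<in> C" "lin_equiv C (cls P + cls Q) (cls (P \<otimes>\<^bsub>G\<^esub> Q))"
  using sum_exists[OF assms] G_mult_eqI by metis+

lemma comm_group_G: "comm_group G"
proof (rule comm_groupI, unfold G_simps)
  fix P Q R assume *: "P \<in> C" "Q \<in> C" "R \<in> C"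
  have 1: "lin_equiv C (cls P + cls (Q \<otimes>\<^bsub>G\<^esub> R)) (cls (P \<otimes>\<^bsub>G\<^esub> (Q \<otimes>\<^bsub>G\<^esub> R)))"
    by (intro G_mult *)
  have 2: "lin_equiv C (cls P + (cls Q + cls R)) (cls P + cls (Q \<otimes>\<^bsub>G\<^esub> R))"
    by (intro lin_equiv_add lin_equiv_refl G_mult *)
  have 3: "lin_equiv C (cls (P \<otimes>\<^bsub>G\<^esub> Q) + cls R) (cls P + cls Q + cls R)"
    by (intro lin_equiv_add lin_equiv_refl lin_equiv_sym[OF G_mult(2)] *)
  note lin_equiv_trans[OF 3 lin_equiv_trans[OF 2[folded add.assoc] 1]]
  then show "P \<otimes>\<^bsub>G\<^esub> Q \<otimes>\<^bsub>G\<^esub> R = P \<otimes>\<^bsub>G\<^esub> (Q \<otimes>\<^bsub>G\<^esub> R)"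
    by (intro G_mult_eqI G_mult *)
next
  fix P Q assume *: "P \<in> C" "Q \<in> C"
  have "lin_equiv C (cls P + cls Q) (cls (Q \<otimes>\<^bsub>G\<^esub> P))"
    using G_mult(2)[OF *(2,1)] by (simp add: add.commute)
  then show "P \<otimes>\<^bsub>G\<^esub> Q = Q \<otimes>\<^bsub>G\<^esub> P" by (intro G_mult_eqI G_mult *)
next
  fix P assume P: "P \<in> C"
  show "pO \<otimes>\<^bsub>G\<^esub> P = P" by (intro G_mult_eqI P) (simp add: lin_equiv_refl)
  obtain x where x: "x \<in> cone" "P = proj_class x" using C_rep[OF P] .
  have "proj_class (neg4 x) \<otimes>\<^bsub>G\<^esub> P = pO"
    using cls_neg[OF x(1)] torsion_C(1) by (intro G_mult_eqI) (simp_all add: x(2) add.commute)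
  then show "\<exists>Q\<in>C. Q \<otimes>\<^bsub>G\<^esub> P = pO" using neg4_cone[OF x(1)] proj_class_C by blast
qed (auto intro: G_mult torsion_C)

lemma inv_G:
  assumes "x \<in> cone"
  shows "inv\<^bsub>G\<^esub> (proj_class x) = proj_class (neg4 x)"
proof -
  interpret comm_group G by (rule comm_group_G)
  have "proj_class (neg4 x) \<otimes>\<^bsub>G\<^esub> proj_class x = pO"
    using cls_neg[OF assms] torsion_C(1) by (intro G_mult_eqI) (simp_all add: add.commute)
  then show ?thesis using assms neg4_cone by (intro inv_equality) (simp_all add: proj_class_C)
qed

lemma cls_pow:
  assumes "P \<in> C"
  shows "lin_equiv C (frag_cmul (int n) (cls P)) (cls (P [^]\<^bsub>G\<^esub> n))"
proof -
  interpret comm_group G by (rule comm_group_G)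
  show ?thesis
  proof (induction n)
    case (Suc n)
    have "lin_equiv C (frag_cmul (int n) (cls P) + cls P) (cls (P [^]\<^bsub>G\<^esub> n) + cls P)"
      by (intro lin_equiv_add lin_equiv_refl Suc)
    moreover have "lin_equiv C (cls (P [^]\<^bsub>G\<^esub> n) + cls P) (cls (P [^]\<^bsub>G\<^esub> Suc n))"
      using G_mult(2)[of "P [^]\<^bsub>G\<^esub> n" P] assms nat_pow_closed[of P n] by simp
    moreover have "frag_cmul (int (Suc n)) (cls P) = frag_cmul (int n) (cls P) + cls P"
      by (simp add: frag_cmul_distrib add.commute)
    ultimately show ?case using lin_equiv_trans by simp
  qed (simp add: lin_equiv_refl)
qed

lemma cls_finprod:
  assumes "finite A" "A \<subseteq> C"
  shows "finprod G (\<lambda>P. P [^]\<^bsub>G\<^esub> f P) A \<in> C \<and>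
    lin_equiv C (\<Sum>P\<in>A. frag_cmul (int (f P)) (cls P)) (cls (finprod G (\<lambda>P. P [^]\<^bsub>G\<^esub> (f P :: nat)) A))"
proof -
  interpret comm_group G by (rule comm_group_G)
  show ?thesis using assms
  proof (induction A)
    case empty
    then show ?case by (simp add: lin_equiv_refl torsion_C)
  next
    case (insert P A)
    let ?g = "\<lambda>P. P [^]\<^bsub>G\<^esub> f P"
    have g: "?g Q \<in> carrier G" if "Q \<in> C" for Q using that nat_pow_closed[of Q] by simp
    have fp: "finprod G ?g (insert P A) = ?g P \<otimes>\<^bsub>G\<^esub> finprod G ?g A"
      using insert g by (intro finprod_insert) auto
    have P: "P \<in> C" "?g P \<in> C" using insert.prems g[of P] by simp_all
    have A: "finprod G ?g A \<in> C"
      "lin_equiv C (\<Sum>P\<in>A. frag_cmul (int (f P)) (cls P)) (cls (finprod G ?g A))"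
      using insert by auto
    have "lin_equiv C (frag_cmul (int (f P)) (cls P) + (\<Sum>P\<in>A. frag_cmul (int (f P)) (cls P)))
      (cls (?g P) + cls (finprod G ?g A))"
      by (intro lin_equiv_add cls_pow P A)
    from lin_equiv_trans[OF this G_mult(2)[OF P(2) A(1)]] G_mult(1)[OF P(2) A(1)] show ?case
      unfolding fp using insert.hyps by simp
  qed
qed

text \<open>In divisor classes the sum becomes div H - 4(O) = div H - div X2, which is principal;
  injectivity of points modulo equivalence then gives O.\<close>

lemma plane_section_sum:
  assumes "form 1 H" "nonzero H"
  shows "finprod G (\<lambda>P. P [^]\<^bsub>G\<^esub> mult_at C P H) {P \<in> C. vanishes_at H P} = pO"
proof -
  let ?A = "{P \<in> C. vanishes_at H P}"
  have fin: "finite ?A" using finite_zeros[OF assms] zeros_eq[OF assms(1)] by simp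
  let ?S = "finprod G (\<lambda>P. P [^]\<^bsub>G\<^esub> mult_at C P H) ?A"
  have S: "?S \<in> C" "lin_equiv C (\<Sum>P\<in>?A. frag_cmul (int (mult_at C P H)) (cls P)) (cls ?S)"
    using cls_finprod[OF fin, of "\<lambda>P. mult_at C P H"] by auto
  have "(\<Sum>P\<in>?A. int (mult_at C P H)) = 4"
    using degree_div_sum[OF assms] degree_div[OF assms] zeros_eq[OF assms(1)] by simp
  moreover have "(\<Sum>P\<in>?A. frag_cmul (int (mult_at C P H)) (frag_of pO))
      = frag_cmul (\<Sum>P\<in>?A. int (mult_at C P H)) (frag_of pO)"
    by (rule poly_mapping_eqI) (simp add: lookup_sum sum_distrib_right)
  ultimately have "(\<Sum>P\<in>?A. frag_cmul (int (mult_at C P H)) (cls P)) = div_of_form C H - frag_cmul 4 (frag_of pO)"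
    by (simp add: cls_def frag_cmul_minus sum_subtractf div_of_form_def)
  with div_coord_2 have "lin_equiv C (\<Sum>P\<in>?A. frag_cmul (int (mult_at C P H)) (cls P)) (cls pO)"
    using lin_equiv_div[OF assms(1) form_coord(1) assms(2) form_coord(2), of 2] by (simp add: lin_equiv_def)
  from cls_inj[OF S(1) torsion_C(1) lin_equiv_trans[OF lin_equiv_sym[OF S(2)] this]] show ?thesis .
qed

section \<open>Translation by \<open>T\<close>\<close>

text \<open>The expected formula for -(x + T), obtained by composing the cyclic shift of the
  coordinates with the inverse.\<close>

definition rev4 :: "'a ^ 4 \<Rightarrow> 'a ^ 4" where
  "rev4 x = vec4 (x $ 3) (x $ 2) (x $ 1) (x $ 0)"

lemma rev4_nth [simp]: "rev4 x $ 0 = x $ 3" "rev4 x $ 1 = x $ 2" "rev4 x $ 2 = x $ 1" "rev4 x $ 3 = x $ 0"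
  by (simp_all add: rev4_def)

lemma rev4_rev4 [simp]: "rev4 (rev4 x) = x"
  by (simp add: vec4_eq_iff)

lemma rev4_cone: "x \<in> cone \<Longrightarrow> rev4 x \<in> cone"
  by (auto simp: cone_def vec4_eq_iff add.commute mult.commute mult.left_commute)

lemma rev4_scale: "rev4 (s *s x) = s *s rev4 x"
  by (simp add: vec4_eq_iff)

lemma rev4_torsion: "rev4 O4 = W4" "rev4 W4 = O4" "rev4 T4 = U4" "rev4 U4 = T4"
  by (simp_all add: vec4_eq_iff torsion_defs)

text \<open>Together with \<open>plane_O\<close> a basis of the pencil of planes through O and T:
  this one is tangent at T and \<open>plane_O\<close> is tangent at O, the residual points being U
  and W.\<close>

definition plane_T :: "'a ^ 4 \<Rightarrow> 'a" where "plane_T y = y $ 0 + y $ 2 + e * y $ 3"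
definition plane_O :: "'a ^ 4 \<Rightarrow> 'a" where "plane_O y = y $ 1 + y $ 3 + e * y $ 2"

lemma form_plane_T: "form 1 plane_T" "nonzero plane_T"
proof -
  show *: "form 1 plane_T" unfolding plane_T_def[abs_def] by (intro form_add form_scale form_var)
  show "nonzero plane_T" by (rule nonzero_linearI[OF *, of "vec4 1 0 0 0"]) (simp add: plane_T_def)
qed

lemma form_plane_O: "form 1 plane_O" "nonzero plane_O"
proof -
  show *: "form 1 plane_O" unfolding plane_O_def[abs_def] by (intro form_add form_scale form_var)
  show "nonzero plane_O" by (rule nonzero_linearI[OF *, of "vec4 0 1 0 0"]) (simp add: plane_O_def)
qed

lemma div_plane_T: "div_of_form C plane_T = frag_of pT + frag_of pT + frag_of pO + frag_of pU"
proof (rule div_eqI[OF form_plane_T])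
  have "plane_T O4 = 0" "plane_T U4 = 0" by (simp_all add: plane_T_def torsion_defs char2_simps)
  then have "mult_at C pO plane_T \<ge> 1" "mult_at C pU plane_T \<ge> 1"
    using mult_pos_rep[OF _ form_plane_T] torsion_cone by (simp_all add: Suc_le_eq)
  moreover have "in_max pT 2 plane_T"
  proof -
    have "in_max pT 2 (\<lambda>y. y $ 0 + y $ 2)" "in_max pT 2 (\<lambda>y. y $ 3)"
      using in_max_le[OF torsion_C(2) form_coord, of 2 3] in_max_le[OF torsion_C(2) form_sum02, of 2]
        mult_coord(4)[OF torsion_C(2)] mult_sum02[OF torsion_C(2)] by auto
    from in_max_add[OF torsion_C(2) form_sum02(1) form_scale[OF form_coord(1)] this(1)
        in_max_scale[OF torsion_C(2) form_coord(1) this(2)]]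
    show ?thesis unfolding plane_T_def[abs_def] .
  qed
  then have "mult_at C pT plane_T \<ge> 2" using in_max_le[OF torsion_C(2) form_plane_T] by blast
  ultimately show "lookup (frag_of pT + frag_of pT + frag_of pO + frag_of pU) P
      \<le> lookup (div_of_form C plane_T) P" for P
    using torsion_C torsion_distinct by (auto simp: lookup_add lookup_div[OF form_plane_T])
qed (simp add: divisor_degree_add divisor_degree_frag_of)

lemma div_plane_O: "div_of_form C plane_O = frag_of pO + frag_of pT + frag_of pO + frag_of pW"
proof (rule div_eqI[OF form_plane_O])
  have "plane_O T4 = 0" "plane_O W4 = 0" by (simp_all add: plane_O_def torsion_defs char2_simps)
  then have "mult_at C pT plane_O \<ge> 1" "mult_at C pW plane_O \<ge> 1"
    using mult_pos_rep[OF _ form_plane_O] torsion_cone by (simp_all add: Suc_le_eq)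
  moreover have "in_max pO 2 plane_O"
    using in_max_pencil_O[of e 1] by (simp add: plane_O_def[abs_def] add.commute)
  then have "mult_at C pO plane_O \<ge> 2" using in_max_le[OF torsion_C(1) form_plane_O] by blast
  ultimately show "lookup (frag_of pO + frag_of pT + frag_of pO + frag_of pW) P
      \<le> lookup (div_of_form C plane_O) P" for P
    using torsion_C torsion_distinct by (auto simp: lookup_add lookup_div[OF form_plane_O])
qed (simp add: divisor_degree_add divisor_degree_frag_of)

lemma pencil_OT:
  assumes "form 1 L" "L O4 = 0" "L T4 = 0"
  obtains a b where "L = (\<lambda>y. a * plane_T y + b * plane_O y)"
proof -
  obtain a b c d where L: "L = (\<lambda>x. a * x $ 0 + b * x $ 1 + c * x $ 2 + d * x $ 3)"
    using assms(1) form_1_vec4 by blast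
  with assms have "d + (a * e + b) = 0" "c + (a + b * e) = 0" by (simp_all add: torsion_defs add_ac)
  then have "d = a * e + b" "c = a + b * e" using eq_iff_add by metis+
  then have "L = (\<lambda>y. a * plane_T y + b * plane_O y)"
    by (simp add: L plane_T_def plane_O_def fun_eq_iff algebra_simps)
  with that show ?thesis by blast
qed

text \<open>The difference of both sides is the sum of the two defining equations. Thus the ratio of
  \<open>plane_T\<close> to \<open>plane_O\<close>, the parameter of the pencil, agrees at
  \<open>x\<close> and \<open>rev4 x\<close> wherever it is defined at both.\<close>

lemma rev_identity:
  assumes "x \<in> cone"
  shows "plane_T x * plane_O (rev4 x) = plane_O x * plane_T (rev4 x)"
proof -
  have "plane_T x * plane_O (rev4 x) + plane_O x * plane_T (rev4 x)
    = (x $ 0 + x $ 2)\<^sup>2 + e\<^sup>2 * x $ 1 * x $ 3 + ((x $ 1 + x $ 3)\<^sup>2 + e\<^sup>2 * x $ 0 * x $ 2)"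
    unfolding plane_T_def plane_O_def by (simp add: power2_eq_square algebra_simps char2_simps)
  also have "\<dots> = 0" unfolding coneD(1,2)[OF assms] by (simp add: char2_simps)
  finally show ?thesis by (rule eq_iff_add[THEN iffD2])
qed

lemma plane_T_plane_O_zero:
  assumes x: "x \<in> cone" and "plane_T x = 0" "plane_O x = 0"
  shows "proj_class x = pO \<or> proj_class x = pT"
proof -
  have 1: "x $ 0 + x $ 2 = e * x $ 3" "x $ 1 + x $ 3 = e * x $ 2"
    using assms(2,3) eq_iff_add unfolding plane_T_def plane_O_def by blast+
  have "x $ 3 = 0 \<or> x $ 3 = x $ 1"
    using coneD(1)[OF x] e_nz unfolding 1 by (auto simp: power2_eq_square)
  moreover have "x $ 2 = 0" if "x $ 3 = x $ 1"
    using 1(2) e_nz unfolding that by (simp add: add_self)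
  ultimately have "x $ 3 = 0 \<or> x $ 2 = 0" by blast
  then show ?thesis using cone_coord_3[OF x] cone_coord_2[OF x] by auto
qed

text \<open>Reversal is an involution, so the scaling factor of a fixed point has square 1; in
  characteristic 2 it is 1 itself.\<close>

lemma rev_fixed:
  assumes "x \<in> cone" "proj_class (rev4 x) = proj_class x"
  shows "x $ 3 = x $ 0" "x $ 2 = x $ 1"
proof -
  obtain s where s: "s \<noteq> 0" "rev4 x = s *s x" using assms(2) proj_class_eq_iff by metis
  have "rev4 x $ i = s * x $ i" for i unfolding s(2) by simp
  from this[of 0] this[of 1] this[of 2] this[of 3]
  have *: "x $ 3 = s * x $ 0" "x $ 2 = s * x $ 1" "x $ 1 = s * x $ 2" "x $ 0 = s * x $ 3"
    unfolding rev4_nth .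
  have "(1 - s\<^sup>2) * v = 0" if "v = s * (s * v)" for v
  proof -
    have "(1 - s\<^sup>2) * v = v - s * (s * v)" by (simp add: left_diff_distrib power2_eq_square mult.assoc)
    then show ?thesis unfolding that[symmetric] by simp
  qed
  from this[OF *(3)[unfolded *(2)]] this[OF *(1)[unfolded *(4)]]
  have "(1 - s\<^sup>2) * x $ 1 = 0" "(1 - s\<^sup>2) * x $ 3 = 0" .
  with cone_1_3[OF assms(1)] have "s\<^sup>2 = 1\<^sup>2" by auto
  then have s1: "s = 1" unfolding square_inj .
  show "x $ 3 = x $ 0" "x $ 2 = x $ 1" using *(1,2) unfolding s1 mult_1_left .
qed

text \<open>The identity \<open>rev_identity\<close> shows that a plane through \<open>O\<close>, \<open>T\<close> and \<open>x\<close> passes through \<open>rev4 x\<close>;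
  the remaining work is to exclude that multiplicities spoil this.\<close>

lemma translation_plane:
  assumes x: "x \<in> cone"
  obtains L where "form 1 L" "nonzero L"
    "div_of_form C L = frag_of (proj_class x) + frag_of pT + frag_of pO + frag_of (proj_class (rev4 x))"
proof -
  let ?P = "proj_class x" and ?Q = "proj_class (rev4 x)"
  have PC: "?P \<in> C" using x by (simp add: proj_class_C)
  have rev_cong: "proj_class (rev4 a) = proj_class (rev4 b)" if "proj_class a = proj_class b" for a b
    using that by (auto simp: proj_class_eq_iff rev4_scale)
  \<comment> \<open>Reversal exchanges O with W and T with U; for these four points the plane is one
    of the two with known divisor. For all others it is a combination with both coefficients
    nonzero, and the reversed point is neither O nor T.\<close>
  consider "?P = pO" | "?P = pT" | "?P = pU" | "?P = pW" | "?P \<notin> {pO, pT, pU, pW}" by blast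
  then show ?thesis
  proof cases
    case 1
    with rev_cong[OF 1] that[OF form_plane_O] div_plane_O show ?thesis by (simp add: rev4_torsion)
  next
    case 2
    with rev_cong[OF 2] that[OF form_plane_T] div_plane_T show ?thesis by (simp add: rev4_torsion)
  next
    case 3
    with rev_cong[OF 3] that[OF form_plane_T] div_plane_T show ?thesis by (simp add: rev4_torsion add_ac)
  next
    case 4
    with rev_cong[OF 4] that[OF form_plane_O] div_plane_O show ?thesis by (simp add: rev4_torsion add_ac)
  next
    case 5
    obtain L R where L: "form 1 L" "nonzero L" "R \<in> C"
      "div_of_form C L = frag_of ?P + frag_of pT + frag_of pO + frag_of R"
      using plane_through[OF PC torsion_C(2)] .
    have zeros: "L y = 0 \<longleftrightarrow> proj_class y \<in> {?P, pT, pO, R}" if "y \<in> cone" for y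
    proof -
      have "proj_class y \<in> C" using that by (simp add: proj_class_C)
      then have "int (mult_at C (proj_class y) L) = lookup (frag_of ?P + frag_of pT + frag_of pO + frag_of R) (proj_class y)"
        using lookup_div[OF L(1,2)] L(4) by metis
      then show ?thesis using mult_pos_rep[OF that L(1,2)] by (auto simp: lookup_add split: if_splits)
    qed
    obtain a b where Lab: "L = (\<lambda>y. a * plane_T y + b * plane_O y)"
      using pencil_OT[OF L(1)] zeros torsion_cone by blast
    have not_plane_T: "b \<noteq> 0"
    proof
      assume "b = 0"
      then have "L = (\<lambda>y. a * plane_T y)" "a \<noteq> 0" using L(2) by (auto simp: Lab nonzero_def)
      moreover have "L x = 0" using zeros[OF x] by simp
      ultimately have "mult_at C ?P plane_T > 0" using mult_pos_rep[OF x form_plane_T] by simp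
      then show False using 5 PC arg_cong[OF div_plane_T, of "\<lambda>D. lookup D ?P"]
        by (simp add: lookup_div[OF form_plane_T] lookup_add)
    qed
    have not_plane_O: "a \<noteq> 0"
    proof
      assume "a = 0"
      then have "L = (\<lambda>y. b * plane_O y)" "b \<noteq> 0" using L(2) by (auto simp: Lab nonzero_def)
      moreover have "L x = 0" using zeros[OF x] by simp
      ultimately have "mult_at C ?P plane_O > 0" using mult_pos_rep[OF x form_plane_O] by simp
      then show False using 5 PC arg_cong[OF div_plane_O, of "\<lambda>D. lookup D ?P"]
        by (simp add: lookup_div[OF form_plane_O] lookup_add)
    qed
    have rev_zero: "L (rev4 y) = 0" if y: "y \<in> cone" "L y = 0" "proj_class y \<notin> {pO, pT}" for y
    proof -
      have 1: "a * plane_T y = b * plane_O y" using y(2) eq_iff_add unfolding Lab by blast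
      have nz: "plane_T y \<noteq> 0" "plane_O y \<noteq> 0" using 1 plane_T_plane_O_zero[OF y(1)] y(3) not_plane_T not_plane_O by auto
      have "plane_T y * (a * plane_T (rev4 y)) = b * (plane_O y * plane_T (rev4 y))" using 1 by (metis mult.commute mult.left_commute)
      also have "\<dots> = plane_T y * (b * plane_O (rev4 y))" unfolding rev_identity[OF y(1), symmetric] by (simp add: mult_ac)
      finally have "a * plane_T (rev4 y) = b * plane_O (rev4 y)" using nz by simp
      then show ?thesis unfolding Lab by (simp add: char2_simps)
    qed
    have rev_ne: "proj_class (rev4 y) \<notin> {pO, pT}" if "proj_class y \<notin> {pU, pW}" for y
      using rev_cong[of "rev4 y" O4] rev_cong[of "rev4 y" T4] that by (auto simp: rev4_torsion)
    have "?Q \<in> {?P, pT, pO, R}"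
      using rev_zero[OF x] zeros[OF x] zeros[OF rev4_cone[OF x]] 5 by auto
    with rev_ne[of x] 5 have "?Q = ?P \<or> ?Q = R" by auto
    \<comment> \<open>If reversal fixes \<open>x\<close>, the zero \<open>rev4 x\<close> says
      nothing new about \<open>R\<close>. Were \<open>R\<close> another point, it would be a zero of
      \<open>L\<close> apart from O, T and \<open>x\<close>, and fixed by reversal as well.\<close>
    moreover have "R = ?P" if PQ: "?Q = ?P"
    proof (rule ccontr)
      assume RP: "R \<noteq> ?P"
      obtain z where z: "z \<in> cone" "R = proj_class z" using C_rep[OF L(3)] .
      have Lz: "L z = 0" using zeros[OF z(1)] z(2) by simp
      have LUW: "L U4 \<noteq> 0" "L W4 \<noteq> 0"
        using not_plane_T not_plane_O e_nz by (simp_all add: Lab plane_T_def plane_O_def torsion_defs char2_simps)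
      have "R \<noteq> pU" "R \<noteq> pW" using zeros[OF torsion_cone(3)] zeros[OF torsion_cone(4)] LUW by blast+
      have ne: "pO \<noteq> ?P" "pT \<noteq> ?P" "pT \<noteq> pO" using 5 torsion_distinct by blast+
      have "int (mult_at C pO L) = lookup (div_of_form C L) pO"
        "int (mult_at C pT L) = lookup (div_of_form C L) pT"
        using torsion_C by (simp_all add: lookup_div[OF L(1,2)])
      then have m1: "R = pO \<Longrightarrow> mult_at C pO L = 2" "R = pT \<Longrightarrow> mult_at C pT L = 2"
        unfolding L(4) using ne ne(3)[symmetric] by (simp_all add: lookup_add)
      have mO: "mult_at C pO plane_T = 1" "mult_at C pT plane_O = 1" "mult_at C pO plane_O = 2" "mult_at C pT plane_T = 2"
      proof -
        have "int (mult_at C pO plane_T) = lookup (div_of_form C plane_T) pO"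
          "int (mult_at C pT plane_O) = lookup (div_of_form C plane_O) pT"
          "int (mult_at C pO plane_O) = lookup (div_of_form C plane_O) pO"
          "int (mult_at C pT plane_T) = lookup (div_of_form C plane_T) pT"
          using torsion_C by (simp_all add: lookup_div[OF form_plane_T] lookup_div[OF form_plane_O])
        then show "mult_at C pO plane_T = 1" "mult_at C pT plane_O = 1" "mult_at C pO plane_O = 2" "mult_at C pT plane_T = 2"
          unfolding div_plane_T div_plane_O using torsion_distinct by (auto simp: lookup_add)
      qed
      \<comment> \<open>Otherwise \<open>L\<close> and \<open>plane_O\<close> would both have
        multiplicity 2 at O, hence also \<open>plane_T\<close>, which has multiplicity 1. The same
        argument with the planes exchanged works at T.\<close>
      have "R \<noteq> pO"
      proof
        assume "R = pO"
        then have "in_max pO 2 L" "in_max pO 2 plane_O"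
          using m1 mO in_max_le[OF torsion_C(1) L(1,2), of 2] in_max_le[OF torsion_C(1) form_plane_O, of 2] by simp_all
        from in_max_add[OF torsion_C(1) L(1) form_scale[OF form_plane_O(1)] this(1) in_max_scale[OF torsion_C(1) form_plane_O(1) this(2), of b]]
        have "in_max pO 2 (\<lambda>y. a * plane_T y)" by (simp add: Lab add.assoc char2_simps)
        from in_max_scale[OF torsion_C(1) form_scale[OF form_plane_T(1)] this, of "inverse a"]
        have "in_max pO 2 plane_T" using not_plane_O by (simp flip: mult.assoc)
        with in_max_le[OF torsion_C(1) form_plane_T, of 2] mO show False by simp
      qed
      have "R \<noteq> pT"
      proof
        assume "R = pT"
        then have "in_max pT 2 L" "in_max pT 2 plane_T"
          using m1 mO in_max_le[OF torsion_C(2) L(1,2), of 2] in_max_le[OF torsion_C(2) form_plane_T, of 2] by simp_all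
        from in_max_add[OF torsion_C(2) form_scale[OF form_plane_T(1)] L(1) in_max_scale[OF torsion_C(2) form_plane_T(1) this(2), of a] this(1)]
        have "in_max pT 2 (\<lambda>y. b * plane_O y)" by (simp add: Lab add_self_left)
        from in_max_scale[OF torsion_C(2) form_scale[OF form_plane_O(1)] this, of "inverse b"]
        have "in_max pT 2 plane_O" using not_plane_T by (simp flip: mult.assoc)
        with in_max_le[OF torsion_C(2) form_plane_O, of 2] mO show False by simp
      qed
      let ?Rr = "proj_class (rev4 z)"
      have "?Rr \<in> {?P, pT, pO, R}"
        using rev_zero[OF z(1) Lz] \<open>R \<noteq> pO\<close> \<open>R \<noteq> pT\<close> zeros[OF rev4_cone[OF z(1)]] z(2) by auto
      moreover have "?Rr \<notin> {pO, pT}" using rev_ne[of z] \<open>R \<noteq> pU\<close> \<open>R \<noteq> pW\<close> z(2) by auto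
      moreover have "?Rr \<noteq> ?P"
      proof
        assume "?Rr = ?P"
        from rev_cong[OF this] have "R = ?Q" by (simp add: z(2))
        with PQ RP show False by simp
      qed
      ultimately have "?Rr = R" by auto
      then have zf: "z $ 3 = z $ 0" "z $ 2 = z $ 1" using rev_fixed[OF z(1)] z(2) by auto
      have xf: "x $ 3 = x $ 0" "x $ 2 = x $ 1" using rev_fixed[OF x PQ] by auto
      \<comment> \<open>On the line X3 = X0, X2 = X1 of fixed vectors \<open>L\<close> becomes r X0
        + s X1. Two distinct zeros on this line force r = s = 0, and then a e^2 = 0.\<close>
      define r where "r = a * (1 + e) + b"
      define s where "s = a + b * (1 + e)"
      have "L x = r * x $ 0 + s * x $ 1" "L z = r * z $ 0 + s * z $ 1"
        by (simp_all add: Lab plane_T_def plane_O_def xf zf r_def s_def algebra_simps char2_simps)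
      then have rs: "r * x $ 0 = s * x $ 1" "r * z $ 0 = s * z $ 1"
        using Lz zeros[OF x] eq_iff_add by auto
      have xnz: "x $ 1 \<noteq> 0" "x $ 0 \<noteq> 0" 
        using 5 cone_coord_1[OF x] cone_coord_0[OF x] by auto
      have rs0: "r = 0 \<and> s = 0"
      proof (rule ccontr)
        assume "\<not> ?thesis"
        then have rn: "r \<noteq> 0" "s \<noteq> 0" using rs(1) xnz by auto
        have "z = (z $ 1 / x $ 1) *s x"
        proof -
          have "r * (z $ 0 * x $ 1) = (r * z $ 0) * x $ 1" by (simp only: mult_ac)
          also have "\<dots> = z $ 1 * (r * x $ 0)" unfolding rs by (simp only: mult_ac)
          also have "\<dots> = r * (z $ 1 * x $ 0)" by (simp only: mult_ac)
          finally have "z $ 0 * x $ 1 = z $ 1 * x $ 0" using rn by simp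
          then have "z $ 0 = z $ 1 / x $ 1 * x $ 0" using xnz by (simp add: field_simps)
          then show ?thesis using xnz by (simp add: vec4_eq_iff zf xf)
        qed
        then have "R = ?P" unfolding z(2) by (rule cone_proj_eqI[OF z(1)])
        with RP show False ..
      qed
      then have "b = a * (1 + e)" using eq_iff_add unfolding r_def by metis
      moreover have "s = 0" using rs0 by simp
      ultimately have "a * e\<^sup>2 = 0"
        unfolding s_def by (simp add: power2_eq_square algebra_simps char2_simps)
      with e_nz not_plane_O show False by simp
    qed
    ultimately have "R = ?Q" by auto
    with that L show ?thesis by simp
  qed
qed

text \<open>The plane section x + T + O + \<open>rev4 x\<close> sums to zero, so x + T is the
  inverse of \<open>rev4 x\<close>, whose coordinates are the cyclic shift.\<close>

lemma translation:
  assumes x: "x \<in> cone"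
  shows "proj_class x \<otimes>\<^bsub>G\<^esub> pT = proj_class (vec4 (x $ 3) (x $ 0) (x $ 1) (x $ 2))"
proof -
  obtain L where L: "form 1 L" "nonzero L"
    "div_of_form C L = frag_of (proj_class x) + frag_of pT + frag_of pO + frag_of (proj_class (rev4 x))"
    using translation_plane[OF x] .
  from cls_plane[OF L] have "lin_equiv C (cls (proj_class x) + cls pT + cls (proj_class (rev4 x))) 0" by simp
  from lin_equiv_cancel[OF this cls_neg[OF rev4_cone[OF x]]]
  have "lin_equiv C (cls (proj_class x) + cls pT) (cls (proj_class (neg4 (rev4 x))))" .
  moreover have "neg4 (rev4 x) = vec4 (x $ 3) (x $ 0) (x $ 1) (x $ 2)" by (simp add: vec4_eq_iff)
  moreover have "proj_class (neg4 (rev4 x)) \<in> C" using x neg4_cone rev4_cone by (simp add: proj_class_C)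
  ultimately show ?thesis by (intro G_mult_eqI) simp_all
qed

end

section \<open>Rational points and the statements over the base field\<close>

lemma to_ac_vec4: "(\<chi> i. to_ac (vec4 a b c d $ i)) = vec4 (to_ac a) (to_ac b) (to_ac c) (to_ac d)"
  by (simp add: vec4_eq_iff)

lemma rational_vec4:
  assumes "(a, b, c, d) \<noteq> (0, 0, 0, 0)"
  shows "rational_point (proj_class (vec4 (to_ac a) (to_ac b) (to_ac c) (to_ac d)))"
  unfolding rational_point_def
  by (rule exI[of _ "vec4 a b c d"]) (use assms in \<open>auto simp: to_ac_vec4 vec4_eq_iff\<close>)

theorem theorem10:
  fixes c :: "'k::field"
  assumes "CHAR('k) = 2"
    and "c \<noteq> 0"
    and "elliptic_curve (mu4_curve c) (mu4_O c)"
  shows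
    "is_embedding_divisor_class (mu4_curve c) (mu4_O c)
        (divisor_class (mu4_curve c) (frag_cmul 4 (frag_of (mu4_O c)))) \<and>
     (mu4_T c \<in> mu4_curve c \<and> rational_point (mu4_T c) \<and>
        mu4_T c [^]\<^bsub>point_group (mu4_curve c) (mu4_O c)\<^esub> (4::nat) = mu4_O c \<and>
        (\<forall>m::nat. 0 < m \<and> m < 4 \<longrightarrow>
           mu4_T c [^]\<^bsub>point_group (mu4_curve c) (mu4_O c)\<^esub> m \<noteq> mu4_O c)) \<and>
     (\<forall>x0 x1 x2 x3. hom_coords x0 x1 x2 x3 \<in> mu4_curve c \<longrightarrow>
        hom_coords x0 x1 x2 x3 \<otimes>\<^bsub>point_group (mu4_curve c) (mu4_O c)\<^esub> mu4_T c
          = hom_coords x3 x0 x1 x2) \<and>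
     (\<forall>x0 x1 x2 x3. hom_coords x0 x1 x2 x3 \<in> mu4_curve c \<longrightarrow>
        inv\<^bsub>point_group (mu4_curve c) (mu4_O c)\<^esub> (hom_coords x0 x1 x2 x3)
          = hom_coords x0 x3 x2 x1)"
proof -
  define C where "C = mu4_curve c"
  interpret mu4 "to_ac c" C
  proof
    show "CHAR('k alg_closure) = 2" using assms(1) by simp
    show "to_ac c \<noteq> 0" using assms(2) by simp
    show "C = {P \<in> proj_space. \<forall>x\<in>P. (x $ 0 + x $ 2)\<^sup>2 = (to_ac c)\<^sup>2 * x $ 1 * x $ 3 \<and>
        (x $ 1 + x $ 3)\<^sup>2 = (to_ac c)\<^sup>2 * x $ 0 * x $ 2}" by (simp add: C_def mu4_curve_def)
    show "irreducible_set C" using assms(3) by (simp add: C_def elliptic_curve_def)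
  qed
  have O: "mu4_O c = pO" and T: "mu4_T c = pT"
    by (simp_all add: mu4_O_def mu4_T_def hom_coords_vec4 torsion_defs)
  interpret G: comm_group G by (rule comm_group_G)
  have rat_O: "rational_point pO" and rat_T: "rational_point pT"
    using rational_vec4[of c 1 0 1] rational_vec4[of 1 c 1 0] by (simp_all add: torsion_defs)
  have complete: "embedded_by_complete_linear_system C CARD(4)"
    unfolding embedded_by_complete_linear_system_def
  proof (intro conjI allI impI)
    fix H assume H: "form 1 H \<and> vanishes_on H C"
    then have "H = (\<lambda>x. 0)" using linear_nonzero nonzero_iff by blast
    then show "H = 0" by (simp add: zero_fun_def)
  next
    fix H assume H: "form 1 H \<and> \<not> vanishes_on H C"
    then have H': "form 1 H" "nonzero H" using nonzero_iff by blast+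
    show "divisor_degree (div_of_form C H) = int CARD(4)" using degree_div[OF H'] by simp
    fix D assume "divisor_on C D \<and> effective D \<and> lin_equiv C D (div_of_form C H)"
    then show "\<exists>L. form 1 L \<and> \<not> vanishes_on L C \<and> D = div_of_form C L"
      using complete_linear_system[OF H'] nonzero_iff by blast
  qed
  \<comment> \<open>The common sum of the plane sections is S = O, so the class 3(O) + (S) is that
    of 4(O).\<close>
  have "frag_cmul (int CARD(4) - 1) (frag_of pO) + frag_of pO = frag_cmul 4 (frag_of pO)"
    by (rule poly_mapping_eqI) (simp add: lookup_add)
  moreover have "\<forall>H. form 1 H \<and> \<not> vanishes_on H C \<longrightarrow>
      finprod G (\<lambda>P. P [^]\<^bsub>G\<^esub> mult_at C P H) {P \<in> C. vanishes_at H P} = pO"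
    using plane_section_sum nonzero_iff by blast
  ultimately have 1: "is_embedding_divisor_class C pO (divisor_class C (frag_cmul 4 (frag_of pO)))"
    unfolding is_embedding_divisor_class_def using complete torsion_C(1) rat_O
    by (intro conjI bexI[of _ pO]) simp_all
  \<comment> \<open>Translation shifts coordinates cyclically, so the multiples of T run through T,
    U, W and O; these are distinct, which makes the order exactly 4.\<close>
  have TT: "pT \<otimes>\<^bsub>G\<^esub> pT = pU" "pU \<otimes>\<^bsub>G\<^esub> pT = pW" "pW \<otimes>\<^bsub>G\<^esub> pT = pO"
    using torsion_cone by (simp_all add: translation) (simp_all add: torsion_defs)
  have pow: "pT [^]\<^bsub>G\<^esub> (1::nat) = pT" "pT [^]\<^bsub>G\<^esub> (2::nat) = pU" "pT [^]\<^bsub>G\<^esub> (3::nat) = pW" "pT [^]\<^bsub>G\<^esub> (4::nat) = pO"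
    using torsion_C(2) G.l_one[of pT] by (simp_all add: numeral_eq_Suc TT)
  have ne: "pT [^]\<^bsub>G\<^esub> m \<noteq> pO" if "0 < m \<and> m < 4" for m :: nat
  proof -
    from that consider "m = 1" | "m = 2" | "m = 3" by linarith
    then show ?thesis using pow torsion_distinct by cases auto
  qed
  have tr: "hom_coords x0 x1 x2 x3 \<otimes>\<^bsub>G\<^esub> pT = hom_coords x3 x0 x1 x2"
    and inv: "inv\<^bsub>G\<^esub> (hom_coords x0 x1 x2 x3) = hom_coords x0 x3 x2 x1"
    if "hom_coords x0 x1 x2 x3 \<in> C" for x0 x1 x2 x3
    using that by (simp_all add: hom_coords_vec4 proj_class_C translation inv_G neg4_def)
  show ?thesis
    unfolding C_def[symmetric] O T using 1 torsion_C(2) rat_T pow(4) ne tr inv by blast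
qed

end
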